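(* Let $G=(V,E)$ be a simple graph and let $(P_A,P_B,P_C)$ be a partition of $E$ into three pseudoforests. Then this partition can be converted, in linear time, into a partition of $E$ into four forests, one of which has maximum degree at most three.
   Context: A pseudoforest is a graph in which each connected component contains at most one cycle. *)

theory Defs
  imports Main
begin

section \<open>Graphs\<close>

definition simple_graph :: "'a set \<Rightarrow> 'a set set \<Rightarrow> bool" where
  "simple_graph V E \<longleftrightarrow> finite V \<and> (\<forall>e\<in>E. e \<subseteq> V \<and> card e = 2)"

text \<open>Throughout, an edge set on \<open>V\<close> stands for the spanning subgraph of the complete graph on
  \<open>V\<close> with these edges. A cycle is identified with its set of edges, so the choice of a starting
  vertex or of an orientation does not give a different cycle.\<close>

definition cycle_edges :: "'a list \<Rightarrow> 'a set set" where
  "cycle_edges vs = {{vs ! i, vs ! (Suc i mod length vs)} | i. i < length vs}"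

definition is_cycle :: "'a set set \<Rightarrow> 'a set set \<Rightarrow> bool" where
  "is_cycle E C \<longleftrightarrow> C \<subseteq> E \<and> (\<exists>vs. 3 \<le> length vs \<and> distinct vs \<and> C = cycle_edges vs)"

definition components :: "'a set \<Rightarrow> 'a set set \<Rightarrow> 'a set set" where
  "components V E = V // {(u, v). u \<in> V \<and> v \<in> V \<and> (u, v) \<in> {(x, y). {x, y} \<in> E}\<^sup>*}"

definition forest :: "'a set set \<Rightarrow> bool" where
  "forest E \<longleftrightarrow> (\<nexists>C. is_cycle E C)"

definition pseudoforest :: "'a set \<Rightarrow> 'a set set \<Rightarrow> bool" where
  "pseudoforest V E \<longleftrightarrow> (\<forall>K \<in> components V E. \<exists>\<^sub>\<le>\<^sub>1 C. is_cycle {e \<in> E. e \<subseteq> K} C)"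

definition degree :: "'a set set \<Rightarrow> 'a \<Rightarrow> nat" where
  "degree E v = card {e \<in> E. v \<in> e}"

text \<open>Parts may be empty, unlike in \<open>partition_on\<close>.\<close>

definition edge_partition :: "'a set set \<Rightarrow> 'a set set list \<Rightarrow> bool" where
  "edge_partition E Ps \<longleftrightarrow>
     \<Union>(set Ps) = E \<and> (\<forall>i < length Ps. \<forall>j < length Ps. i \<noteq> j \<longrightarrow> Ps ! i \<inter> Ps ! j = {})"


section \<open>A random access machine\<close>

text \<open>Running time is measured for structured programs on a random access machine with named,
  zero-based, unbounded arrays of natural numbers. A scalar variable is cell 0 of an array.\<close>

type_synonym store = "string \<Rightarrow> nat \<Rightarrow> nat"

datatype aexp = Const nat | Cell string aexp | Plus aexp aexp | Minus aexp aexp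

datatype bexp = Less aexp aexp | Equal aexp aexp | Not bexp | And bexp bexp

datatype com =
    Skip
  | Assign string aexp aexp
  | Seq com com
  | If bexp com com
  | While bexp com

primrec aval :: "aexp \<Rightarrow> store \<Rightarrow> nat" where
  "aval (Const k) s = k"
| "aval (Cell x a) s = s x (aval a s)"
| "aval (Plus a b) s = aval a s + aval b s"
| "aval (Minus a b) s = aval a s - aval b s"

primrec bval :: "bexp \<Rightarrow> store \<Rightarrow> bool" where
  "bval (Less a b) s \<longleftrightarrow> aval a s < aval b s"
| "bval (Equal a b) s \<longleftrightarrow> aval a s = aval b s"
| "bval (Not b) s \<longleftrightarrow> \<not> bval b s"
| "bval (And b b') s \<longleftrightarrow> bval b s \<and> bval b' s"

text \<open>\<open>exec w c s t s'\<close>: started in \<open>s\<close>, program \<open>c\<close> terminates in \<open>s'\<close> after \<open>t\<close> steps, and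
  every value it writes is at most \<open>w\<close> (an assignment exceeding \<open>w\<close> is stuck). The bound excludes
  packing large amounts of data into one cell; with \<open>w\<close> linear in the input size it says that
  machine words have logarithmically many bits. Each assignment and each evaluation of a test costs
  one step. This is adequate because a fixed program contains only finitely many expressions:
  evaluating one takes a bounded number of machine operations, and its intermediate values exceed
  \<open>w\<close> and the values in \<open>s\<close> by at most a constant factor and an additive constant.\<close>

inductive exec :: "nat \<Rightarrow> com \<Rightarrow> store \<Rightarrow> nat \<Rightarrow> store \<Rightarrow> bool" for w :: nat where
  Skip: "exec w Skip s 1 s"
| Assign: "aval e s \<le> w \<Longrightarrow> exec w (Assign x i e) s 1 (s(x := (s x)(aval i s := aval e s)))"
| Seq: "exec w c1 s t1 s' \<Longrightarrow> exec w c2 s' t2 s'' \<Longrightarrow> exec w (Seq c1 c2) s (t1 + t2) s''"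
| IfTrue: "bval b s \<Longrightarrow> exec w c1 s t s' \<Longrightarrow> exec w (If b c1 c2) s (Suc t) s'"
| IfFalse: "\<not> bval b s \<Longrightarrow> exec w c2 s t s' \<Longrightarrow> exec w (If b c1 c2) s (Suc t) s'"
| WhileFalse: "\<not> bval b s \<Longrightarrow> exec w (While b c) s 1 s"
| WhileTrue: "bval b s \<Longrightarrow> exec w c s t1 s' \<Longrightarrow> exec w (While b c) s' t2 s'' \<Longrightarrow>
    exec w (While b c) s (Suc (t1 + t2)) s''"


section \<open>Input and output\<close>

text \<open>The machine sees the vertices and edges of a graph as positions in enumerations \<open>vs\<close> and
  \<open>es\<close>. The graph is given by its edge list: edge number \<open>i\<close> joins the vertices numbered
  \<open>u[i]\<close> and \<open>v[i]\<close>. A partition is given by storing for each edge the number of its part.\<close>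

definition labels :: "'a set list \<Rightarrow> 'a set set list \<Rightarrow> (nat \<Rightarrow> nat) \<Rightarrow> bool" where
  "labels es Ps a \<longleftrightarrow> (\<forall>i < length es. a i < length Ps \<and> es ! i \<in> Ps ! a i)"

definition input_store :: "'a list \<Rightarrow> 'a set list \<Rightarrow> 'a set set list \<Rightarrow> store \<Rightarrow> bool" where
  "input_store vs es Ps s \<longleftrightarrow>
     s ''n'' 0 = length vs \<and> s ''m'' 0 = length es \<and>
     (\<forall>i < length es. s ''u'' i < length vs \<and> s ''v'' i < length vs \<and>
        es ! i = {vs ! s ''u'' i, vs ! s ''v'' i}) \<and>
     labels es Ps (s ''part'') \<and>
     (\<forall>x i. \<not> (x \<in> {''n'', ''m''} \<and> i = 0 \<or> x \<in> {''u'', ''v'', ''part''} \<and> i < length es)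
        \<longrightarrow> s x i = 0)"

definition output_store :: "'a set list \<Rightarrow> 'a set set list \<Rightarrow> store \<Rightarrow> bool" where
  "output_store es Fs s \<longleftrightarrow> labels es Fs (s ''out'')"

end

theory Submission
  imports Defs
begin

text \<open>Number the vertices below \<open>n\<close> and let the slot \<open>v + n * k\<close> stand for vertex \<open>v\<close> in part \<open>k\<close>; the
  three pseudoforests become one on \<open>3n\<close> slots. Stripping leaves exposes its cycles. If one edge is
  removed from every cycle, the removed edges have degree at most three, because the cycles of one
  part are disjoint. The point is to make the removed edges a forest \<open>M\<close> as well.

  Choose distinct representative vertices \<open>r Z \<in> Z\<close> for the cycles \<open>Z\<close>: joining every cycle to three
  of its vertices and grouping the remaining slots into dummy triples gives a cubic bipartite
  multigraph, whose uniform fractional perfect matching is rounded along alternating cycles in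
  linear time. Then grow a vertex set \<open>T\<close> from the vertices that represent no cycle: if \<open>r Z \<notin> T\<close> has
  a neighbour on \<open>Z\<close> in \<open>T\<close>, remove the edge between them and add \<open>r Z\<close> to \<open>T\<close>; this hangs a fresh
  vertex on \<open>M\<close>. When the growth is stuck, counting shows that every vertex outside \<open>T\<close> lies on three
  cycles, each represented outside \<open>T\<close> at that vertex or next to it. Pick such a cycle \<open>Z\<close> and restart
  the growth from \<open>r Z\<close>. If \<open>Z\<close> has at least four vertices, an edge of \<open>Z\<close> adjacent to a neighbour of
  \<open>r Z\<close> leads back to \<open>T\<close>; removing it links the new tree to the old ones by a single edge. Once only
  triangles are left, move an edge of \<open>Z\<close> at \<open>r Z\<close> into the next part: its ends lie on different
  triangles of that part, since the graph is simple, hence in different components, and the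
  components joined in this way at different restarts are distinct, so no cycle arises.\<close>

section \<open>Cycles and forests\<close>

text \<open>A slot doubles as an edge of the cubic bipartite multigraph: it joins its vertex to the
  triple it was put into. So \<open>n\<close> vertices face \<open>n\<close> triples, and a perfect
  matching is a set of slots that meets every block of \<open>vr\<close> and every block of
  \<open>rot\<close> exactly once. The count in the stuck case needs every vertex outside
  \<open>T\<close> to carry a representative, which is why the growth starts at the vertices
  representing nothing. It needs the representatives to be distinct vertices because each of them
  claims three slots, and vertices offer three slots each; equality leaves no slot over. Long cycles
  precede triangles because an edge may be moved only if its two ends lie, in the next part, on
  triangles entirely outside \<open>T\<close>: such triangles cannot have been joined before.
  Running times come from potentials. The delicate one belongs to the rounding, where an alternating
  walk may be built and popped many times: popping \<open>L\<close> slots is paid for by a gain of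
  at least \<open>L\<close> in the sum of squared weights, which cannot exceed 9 per slot.\<close>

definition adj_rel :: "'a set set \<Rightarrow> ('a \<times> 'a) set" where
  "adj_rel E = {(x, y). {x, y} \<in> E}"

lemma adj_rel_sym: "(x, y) \<in> (adj_rel E)\<^sup>* \<Longrightarrow> (y, x) \<in> (adj_rel E)\<^sup>*"
proof -
  have "sym (adj_rel E)" by (auto simp: sym_def adj_rel_def insert_commute)
  then show "(x, y) \<in> (adj_rel E)\<^sup>* \<Longrightarrow> (y, x) \<in> (adj_rel E)\<^sup>*"
    by (meson sym_rtrancl symD)
qed

lemma adj_rel_mono: "E \<subseteq> E' \<Longrightarrow> (adj_rel E)\<^sup>* \<subseteq> (adj_rel E')\<^sup>*"
  by (rule rtrancl_mono) (auto simp: adj_rel_def)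

lemma adj_rel_invariant:
  assumes "(x, y) \<in> (adj_rel E)\<^sup>*" and "P x"
    and "\<And>p q. {p, q} \<in> E \<Longrightarrow> P p \<Longrightarrow> P q"
  shows "P y"
  using assms(1,2) by (induction rule: rtrancl_induct) (auto simp: adj_rel_def assms(3))

lemma is_cycle_mono: "is_cycle E C \<Longrightarrow> E \<subseteq> E' \<Longrightarrow> is_cycle E' C"
  by (auto simp: is_cycle_def)

lemma is_cycle_restrict: "is_cycle E C \<Longrightarrow> C \<subseteq> E' \<Longrightarrow> is_cycle E' C"
  by (auto simp: is_cycle_def)

lemma forest_mono: "forest E \<Longrightarrow> E' \<subseteq> E \<Longrightarrow> forest E'"
  unfolding forest_def using is_cycle_mono by blast

lemma cycle_edges_nonempty: "is_cycle E C \<Longrightarrow> C \<noteq> {}"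
  unfolding is_cycle_def cycle_edges_def by fastforce

lemma Union_cycle_edges: "vs \<noteq> [] \<Longrightarrow> \<Union>(cycle_edges vs) = set vs"
proof -
  assume ne: "vs \<noteq> []"
  have "vs ! (Suc i mod length vs) \<in> set vs" for i
    using ne by simp
  then show ?thesis by (auto simp: cycle_edges_def in_set_conv_nth) blast+
qed

text \<open>The two neighbours are the cyclic predecessor and successor; length at least 3 makes
  them distinct.\<close>

lemma cycle_two_edges:
  assumes "is_cycle E C" "x \<in> \<Union>C"
  obtains y z where "{x, y} \<in> C" "{x, z} \<in> C" "y \<noteq> z" "x \<noteq> y" "x \<noteq> z"
proof -
  obtain vs where vs: "3 \<le> length vs" "distinct vs" "C = cycle_edges vs"
    using assms by (auto simp: is_cycle_def)
  let ?L = "length vs"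
  have "\<Union>C = set vs" using Union_cycle_edges[of vs] vs by fastforce
  then have "x \<in> set vs" using assms(2) by simp
  then obtain i where i: "i < ?L" "x = vs ! i" by (auto simp: in_set_conv_nth)
  define j where "j = (if i = 0 then ?L - 1 else i - 1)"
  define k where "k = (if Suc i = ?L then 0 else Suc i)"
  have j: "j < ?L" "Suc j mod ?L = i" using i vs(1) by (auto simp: j_def)
  have k: "k < ?L" "Suc i mod ?L = k" using i vs(1) by (auto simp: k_def)
  have "{vs ! j, x} \<in> C" using j i vs(3) unfolding cycle_edges_def by blast
  moreover have "{x, vs ! k} \<in> C" using k i vs(3) unfolding cycle_edges_def by blast
  moreover have "j \<noteq> k" "j \<noteq> i" "k \<noteq> i" using i vs(1) by (auto simp: j_def k_def split: if_splits)
  ultimately show ?thesis using that[of "vs ! j" "vs ! k"] i j k vs(2)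
    by (auto simp: nth_eq_iff_index_eq insert_commute)
qed

text \<open>The rest of the cycle is a path between the ends of the deleted edge. Hence a new cycle
  yields a connection in the old graph, which is how insertions are shown to keep a forest.\<close>

lemma cycle_bypass:
  assumes "is_cycle E C" "{x, y} \<in> C"
  shows "(x, y) \<in> (adj_rel (C - {{x, y}}))\<^sup>*"
proof -
  obtain vs where vs: "3 \<le> length vs" "distinct vs" "C = cycle_edges vs"
    using assms by (auto simp: is_cycle_def)
  let ?L = "length vs"
  obtain i where i: "i < ?L" "{x, y} = {vs ! i, vs ! (Suc i mod ?L)}"
    using assms(2) vs(3) by (auto simp: cycle_edges_def)
  let ?R = "(adj_rel (C - {{x, y}}))\<^sup>*"
  \<comment> \<open>Only position \<open>i\<close> produces the deleted edge: a coincidence with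
    swapped ends would make \<open>i\<close> and \<open>j\<close> each other's cyclic successor,
    impossible in length at least 3.\<close>
  have edge: "{vs ! j, vs ! (Suc j mod ?L)} \<in> C - {{x, y}}" if j: "j < ?L" "j \<noteq> i" for j
  proof -
    have "{vs ! j, vs ! (Suc j mod ?L)} \<noteq> {vs ! i, vs ! (Suc i mod ?L)}"
    proof
      assume eq: "{vs ! j, vs ! (Suc j mod ?L)} = {vs ! i, vs ! (Suc i mod ?L)}"
      have "Suc j mod ?L < ?L" "Suc i mod ?L < ?L" using i(1) by (auto intro!: mod_less_divisor)
      then have "j = Suc i mod ?L \<and> i = Suc j mod ?L"
        using eq j i(1) vs(2) unfolding doubleton_eq_iff by (auto simp: nth_eq_iff_index_eq)
      moreover have "Suc k mod ?L = (if Suc k = ?L then 0 else Suc k)" if "k < ?L" for k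
        using that by auto
      ultimately show False using j i(1) vs(1) by (smt (verit) Suc_leI le_less_Suc_eq
          lessI less_antisym numeral_3_eq_3 not_less Suc_lessD zero_less_Suc less_Suc0 n_not_Suc_n less_irrefl_nat Suc_inject)
    qed
    then show ?thesis using i j vs(3) unfolding cycle_edges_def by auto
  qed
  have "(vs ! (Suc i mod ?L), vs ! ((Suc i + k) mod ?L)) \<in> ?R" if "k < ?L" for k
    using that
  proof (induction k)
    case (Suc k)
    let ?j = "(Suc i + k) mod ?L"
    have ji: "?j \<noteq> i"
    proof
      assume "?j = i"
      then have "(Suc i + k) mod ?L = i mod ?L" using i(1) by simp
      then have "?L dvd Suc k"
        by (metis add_Suc_shift add_diff_cancel_left' le_add1 mod_eq_dvd_iff_nat)
      then show False using Suc.prems by (simp add: nat_dvd_not_less)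
    qed
    have "?j < ?L" using i(1) by (intro mod_less_divisor) linarith
    then have "{vs ! ?j, vs ! (Suc ?j mod ?L)} \<in> C - {{x, y}}" using edge ji by blast
    then have "{vs ! ?j, vs ! ((Suc i + Suc k) mod ?L)} \<in> C - {{x, y}}"
      by (simp add: mod_Suc_eq)
    then show ?case using Suc by (auto simp: adj_rel_def intro: rtrancl_into_rtrancl)
  qed auto
  note step = this
  have "Suc i + (?L - 1) = i + ?L" using i(1) by linarith
  then have "(Suc i + (?L - 1)) mod ?L = i" using i(1) by simp
  then have "(vs ! (Suc i mod ?L), vs ! i) \<in> ?R" using step[of "?L - 1"] i(1) by simp
  then have "(vs ! (Suc i mod ?L), vs ! i) \<in> ?R \<and> (vs ! i, vs ! (Suc i mod ?L)) \<in> ?R"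
    using adj_rel_sym by auto
  moreover have "x = vs ! i \<and> y = vs ! (Suc i mod ?L) \<or> y = vs ! i \<and> x = vs ! (Suc i mod ?L)"
    using i(2) by (auto simp: doubleton_eq_iff)
  ultimately show ?thesis by metis
qed

text \<open>A cycle through the new edge would bypass it inside \<open>E\<close>; any other cycle
  already lies in \<open>E\<close>.\<close>

lemma forest_insert:
  assumes "forest E" "(x, y) \<notin> (adj_rel E)\<^sup>*"
  shows "forest (insert {x, y} E)"
  unfolding forest_def
proof (rule notI, elim exE)
  fix C assume C: "is_cycle (insert {x, y} E) C"
  show False
  proof (cases "{x, y} \<in> C")
    case True
    have "C - {{x, y}} \<subseteq> E" using C by (auto simp: is_cycle_def)
    then have "(x, y) \<in> (adj_rel E)\<^sup>*" using cycle_bypass[OF C True] adj_rel_mono by blast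
    then show False using assms by simp
  next
    case False
    then have "is_cycle E C" using C by (auto simp: is_cycle_def)
    then show False using assms by (auto simp: forest_def)
  qed
qed

text \<open>No edge of \<open>E\<close> enters \<open>y\<close>, so \<open>y\<close> is unreachable
  from \<open>x\<close>. This is the growth step: a leaf is hung on the tree.\<close>

lemma forest_insert_fresh:
  assumes "forest E" "y \<notin> \<Union>E" "x \<noteq> y"
  shows "forest (insert {x, y} E)"
proof (rule forest_insert[OF assms(1)])
  show "(x, y) \<notin> (adj_rel E)\<^sup>*"
    using assms by (auto simp: adj_rel_def elim: rtranclE)
qed

lemma cycle_connected:
  assumes "is_cycle E C" "x \<in> \<Union>C" "y \<in> \<Union>C"
  shows "(x, y) \<in> (adj_rel C)\<^sup>*"
proof -
  obtain vs where vs: "3 \<le> length vs" "distinct vs" "C = cycle_edges vs"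
    using assms by (auto simp: is_cycle_def)
  have "(vs ! 0, vs ! k) \<in> (adj_rel C)\<^sup>*" if "k < length vs" for k
    using that
  proof (induction k)
    case (Suc k)
    have "{vs ! k, vs ! (Suc k mod length vs)} \<in> C"
      using vs(3) Suc.prems unfolding cycle_edges_def by (auto intro!: exI[of _ k])
    then have "(vs ! k, vs ! Suc k) \<in> adj_rel C" using Suc by (auto simp: adj_rel_def)
    then show ?case using Suc by (meson Suc_lessD rtrancl.rtrancl_into_rtrancl)
  qed simp
  moreover have "\<Union>C = set vs" using Union_cycle_edges[of vs] vs by fastforce
  then have "x \<in> set vs" "y \<in> set vs" using assms by simp_all
  ultimately have "(vs ! 0, x) \<in> (adj_rel C)\<^sup>*" "(vs ! 0, y) \<in> (adj_rel C)\<^sup>*"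
    by (auto simp: in_set_conv_nth)
  then show ?thesis by (meson adj_rel_sym rtrancl_trans)
qed

text \<open>Longest path: its first vertex has a neighbour other than the second vertex, and by
  maximality that neighbour is on the path and closes a cycle.\<close>

lemma min_degree_cycle:
  assumes fin: "finite E" "E \<noteq> {}" and c2: "\<And>e. e \<in> E \<Longrightarrow> card e = 2"
    and deg: "\<And>x. x \<in> \<Union>E \<Longrightarrow> \<exists>y z. {x, y} \<in> E \<and> {x, z} \<in> E \<and> y \<noteq> z"
  shows "\<exists>C. is_cycle E C"
proof -
  define path where "path xs \<longleftrightarrow> 2 \<le> length xs \<and> distinct xs \<and>
    (\<forall>i. Suc i < length xs \<longrightarrow> {xs ! i, xs ! Suc i} \<in> E)" for xs
  have finU: "finite (\<Union>E)" using fin c2 by (metis card.infinite finite_Union zero_neq_numeral)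
  have sub: "set xs \<subseteq> \<Union>E" if p: "path xs" for xs
  proof
    fix x assume "x \<in> set xs"
    then obtain i where i: "i < length xs" "x = xs ! i" by (auto simp: in_set_conv_nth)
    show "x \<in> \<Union>E"
    proof (cases "Suc i < length xs")
      case True then show ?thesis using i p unfolding path_def by blast
    next
      case False
      then have j: "Suc (i - 1) < length xs" "Suc (i - 1) = i" using i p unfolding path_def by auto
      then have "{xs ! (i - 1), xs ! Suc (i - 1)} \<in> E" using p unfolding path_def by blast
      then show ?thesis using i j by auto
    qed
  qed
  have bound: "length xs < Suc (card (\<Union>E))" if "path xs" for xs
    using that sub[OF that] card_mono[OF finU] distinct_card[of xs] unfolding path_def
    by (metis less_Suc_eq_le)
  obtain e where "e \<in> E" using fin by auto
  then obtain p q where pq: "e = {p, q}" "p \<noteq> q" using c2 by (metis card_2_iff)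
  have "path [p, q]" using pq \<open>e \<in> E\<close> unfolding path_def by (auto simp: less_Suc_eq)
  then obtain xs where xs: "path xs" and max: "\<And>ys. path ys \<Longrightarrow> length ys \<le> length xs"
    using ex_has_greatest_nat[of path "[p, q]" length "Suc (card (\<Union>E))"] bound less_imp_le by blast
  have len: "2 \<le> length xs" using xs by (simp add: path_def)
  let ?h = "xs ! 0"
  have "?h \<in> set xs" using len by (intro nth_mem) linarith
  then have "?h \<in> \<Union>E" using sub[OF xs] by blast
  then obtain y where y: "{?h, y} \<in> E" "y \<noteq> xs ! 1" by (metis deg)
  have yh: "y \<noteq> ?h" using c2[OF y(1)] by auto
  have "y \<in> set xs"
  proof (rule ccontr)
    assume "y \<notin> set xs"
    then have "path (y # xs)" using xs y(1) unfolding path_def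
      by (auto simp: nth_Cons insert_commute split: nat.splits)
    then show False using max[of "y # xs"] by simp
  qed
  then obtain j where j: "j < length xs" "y = xs ! j" by (auto simp: in_set_conv_nth)
  \<comment> \<open>Position 0 is the vertex itself and position 1 is excluded by the choice of
    \<open>y\<close>, so the closed segment has at least three vertices.\<close>
  have j2: "2 \<le> j" using j y yh by (metis One_nat_def Suc_1 Suc_leI less_2_cases not_le)
  let ?ys = "take (Suc j) xs"
  have lys: "length ?ys = Suc j" using j by simp
  have "{?ys ! i, ?ys ! (Suc i mod Suc j)} \<in> E" if "i < Suc j" for i
  proof (cases "i = j")
    case True then show ?thesis using y(1) j by (simp add: insert_commute)
  next
    case False
    then have "i < j" using that by simp
    then show ?thesis using xs j unfolding path_def by simp
  qed
  then have "cycle_edges ?ys \<subseteq> E" unfolding cycle_edges_def lys by blast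
  moreover have "distinct ?ys" "3 \<le> length ?ys" using xs j2 lys by (auto simp: path_def)
  ultimately show ?thesis unfolding is_cycle_def by blast
qed

text \<open>Induction on the number of edges: by \<open>min_degree_cycle\<close> there is a leaf,
  and deleting its edge costs one edge and at least one covered vertex.\<close>

lemma forest_card_less:
  assumes "finite E" "E \<noteq> {}" "\<And>e. e \<in> E \<Longrightarrow> card e = 2" "forest E"
  shows "card E < card (\<Union>E)"
  using assms
proof (induction "card E" arbitrary: E rule: less_induct)
  case less
  have finU: "finite (\<Union>E)" using less.prems(1,3) by (metis card.infinite finite_Union zero_neq_numeral)
  obtain x where x: "x \<in> \<Union>E" "\<And>y z. {x, y} \<in> E \<Longrightarrow> {x, z} \<in> E \<Longrightarrow> y = z"
    using min_degree_cycle[OF less.prems(1-3)] less.prems(4) unfolding forest_def by blast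
  then obtain e where e: "e \<in> E" "x \<in> e" by auto
  have uniq: "e' = e" if "e' \<in> E" "x \<in> e'" for e'
  proof -
    have "\<exists>y. e' = {x, y}" "\<exists>y. e = {x, y}" using that e less.prems(3) by (metis card_2_iff insertE singletonD insert_commute)+
    then show ?thesis using x(2) that e by metis
  qed
  show ?case
  proof (cases "E = {e}")
    case True then show ?thesis using less.prems(3)[of e] by simp
  next
    case False
    let ?E = "E - {e}"
    have "card ?E < card E" using e less.prems(1) by (meson card_Diff1_less)
    moreover have "?E \<noteq> {}" using False e by auto
    ultimately have "card ?E < card (\<Union>?E)"
      using less.hyps[of ?E] less.prems forest_mono[of E ?E] by auto
    moreover have "\<Union>?E \<subset> \<Union>E" using uniq e by blast
    then have "card (\<Union>?E) < card (\<Union>E)" using finU by (simp add: psubset_card_mono)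
    ultimately show ?thesis using e less.prems(1) by (metis card_Suc_Diff1 Suc_leI le_less_trans)
  qed
qed

text \<open>Deleting one edge of the cycle leaves a forest, so there are at most as many edges as
  covered vertices. By the handshake identity the degrees average at most 2, while none is below
  2.\<close>

lemma unicyclic_degree_two:
  assumes fin: "finite E" and c2: "\<And>e. e \<in> E \<Longrightarrow> card e = 2"
    and uni: "\<And>C1 C2. is_cycle E C1 \<Longrightarrow> is_cycle E C2 \<Longrightarrow> C1 = C2"
    and deg: "\<And>x. x \<in> \<Union>E \<Longrightarrow> 2 \<le> degree E x" and x: "x \<in> \<Union>E"
  shows "degree E x = 2"
proof -
  have finU: "finite (\<Union>E)" using fin c2 by (metis card.infinite finite_Union zero_neq_numeral)
  have "\<exists>C. is_cycle E C"
  proof (rule min_degree_cycle)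
    fix p assume p: "p \<in> \<Union>E"
    then have "\<not> card {e \<in> E. p \<in> e} \<le> Suc 0" using deg[of p] by (simp add: degree_def)
    then obtain e f where ef: "e \<in> E" "p \<in> e" "f \<in> E" "p \<in> f" "e \<noteq> f"
      using fin by (auto simp: card_le_Suc0_iff_eq)
    have "\<exists>y. e = {p, y}" "\<exists>y. f = {p, y}" using ef c2 by (metis card_2_iff insertE singletonD insert_commute)+
    then show "\<exists>y z. {p, y} \<in> E \<and> {p, z} \<in> E \<and> y \<noteq> z" using ef by auto
  qed (use fin c2 x in auto)
  then obtain C where C: "is_cycle E C" by auto
  then obtain e where e: "e \<in> C" "e \<in> E" using cycle_edges_nonempty[OF C] by (auto simp: is_cycle_def)
  have "forest (E - {e})"
    unfolding forest_def
  proof (rule notI, elim exE)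
    fix C' assume C': "is_cycle (E - {e}) C'"
    then have "C = C'" using uni[OF C is_cycle_mono[OF C']] by blast
    then show False using C' e by (auto simp: is_cycle_def)
  qed
  moreover have "E - {e} \<noteq> {}"
  proof
    assume "E - {e} = {}"
    then have "E = {e}" using e by auto
    moreover obtain p where "p \<in> e" using c2 e by fastforce
    ultimately have "degree E p \<le> 1" by (simp add: degree_def card_le_Suc0_iff_eq)
    then show False using deg[of p] \<open>p \<in> e\<close> e by auto
  qed
  ultimately have "card (E - {e}) < card (\<Union>(E - {e}))" using fin c2 by (intro forest_card_less) auto
  also have "\<dots> \<le> card (\<Union>E)" by (rule card_mono[OF finU]) auto
  finally have le: "card E \<le> card (\<Union>E)" using e fin by (simp add: card_Diff_singleton)
  have "(\<Sum>p\<in>\<Union>E. card {e \<in> E. p \<in> e}) = (\<Sum>e\<in>E. 2)"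
  proof (rule sum_multicount_gen[OF finU fin], rule ballI)
    fix f assume f: "f \<in> E"
    have "{i \<in> \<Union>E. i \<in> f} = f" using f by auto
    then show "card {i \<in> \<Union>E. i \<in> f} = 2" using c2[OF f] by simp
  qed
  then have s: "(\<Sum>p\<in>\<Union>E. degree E p) \<le> (\<Sum>p\<in>\<Union>E. 2)" using le by (simp add: degree_def)
  show ?thesis
  proof (rule ccontr)
    assume "degree E x \<noteq> 2"
    then have "2 < degree E x" using deg[OF x] by simp
    then have "(\<Sum>p\<in>\<Union>E. 2) < (\<Sum>p\<in>\<Union>E. degree E p)"
      using x deg finU by (intro sum_strict_mono_ex1) auto
    then show False using s by simp
  qed
qed

text \<open>Localises the count to the component of \<open>x\<close>. It is the reason why stripping
  leaves from a pseudoforest leaves disjoint cycles and nothing else.\<close>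

lemma pseudoforest_degree_two:
  assumes fin: "finite E" and c2: "\<And>e. e \<in> E \<Longrightarrow> card e = 2"
    and uni: "\<And>C1 C2 p q. is_cycle E C1 \<Longrightarrow> is_cycle E C2 \<Longrightarrow> p \<in> \<Union>C1 \<Longrightarrow> q \<in> \<Union>C2 \<Longrightarrow>
      (p, q) \<in> (adj_rel E)\<^sup>* \<Longrightarrow> C1 = C2"
    and deg: "\<And>x. x \<in> \<Union>E \<Longrightarrow> 2 \<le> degree E x" and x: "x \<in> \<Union>E"
  shows "degree E x = 2"
proof -
  define K where "K = {y. (x, y) \<in> (adj_rel E)\<^sup>*}"
  define F where "F = {e \<in> E. e \<inter> K \<noteq> {}}"
  have FK: "e \<subseteq> K" if e: "e \<in> F" for e
  proof
    fix q assume q: "q \<in> e"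
    obtain p where p: "p \<in> e" "p \<in> K" using e by (auto simp: F_def)
    have "p = q \<or> {p, q} = e" using c2[of e] e p q unfolding F_def card_2_iff by auto
    then show "q \<in> K" using p e unfolding K_def F_def
      by (auto simp: adj_rel_def intro: rtrancl_into_rtrancl)
  qed
  have dF: "degree F y = degree E y" if "y \<in> K" for y
    using that unfolding degree_def F_def by (intro arg_cong[where f = card]) auto
  have FE: "F \<subseteq> E" by (auto simp: F_def)
  have xK: "x \<in> K" by (simp add: K_def)
  have "degree F x = 2"
  proof (rule unicyclic_degree_two)
    show "finite F" using fin FE finite_subset by auto
    show "x \<in> \<Union>F" using x xK by (auto simp: F_def)
    fix C1 C2 assume C: "is_cycle F C1" "is_cycle F C2"
    have ne: "\<exists>p. p \<in> \<Union>C" if C: "is_cycle F C" for C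
    proof -
      obtain e where "e \<in> C" using cycle_edges_nonempty[OF C] by auto
      then have "card e = 2" using C c2 FE by (auto simp: is_cycle_def)
      then have "e \<noteq> {}" by auto
      then show ?thesis using \<open>e \<in> C\<close> by blast
    qed
    obtain p q where pq: "p \<in> \<Union>C1" "q \<in> \<Union>C2" using ne C by meson
    have "p \<in> K" "q \<in> K" using pq C FK unfolding is_cycle_def by blast+
    then have "(x, p) \<in> (adj_rel E)\<^sup>*" "(x, q) \<in> (adj_rel E)\<^sup>*" unfolding K_def by auto
    then have "(p, q) \<in> (adj_rel E)\<^sup>*" using adj_rel_sym rtrancl_trans by metis
    then show "C1 = C2" using uni[OF is_cycle_mono[OF C(1) FE] is_cycle_mono[OF C(2) FE]] pq by blast
  next
    fix y assume "y \<in> \<Union>F"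
    then have "y \<in> K" "y \<in> \<Union>E" using FK FE by blast+
    then show "2 \<le> degree F y" using dF[of y] deg[of y] by simp
  qed (use c2 FE in auto)
  then show ?thesis using dF[OF xK] by simp
qed

lemma cycle_edges_image: "cycle_edges vs = (\<lambda>i. {vs ! i, vs ! (Suc i mod length vs)}) ` {..<length vs}"
  by (auto simp: cycle_edges_def)

lemma cycle_edges_map:
  assumes "vs \<noteq> []"
  shows "cycle_edges (map f vs) = (`) f ` cycle_edges vs"
  unfolding cycle_edges_image image_image length_map
proof (intro image_cong refl)
  fix i assume i: "i \<in> {..<length vs}"
  have "Suc i mod length vs < length vs" using assms by simp
  then show "{map f vs ! i, map f vs ! (Suc i mod length vs)} = f ` {vs ! i, vs ! (Suc i mod length vs)}"
    using i by simp
qed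

text \<open>Carries cycles between vertices, slots and the abstract graph. The renamings are
  injective only on the part of the graph concerned, hence the restricted premise.\<close>

lemma is_cycle_image:
  assumes "is_cycle E C" "inj_on f (\<Union>E)"
  shows "is_cycle ((`) f ` E) ((`) f ` C)"
proof -
  obtain vs where vs: "3 \<le> length vs" "distinct vs" "C = cycle_edges vs" and CE: "C \<subseteq> E"
    using assms by (auto simp: is_cycle_def)
  have ne: "vs \<noteq> []" using vs(1) by auto
  then have "set vs \<subseteq> \<Union>E" using Union_cycle_edges[of vs] vs(3) CE by auto
  then have "distinct (map f vs)" using vs(2) assms(2) by (auto simp: distinct_map intro: inj_on_subset)
  then show ?thesis unfolding is_cycle_def using vs CE cycle_edges_map[OF ne]
    by (intro conjI exI[of _ "map f vs"]) auto
qed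

section \<open>Loop-free programs and while loops\<close>

text \<open>An upper bound: both branches of a conditional are added, so the bound does not depend
  on the store.\<close>

primrec cost :: "com \<Rightarrow> nat" where
  "cost Skip = 1"
| "cost (Assign x i e) = 1"
| "cost (Seq c1 c2) = cost c1 + cost c2"
| "cost (If b c1 c2) = Suc (cost c1 + cost c2)"
| "cost (While b c) = 1"

text \<open>Loop bodies contain no loops, so symbolic evaluation suffices for them;
  \<open>False\<close> for \<open>While\<close> leaves loops to \<open>runs_While\<close>.\<close>

primrec wp :: "nat \<Rightarrow> com \<Rightarrow> (store \<Rightarrow> bool) \<Rightarrow> store \<Rightarrow> bool" where
  "wp w Skip Q s = Q s"
| "wp w (Assign x i e) Q s = (aval e s \<le> w \<and> Q (s(x := (s x)(aval i s := aval e s))))"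
| "wp w (Seq c1 c2) Q s = wp w c1 (wp w c2 Q) s"
| "wp w (If b c1 c2) Q s = (if bval b s then wp w c1 Q s else wp w c2 Q s)"
| "wp w (While b c) Q s = False"

lemma wp_mono: "wp w c Q s \<Longrightarrow> (\<And>s. Q s \<Longrightarrow> Q' s) \<Longrightarrow> wp w c Q' s"
  by (induction c arbitrary: Q Q' s) (auto split: if_splits)

lemma wp_exec: "wp w c Q s \<Longrightarrow> \<exists>t s'. exec w c s t s' \<and> t \<le> cost c \<and> Q s'"
proof (induction c arbitrary: Q s)
  case (Seq c1 c2)
  then obtain t1 s1 where 1: "exec w c1 s t1 s1" "t1 \<le> cost c1" "wp w c2 Q s1" by fastforce
  then obtain t2 s2 where "exec w c2 s1 t2 s2" "t2 \<le> cost c2" "Q s2" using Seq.IH by blast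
  with 1 show ?case by (auto intro!: exI exec.Seq)
next
  case (If b c1 c2)
  show ?case
  proof (cases "bval b s")
    case True
    then obtain t s' where "exec w c1 s t s'" "t \<le> cost c1" "Q s'" using If by fastforce
    with True show ?thesis by (intro exI[of _ "Suc t"] exI[of _ s']) (auto intro: exec.IfTrue)
  next
    case False
    then obtain t s' where "exec w c2 s t s'" "t \<le> cost c2" "Q s'" using If by fastforce
    with False show ?thesis by (intro exI[of _ "Suc t"] exI[of _ s']) (auto intro: exec.IfFalse)
  qed
qed (fastforce intro: exec.intros)+

text \<open>Every write is checked against \<open>w\<close>, so this property survives any run, and
  copying a cell into another is then always legal.\<close>

definition bounded :: "nat \<Rightarrow> store \<Rightarrow> bool" where
  "bounded w s \<longleftrightarrow> (\<forall>x i. s x i \<le> w)"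

lemma exec_bounded: "exec w c s t s' \<Longrightarrow> bounded w s \<Longrightarrow> bounded w s'"
  by (induction rule: exec.induct) (auto simp: bounded_def)

definition runs :: "nat \<Rightarrow> com \<Rightarrow> store \<Rightarrow> nat \<Rightarrow> (store \<Rightarrow> bool) \<Rightarrow> bool" where
  "runs w c s T Q \<longleftrightarrow> (\<exists>t s'. exec w c s t s' \<and> t \<le> T \<and> Q s' \<and> bounded w s')"

lemma runs_wp: "wp w c Q s \<Longrightarrow> bounded w s \<Longrightarrow> runs w c s (cost c) Q"
  unfolding runs_def using wp_exec exec_bounded by blast

lemma runs_Seq:
  assumes "runs w c1 s T1 Q1" "\<And>s'. Q1 s' \<Longrightarrow> bounded w s' \<Longrightarrow> runs w c2 s' T2 Q2"
  shows "runs w (Seq c1 c2) s (T1 + T2) Q2"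
  using assms unfolding runs_def by (meson exec.Seq add_mono)

lemma runs_mono: "runs w c s T Q \<Longrightarrow> T \<le> T' \<Longrightarrow> (\<And>s'. Q s' \<Longrightarrow> bounded w s' \<Longrightarrow> Q' s') \<Longrightarrow> runs w c s T' Q'"
  unfolding runs_def by (meson le_trans)

text \<open>A potential that drops in every round bounds the number of rounds. Each loop below has
  one whose initial value is linear in \<open>n + m\<close>.\<close>

lemma runs_While:
  fixes \<phi> :: "store \<Rightarrow> nat"
  assumes "I s" "bounded w s"
    and step: "\<And>s. I s \<Longrightarrow> bval b s \<Longrightarrow> bounded w s \<Longrightarrow> wp w c (\<lambda>s'. I s' \<and> \<phi> s' < \<phi> s) s"
  shows "runs w (While b c) s (1 + \<phi> s * (1 + cost c)) (\<lambda>s'. I s' \<and> \<not> bval b s')"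
  using assms(1,2)
proof (induction "\<phi> s" arbitrary: s rule: less_induct)
  case less
  show ?case
  proof (cases "bval b s")
    case True
    then obtain t1 s1 where 1: "exec w c s t1 s1" "t1 \<le> cost c" "I s1" "\<phi> s1 < \<phi> s"
      using step[OF less.prems(1) True less.prems(2)] wp_exec by blast
    have "bounded w s1" using exec_bounded 1 less.prems by blast
    then obtain t2 s2 where 2: "exec w (While b c) s1 t2 s2" "t2 \<le> 1 + \<phi> s1 * (1 + cost c)"
        "I s2 \<and> \<not> bval b s2" "bounded w s2"
      using less.hyps[of s1] 1 unfolding runs_def by blast
    have "Suc (\<phi> s1) * (1 + cost c) \<le> \<phi> s * (1 + cost c)"
      using 1(4) by (intro mult_right_mono) auto
    then have "Suc (t1 + t2) \<le> 1 + \<phi> s * (1 + cost c)" using 1 2 by simp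
    then show ?thesis
      unfolding runs_def using exec.WhileTrue[OF True 1(1) 2(1)] 2 by blast
  next
    case False
    then show ?thesis unfolding runs_def using less.prems exec.WhileFalse by fastforce
  qed
qed

section \<open>Choosing one edge of every cycle\<close>

definition next_color :: "nat \<Rightarrow> nat" where
  "next_color k = (if k < 2 then Suc k else 0)"

lemma next_color_neq: "next_color k \<noteq> k" "k < 3 \<Longrightarrow> next_color k < 3"
  by (auto simp: next_color_def)

text \<open>The parameters are the input arrays. \<open>edge_inj\<close> is simplicity of the whole
  graph, across the three parts; the triangle step rests on it.\<close>

locale colored_graph =
  fixes n m :: nat and u v c :: "nat \<Rightarrow> nat"
  assumes u_less: "i < m \<Longrightarrow> u i < n" and v_less: "i < m \<Longrightarrow> v i < n"
    and u_neq_v: "i < m \<Longrightarrow> u i \<noteq> v i" and c_less: "i < m \<Longrightarrow> c i < 3"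
    and edge_inj: "i < m \<Longrightarrow> j < m \<Longrightarrow> {u i, v i} = {u j, v j} \<Longrightarrow> i = j"
begin

definition a :: "nat \<Rightarrow> nat" where "a i = u i + n * c i"
definition b :: "nat \<Rightarrow> nat" where "b i = v i + n * c i"
definition sedge :: "nat \<Rightarrow> nat set" where "sedge i = {a i, b i}"
definition vedge :: "nat \<Rightarrow> nat set" where "vedge i = {u i, v i}"
definition sgraph :: "nat set set" where "sgraph = sedge ` {..<m}"

text \<open>The slot of the same vertex in the next part, cyclically. Wrapping at
  \<open>3 * n\<close> needs only addition and subtraction, the arithmetic of the machine.\<close>

definition vr :: "nat \<Rightarrow> nat" where "vr x = (if x + n < 3 * n then x + n else x + n - 3 * n)"

lemma a_mod: "i < m \<Longrightarrow> a i mod n = u i" and a_div: "i < m \<Longrightarrow> a i div n = c i"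
  using u_less[of i] by (auto simp: a_def)

lemma b_mod: "i < m \<Longrightarrow> b i mod n = v i" and b_div: "i < m \<Longrightarrow> b i div n = c i"
  using v_less[of i] by (auto simp: b_def)

lemma slot_less: "p < n \<Longrightarrow> k < 3 \<Longrightarrow> p + n * k < 3 * n"
proof -
  assume "p < n" "k < 3"
  then have "n * k \<le> n * 2" by (intro mult_le_mono2) simp
  then show "p + n * k < 3 * n" using \<open>p < n\<close> by linarith
qed

lemma a_less: "i < m \<Longrightarrow> a i < 3 * n" and b_less: "i < m \<Longrightarrow> b i < 3 * n"
  using slot_less u_less v_less c_less by (auto simp: a_def b_def)

lemma a_neq_b: "i < m \<Longrightarrow> a i \<noteq> b i"
  using u_neq_v by (auto simp: a_def b_def)

lemma vedge_sedge: "i < m \<Longrightarrow> vedge i = (\<lambda>x. x mod n) ` sedge i"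
  by (simp add: vedge_def sedge_def a_mod b_mod)

lemma sedge_vedge: "sedge i = (\<lambda>p. p + n * c i) ` vedge i"
  by (simp add: vedge_def sedge_def a_def b_def)

lemma vedge_inj: "i < m \<Longrightarrow> j < m \<Longrightarrow> vedge i = vedge j \<Longrightarrow> i = j"
  using edge_inj by (simp add: vedge_def)

lemma sedge_inj: "i < m \<Longrightarrow> j < m \<Longrightarrow> sedge i = sedge j \<Longrightarrow> i = j"
  by (metis vedge_inj vedge_sedge)

lemma vr_less: "x < 3 * n \<Longrightarrow> vr x < 3 * n" by (auto simp: vr_def)

lemma vr_mod: "vr x mod n = x mod n"
proof (cases "x + n < 3 * n")
  case False
  then have "x = vr x + n * 2" by (auto simp: vr_def)
  then show ?thesis by (metis mod_mult_self2)
qed (simp add: vr_def)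

lemma slot_div: "x < 3 * n \<Longrightarrow> x div n < 3"
  by (simp add: less_mult_imp_div_less)

lemma vr_div: "x < 3 * n \<Longrightarrow> vr x div n = next_color (x div n)"
proof -
  assume x: "x < 3 * n"
  then have n: "n > 0" by auto
  show ?thesis
  proof (cases "x + n < 3 * n")
    case True
    then have "x < 2 * n" by simp
    then have "x div n < 2" by (simp add: div_less_iff_less_mult n)
    moreover have "(x + n) div n = Suc (x div n)" using n by (simp add: div_add_self2)
    ultimately show ?thesis using True by (simp add: vr_def next_color_def)
  next
    case False
    then have "vr x < n" "\<not> x < 2 * n" using x by (auto simp: vr_def)
    then have "vr x div n = 0" "\<not> x div n < 2" using n by (simp_all add: div_less_iff_less_mult)
    then show ?thesis by (simp add: next_color_def)
  qed
qed

lemma vr_vr_vr: "x < 3 * n \<Longrightarrow> vr (vr (vr x)) = x"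
  by (auto simp: vr_def)

lemma vr_neq: "x < 3 * n \<Longrightarrow> vr x \<noteq> x \<and> vr (vr x) \<noteq> x"
  by (auto simp: vr_def)

lemma same_vertex_iff:
  assumes "x < 3 * n" "y < 3 * n"
  shows "x mod n = y mod n \<longleftrightarrow> y = x \<or> y = vr x \<or> y = vr (vr x)"
proof
  assume eq: "x mod n = y mod n"
  have "y div n = x div n \<or> y div n = next_color (x div n) \<or> y div n = next_color (next_color (x div n))"
    using slot_div[OF assms(1)] slot_div[OF assms(2)] by (auto simp: next_color_def)
  then have "y div n = x div n \<or> y div n = vr x div n \<or> y div n = vr (vr x) div n"
    using vr_div vr_less assms by simp
  moreover have "y mod n = x mod n" "y mod n = vr x mod n" "y mod n = vr (vr x) mod n"
    using eq vr_mod by auto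
  ultimately show "y = x \<or> y = vr x \<or> y = vr (vr x)" by (metis div_mult_mod_eq)
qed (auto simp: vr_mod)

end

text \<open>The component condition in the form used throughout. It treats the three parts at once
  because slots of different parts are never connected.\<close>

locale pseudo_graph = colored_graph +
  assumes cycles_connected: "is_cycle sgraph C1 \<Longrightarrow> is_cycle sgraph C2 \<Longrightarrow> x \<in> \<Union>C1 \<Longrightarrow> y \<in> \<Union>C2 \<Longrightarrow>
      (x, y) \<in> (adj_rel sgraph)\<^sup>* \<Longrightarrow> C1 = C2"

text \<open>\<open>K\<close> is the set of slots on cycles, \<open>su\<close> and \<open>pr\<close> are the successor and predecessor along the cycle,
  \<open>ei x\<close> is the edge from \<open>x\<close> to \<open>su x\<close>, and \<open>cy\<close> names the cycle.\<close>

locale cycle_structure = pseudo_graph +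
  fixes K :: "nat set" and su pr ei cy :: "nat \<Rightarrow> nat"
  assumes K_less: "x \<in> K \<Longrightarrow> x < 3 * n"
    and su_K: "x \<in> K \<Longrightarrow> su x \<in> K" and pr_K: "x \<in> K \<Longrightarrow> pr x \<in> K"
    and pr_su: "x \<in> K \<Longrightarrow> pr (su x) = x" and su_pr: "x \<in> K \<Longrightarrow> su (pr x) = x"
    and cy_su: "x \<in> K \<Longrightarrow> cy (su x) = cy x"
    and ei_less: "x \<in> K \<Longrightarrow> ei x < m" and sedge_ei: "x \<in> K \<Longrightarrow> sedge (ei x) = {x, su x}"
    and ei_inj: "inj_on ei K"
    and cycle_K: "is_cycle sgraph C \<Longrightarrow> \<exists>x\<in>K. C = sedge ` ei ` {y \<in> K. cy y = cy x}"
    and K_cycle: "x \<in> K \<Longrightarrow> is_cycle sgraph (sedge ` ei ` {y \<in> K. cy y = cy x})"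
begin

lemma cy_pr: "x \<in> K \<Longrightarrow> cy (pr x) = cy x"
  using cy_su[OF pr_K] su_pr by metis

lemma su_neq: "x \<in> K \<Longrightarrow> su x \<noteq> x"
  using a_neq_b[OF ei_less] sedge_ei unfolding sedge_def by (metis doubleton_eq_iff)

text \<open>Going straight back would use one edge for two slots, although \<open>ei\<close> is
  injective.\<close>

lemma su_su_neq: "x \<in> K \<Longrightarrow> su (su x) \<noteq> x"
proof
  assume x: "x \<in> K" and eq: "su (su x) = x"
  then have "sedge (ei (su x)) = sedge (ei x)" using sedge_ei su_K by (auto simp: insert_commute)
  then have "ei (su x) = ei x" using x su_K ei_less sedge_inj by blast
  then have "su x = x" using x su_K ei_inj by (auto simp: inj_on_def)
  then show False using su_neq x by simp
qed

lemma su_div: "x \<in> K \<Longrightarrow> su x div n = x div n" and c_ei: "x \<in> K \<Longrightarrow> c (ei x) = x div n"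
  using sedge_ei ei_less a_div[of "ei x"] b_div[of "ei x"] unfolding sedge_def by (metis doubleton_eq_iff)+

lemma vedge_ei: "x \<in> K \<Longrightarrow> vedge (ei x) = {x mod n, su x mod n}"
  using vedge_sedge[OF ei_less] sedge_ei by simp

text \<open>Turns reachability into equality of cycle names: a component carries at most one cycle,
  and one of its edges already identifies the orbit, since \<open>ei\<close> and
  \<open>sedge\<close> are injective.\<close>

lemma cy_connected:
  assumes "x \<in> K" "y \<in> K" "(x, y) \<in> (adj_rel sgraph)\<^sup>*"
  shows "cy x = cy y"
proof -
  let ?C = "\<lambda>x. sedge ` ei ` {y \<in> K. cy y = cy x}"
  have "x \<in> \<Union>(?C x)" "y \<in> \<Union>(?C y)" using assms sedge_ei by auto
  from cycles_connected[OF K_cycle[OF assms(1)] K_cycle[OF assms(2)] this assms(3)]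
  have "?C x = ?C y" .
  then have "sedge (ei x) \<in> ?C y" using assms(1) by blast
  then obtain z where z: "z \<in> K" "cy z = cy y" "sedge (ei x) = sedge (ei z)" by auto
  then have "x = z" using assms sedge_inj ei_less ei_inj by (metis inj_onD)
  then show ?thesis using z by simp
qed

text \<open>The three slots form a cycle through \<open>x\<close>, and only one cycle passes through
  \<open>x\<close>, so the orbit contains nothing else.\<close>

lemma triangle_orbit:
  assumes x: "x \<in> K" and tri: "su (su (su x)) = x" and y: "y \<in> K" "cy y = cy x"
  shows "y = x \<or> y = su x \<or> y = su (su x)"
proof -
  let ?S = "{x, su x, su (su x)}"
  have SK: "?S \<subseteq> K" using x su_K by auto
  have "cycle_edges [x, su x, su (su x)] = sedge ` ei ` ?S"
  proof -
    have "{..<length [x, su x, su (su x)]} = {0, 1, 2}" by auto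
    then have "cycle_edges [x, su x, su (su x)] = {{x, su x}, {su x, su (su x)}, {su (su x), x}}"
      unfolding cycle_edges_image by simp
    then show ?thesis using x su_K sedge_ei tri by simp
  qed
  moreover have "distinct [x, su x, su (su x)]" using x su_neq su_su_neq su_K by (auto simp: eq_commute)
  moreover have "sedge ` ei ` ?S \<subseteq> sgraph" using SK ei_less unfolding sgraph_def by blast
  ultimately have C: "is_cycle sgraph (sedge ` ei ` ?S)"
    unfolding is_cycle_def by (intro conjI exI[of _ "[x, su x, su (su x)]"]) auto
  have "x \<in> \<Union>(sedge ` ei ` ?S)" "x \<in> \<Union>(sedge ` ei ` {y \<in> K. cy y = cy x})" using x sedge_ei by auto
  from cycles_connected[OF C K_cycle[OF x] this rtrancl_refl]
  have "sedge ` ei ` ?S = sedge ` ei ` {y \<in> K. cy y = cy x}" .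
  then have "sedge (ei y) \<in> sedge ` ei ` ?S" using y by blast
  then obtain z where z: "z \<in> ?S" "sedge (ei y) = sedge (ei z)" by blast
  then have "y = z" using SK y sedge_inj ei_less ei_inj by (metis inj_onD subsetD)
  then show ?thesis using z by auto
qed

end

text \<open>\<open>mt\<close> marks one matched slot per vertex; \<open>rl\<close> marks the slots that were offered to a cycle rather
  than to a dummy triple, so a matched slot outside \<open>rl\<close> belongs to a vertex representing no cycle.\<close>

locale growth = cycle_structure +
  fixes mt rl :: "nat \<Rightarrow> bool"
  assumes mt_vertex: "x < 3 * n \<Longrightarrow> \<exists>!y. y < 3 * n \<and> y mod n = x mod n \<and> mt y"
    and rl_K: "x < 3 * n \<Longrightarrow> rl x \<Longrightarrow> x \<in> K"
    and rp_cycle: "x \<in> K \<Longrightarrow> \<exists>!y. y \<in> K \<and> cy y = cy x \<and> mt y \<and> rl y"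
begin

definition rp :: "nat \<Rightarrow> bool" where "rp x \<longleftrightarrow> x < 3 * n \<and> mt x \<and> rl x"

lemma rp_K: "rp x \<Longrightarrow> x \<in> K" using rl_K by (auto simp: rp_def)

lemma rp_ex: "x \<in> K \<Longrightarrow> \<exists>y. rp y \<and> cy y = cy x"
  using rp_cycle[of x] K_less by (auto simp: rp_def)

lemma rp_unique: "rp x \<Longrightarrow> rp y \<Longrightarrow> cy x = cy y \<Longrightarrow> x = y"
  using rp_cycle[of x] rp_K by (auto simp: rp_def)

lemma rp_vertex_unique: "rp x \<Longrightarrow> rp y \<Longrightarrow> x mod n = y mod n \<Longrightarrow> x = y"
  using mt_vertex[of x] by (auto simp: rp_def)

text \<open>The state in which the growth is stuck.\<close>

definition closed :: "nat set \<Rightarrow> bool" where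
  "closed T \<longleftrightarrow> (\<forall>y. rp y \<and> y mod n \<notin> T \<longrightarrow> su y mod n \<notin> T \<and> pr y mod n \<notin> T)"

text \<open>Every vertex outside \<open>T\<close> contributes a representative \<open>x\<close> together with \<open>pr x\<close> and \<open>su x\<close>. These
  triples are pairwise disjoint, so they exhaust the three slots of each vertex outside \<open>T\<close>.\<close>

lemma closed_covers:
  assumes cl: "closed T" and ex: "\<forall>x < 3 * n. mt x \<and> \<not> rl x \<longrightarrow> x mod n \<in> T"
    and y: "y < 3 * n" "y mod n \<notin> T"
  shows "y \<in> K \<and> (\<exists>x. rp x \<and> x mod n \<notin> T \<and> (y = pr x \<or> y = x \<or> y = su x))"
proof -
  define U where "U = {x. x < 3 * n \<and> x mod n \<notin> T}"
  define R where "R = {x. rp x \<and> x mod n \<notin> T}"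
  define g where "g = (\<lambda>(x, k). if k = 0 then x else if k = Suc 0 then su x else pr x)"
  define h where "h = (\<lambda>(x, k). if k = 0 then x else if k = Suc 0 then vr x else vr (vr x))"
  let ?D = "R \<times> {..<3::nat}"
  have RU: "R \<subseteq> U" by (auto simp: R_def U_def rp_def)
  have finU: "finite U" by (auto simp: U_def)
  \<comment> \<open>\<open>h\<close> lists the three slots of each vertex outside \<open>T\<close>,
    \<open>g\<close> the triple of each representative there. Both are indexed by \<open>?D\<close>,
    so an injective \<open>g\<close> into \<open>U\<close> must be onto.\<close>
  have hU: "h ` ?D = U"
  proof
    show "h ` ?D \<subseteq> U" using RU by (auto simp: h_def U_def vr_less vr_mod split: if_splits)
    show "U \<subseteq> h ` ?D"
    proof
      fix z assume z: "z \<in> U"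
      then have "z < 3 * n" by (simp add: U_def)
      then obtain x where x: "x < 3 * n" "x mod n = z mod n" "mt x" using mt_vertex by blast
      then have "x \<in> R" using z ex by (auto simp: R_def U_def rp_def)
      moreover have "z = x \<or> z = vr x \<or> z = vr (vr x)" using same_vertex_iff x \<open>z < 3 * n\<close> by blast
      ultimately have "z = h (x, 0) \<and> (x, 0) \<in> ?D \<or> z = h (x, 1) \<and> (x, 1) \<in> ?D \<or> z = h (x, 2) \<and> (x, 2) \<in> ?D"
        by (auto simp: h_def)
      then show "z \<in> h ` ?D" by blast
    qed
  qed
  have injg: "inj_on g ?D"
  proof (rule inj_onI)
    fix p q assume pq: "p \<in> ?D" "q \<in> ?D" "g p = g q"
    obtain x i where p: "p = (x, i)" by fastforce
    obtain y j where q: "q = (y, j)" by fastforce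
    have xy: "x \<in> K" "y \<in> K" "rp x" "rp y" "i < 3" "j < 3" using pq p q rp_K by (auto simp: R_def)
    then have "cy (g p) = cy x" "cy (g q) = cy y" using p q by (auto simp: g_def cy_su cy_pr)
    then have "x = y" using pq xy rp_unique by metis
    moreover have "x \<noteq> su x" "x \<noteq> pr x" "su x \<noteq> pr x"
      using su_neq[of x] su_neq[of "pr x"] su_su_neq[of "pr x"] pr_K su_pr xy by metis+
    ultimately have "i = j" using pq(3) p q xy(5,6) by (auto simp: g_def split: if_splits)
    then show "p = q" using p q \<open>x = y\<close> by simp
  qed
  have "x \<in> U" "su x \<in> U" "pr x \<in> U" if "x \<in> R" for x
    using that cl RU K_less[OF su_K[OF rp_K]] K_less[OF pr_K[OF rp_K]]
    unfolding closed_def by (auto simp: U_def R_def)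
  then have "g ` ?D \<subseteq> U" by (auto simp: g_def split: if_splits)
  moreover have "card (h ` ?D) \<le> card (g ` ?D)"
    using card_image_le[of ?D h] card_image[OF injg] finite_subset[OF RU finU] by simp
  ultimately have "g ` ?D = U" using card_seteq[OF finU] hU by metis
  moreover have "y \<in> U" using y by (simp add: U_def)
  ultimately obtain x k where "x \<in> R" "y = g (x, k)" by auto
  then show ?thesis using rp_K su_K pr_K by (auto simp: g_def R_def)
qed

text \<open>\<open>ei (rm x)\<close> is the edge removed from the cycle represented by \<open>x\<close>, and \<open>D\<close> is the set of
  representatives of triangles whose edge has moved to the next part.\<close>

definition label_inv :: "(nat \<Rightarrow> nat) \<Rightarrow> nat set \<Rightarrow> nat set \<Rightarrow> bool" where
  "label_inv out T D \<longleftrightarrow>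
    (\<exists>rm. (\<forall>x. rp x \<longrightarrow> rm x \<in> K \<and> cy (rm x) = cy x) \<and>
      {i. i < m \<and> out i \<noteq> c i} = ei ` rm ` {x. rp x \<and> x mod n \<in> T}) \<and>
    {i. i < m \<and> out i \<noteq> c i \<and> out i \<noteq> 3} = ei ` D \<and>
    (\<forall>x\<in>D. rp x \<and> x mod n \<in> T \<and> out (ei x) = next_color (c (ei x)) \<and> vr x \<in> K \<and> vr (su x) \<in> K) \<and>
    inj_on (\<lambda>(x, z). cy (if z then vr x else vr (su x))) (D \<times> UNIV)"

text \<open>\<open>A\<close> is the set \<open>T\<close> at the last restart and \<open>e\<close> holds the edge that links the tree growing since
  then to \<open>A\<close>. This edge is kept apart because its end outside \<open>A\<close> is reached by the growth only later.\<close>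

definition tree_parts :: "(nat \<Rightarrow> nat) \<Rightarrow> nat set \<Rightarrow> nat set \<Rightarrow> nat set set \<Rightarrow> nat set set \<Rightarrow> bool" where
  "tree_parts out T A M e \<longleftrightarrow> A \<subseteq> T \<and> closed A \<and> forest M \<and>
     (\<forall>f\<in>M. f \<subseteq> A \<or> f \<subseteq> T - A) \<and> {vedge i | i. i < m \<and> out i = 3} \<subseteq> M \<union> e \<and>
     (e \<noteq> {} \<longrightarrow> (\<forall>x < 3 * n. mt x \<and> \<not> rl x \<longrightarrow> x mod n \<in> T) \<and>
       (\<exists>x t. rp x \<and> x mod n \<in> T \<and> su x mod n \<notin> A \<and> t \<in> A \<and> e = {{su x mod n, t}}))"

section \<open>Acyclicity of the removed edges\<close>

definition tree_inv :: "(nat \<Rightarrow> nat) \<Rightarrow> nat set \<Rightarrow> bool" where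
  "tree_inv out T \<longleftrightarrow> (\<exists>A M e. tree_parts out T A M e)"

text \<open>Once stuck, the pending link is harmless. Its far end is in \<open>T\<close>: otherwise
  \<open>closed_covers\<close> assigns that slot to a representative outside \<open>T\<close>, which
  represents the cycle of \<open>x\<close> and hence is \<open>x\<close>, a member of
  \<open>T\<close>. As no edge of \<open>M\<close> leaves \<open>A\<close>, the link joins two
  different components.\<close>

lemma tree_inv_closed:
  assumes "tree_inv out T" "closed T"
  shows "forest {vedge i | i. i < m \<and> out i = 3} \<and> \<Union>{vedge i | i. i < m \<and> out i = 3} \<subseteq> T"
proof -
  let ?G = "{vedge i | i. i < m \<and> out i = 3}"
  obtain A M e where "tree_parts out T A M e" using assms unfolding tree_inv_def by blast
  then have A: "A \<subseteq> T" "forest M" "\<forall>f\<in>M. f \<subseteq> A \<or> f \<subseteq> T - A" "?G \<subseteq> M \<union> e"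
    and e: "e \<noteq> {} \<longrightarrow> (\<forall>x < 3 * n. mt x \<and> \<not> rl x \<longrightarrow> x mod n \<in> T) \<and>
       (\<exists>x t. rp x \<and> x mod n \<in> T \<and> su x mod n \<notin> A \<and> t \<in> A \<and> e = {{su x mod n, t}})"
    unfolding tree_parts_def by simp_all
  show ?thesis
  proof (cases "e = {}")
    case True
    then have "?G \<subseteq> M" using A(4) by simp
    moreover have "\<Union>M \<subseteq> T" using A(1,3) by blast
    ultimately show ?thesis using forest_mono[OF A(2)] by (meson Union_mono order_trans)
  next
    case False
    then obtain x t where x: "rp x" "x mod n \<in> T" "su x mod n \<notin> A" "t \<in> A" "e = {{su x mod n, t}}"
      and ex: "\<forall>x < 3 * n. mt x \<and> \<not> rl x \<longrightarrow> x mod n \<in> T"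
      using e by blast
    let ?p = "su x mod n"
    have xK: "x \<in> K" using rp_K x by simp
    have "?p \<in> T"
    proof (rule ccontr)
      assume "?p \<notin> T"
      then obtain y where y: "rp y" "y mod n \<notin> T" "su x = pr y \<or> su x = y \<or> su x = su y"
        using closed_covers[OF assms(2) ex K_less[OF su_K[OF xK]]] by blast
      then have "cy y = cy x" using cy_su[OF xK] cy_su cy_pr rp_K by metis
      then show False using rp_unique x y by metis
    qed
    have "(t, ?p) \<notin> (adj_rel M)\<^sup>*"
    proof
      assume "(t, ?p) \<in> (adj_rel M)\<^sup>*"
      then have "?p \<in> A" by (rule adj_rel_invariant) (use x A(3) in auto)
      then show False using x by simp
    qed
    from forest_insert[OF A(2) this] have "forest (insert {t, ?p} M)" .
    moreover have "?G \<subseteq> insert {t, ?p} M" using A(4) x(5) by (auto simp: insert_commute)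
    moreover have "\<Union>(insert {t, ?p} M) \<subseteq> T" using A(1,3) x(4) \<open>?p \<in> T\<close> by blast
    ultimately show ?thesis using forest_mono by (meson Union_mono order_trans)
  qed
qed

text \<open>\<open>closed A\<close> keeps the growth off \<open>A\<close>: the vertex to which
  \<open>y\<close> is attached is a neighbour of a representative outside \<open>A\<close>, hence
  outside \<open>A\<close> itself. So the new tree touches \<open>A\<close> only through the pending
  link.\<close>

lemma tree_inv_grow:
  assumes "tree_inv out T" and x: "x \<in> K" "x mod n \<in> T" and y: "rp y" "y mod n \<notin> T"
    and adj: "y = su x \<and> i = ei x \<or> y = pr x \<and> i = ei y"
  shows "tree_inv (out(i := 3)) (insert (y mod n) T)"
proof -
  let ?q = "y mod n"
  obtain A M e where "tree_parts out T A M e" using assms unfolding tree_inv_def by blast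
  then have A: "A \<subseteq> T" "closed A" "forest M" "\<forall>f\<in>M. f \<subseteq> A \<or> f \<subseteq> T - A"
    "{vedge i | i. i < m \<and> out i = 3} \<subseteq> M \<union> e"
    and e: "e \<noteq> {} \<longrightarrow> (\<forall>x < 3 * n. mt x \<and> \<not> rl x \<longrightarrow> x mod n \<in> T) \<and>
       (\<exists>x t. rp x \<and> x mod n \<in> T \<and> su x mod n \<notin> A \<and> t \<in> A \<and> e = {{su x mod n, t}})"
    unfolding tree_parts_def by simp_all
  have ve: "vedge i = {x mod n, ?q}"
    using adj x vedge_ei[of x] vedge_ei[of "pr x"] pr_K[of x] su_pr[of x] by auto
  have "x = pr y \<or> x = su y" using adj x pr_su su_pr by metis
  then have xA: "x mod n \<notin> A" using A(1,2) y unfolding closed_def by blast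
  have MT: "\<Union>M \<subseteq> T" using A(1,4) by blast
  have "?q \<notin> \<Union>M" "x mod n \<noteq> ?q" using MT x y by auto
  from forest_insert_fresh[OF A(3) this] have "forest (insert {x mod n, ?q} M)" .
  moreover have "\<forall>f\<in>insert {x mod n, ?q} M. f \<subseteq> A \<or> f \<subseteq> insert ?q T - A"
    using A(1,4) xA x y by blast
  moreover have "{vedge j | j. j < m \<and> (out(i := 3)) j = 3} \<subseteq> insert {x mod n, ?q} M \<union> e"
    using A(5) ve by auto
  ultimately have "tree_parts (out(i := 3)) (insert ?q T) A (insert {x mod n, ?q} M) e"
    unfolding tree_parts_def
  proof (intro conjI impI)
    assume ne: "e \<noteq> {}"
    then show "\<forall>x < 3 * n. mt x \<and> \<not> rl x \<longrightarrow> x mod n \<in> insert ?q T" using e by simp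
    obtain z t where "rp z" "z mod n \<in> T" "su z mod n \<notin> A" "t \<in> A" "e = {{su z mod n, t}}"
      using e ne by blast
    then show "\<exists>x t. rp x \<and> x mod n \<in> insert ?q T \<and> su x mod n \<notin> A \<and> t \<in> A \<and> e = {{su x mod n, t}}"
      by (intro exI[of _ z] exI[of _ t]) simp
  qed (use A(1,2) in auto)
  then show ?thesis unfolding tree_inv_def by blast
qed

text \<open>A restart that removes no edge: everything built so far becomes \<open>A\<close>, and an
  old pending link is absorbed into \<open>M\<close>. The premise on labels allows an edge to move
  into another part.\<close>

lemma tree_inv_source:
  assumes "tree_inv out T" "closed T" "{vedge i | i. i < m \<and> out' i = 3} \<subseteq> {vedge i | i. i < m \<and> out i = 3}"
  shows "tree_inv out' (insert p T)"
proof -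
  let ?G = "{vedge i | i. i < m \<and> out i = 3}"
  have "forest ?G" "\<Union>?G \<subseteq> T" using tree_inv_closed[OF assms(1,2)] by simp_all
  then have "tree_parts out' (insert p T) T ?G {}" unfolding tree_parts_def using assms by blast
  then show ?thesis unfolding tree_inv_def by blast
qed

text \<open>On a cycle with at least four vertices, \<open>su (su x)\<close> is none of
  \<open>pr x\<close>, \<open>x\<close>, \<open>su x\<close>, so it belongs to no triple of a
  representative outside \<open>T\<close> and must be in \<open>T\<close> by
  \<open>closed_covers\<close>. Its edge to \<open>su x\<close> becomes the pending link.\<close>

lemma tree_inv_long:
  assumes "tree_inv out T" "closed T" and x: "rp x" "x mod n \<notin> T" and long: "su (su (su x)) \<noteq> x"
    and ex: "\<forall>x < 3 * n. mt x \<and> \<not> rl x \<longrightarrow> x mod n \<in> T"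
  shows "tree_inv (out(ei (su x) := 3)) (insert (x mod n) T)"
proof -
  let ?G = "{vedge i | i. i < m \<and> out i = 3}"
  let ?p = "su x" and ?t = "su (su x)"
  have K: "x \<in> K" "?p \<in> K" "?t \<in> K" using rp_K x su_K by auto
  have G: "forest ?G" "\<Union>?G \<subseteq> T" using tree_inv_closed[OF assms(1,2)] by simp_all
  have p: "?p mod n \<notin> T" using assms(2) x unfolding closed_def by blast
  have t: "?t mod n \<in> T"
  proof (rule ccontr)
    assume "?t mod n \<notin> T"
    then obtain y where y: "rp y" "y mod n \<notin> T" "?t = pr y \<or> ?t = y \<or> ?t = su y"
      using closed_covers[OF assms(2) ex K_less[OF K(3)]] by blast
    then have "cy y = cy x" using cy_su K cy_pr rp_K by metis
    then have "y = x" using rp_unique x y by metis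
    then show False using y(3) K su_su_neq su_neq long su_pr by metis
  qed
  have "tree_parts (out(ei (su x) := 3)) (insert (x mod n) T) T ?G {{?p mod n, ?t mod n}}"
    unfolding tree_parts_def
  proof (intro conjI impI)
    show "{vedge i |i. i < m \<and> (out(ei ?p := 3)) i = 3} \<subseteq> ?G \<union> {{?p mod n, ?t mod n}}"
      using vedge_ei[OF K(2)] by auto
    show "\<exists>x' t. rp x' \<and> x' mod n \<in> insert (x mod n) T \<and> su x' mod n \<notin> T \<and> t \<in> T \<and>
      {{?p mod n, ?t mod n}} = {{su x' mod n, t}}"
      using x p t by blast
  qed (use G assms(2) ex in auto)
  then show ?thesis unfolding tree_inv_def by blast
qed

text \<open>Common to growth steps and restarts: as \<open>x\<close> is not yet in \<open>T\<close>,
  its cycle is intact, and relabelling one edge of it makes the cycle of \<open>x\<close> the only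
  newly broken one.\<close>

lemma label_inv_label:
  assumes inv: "label_inv out T D" and x: "rp x" "x mod n \<notin> T" and r: "r \<in> K" "cy r = cy x"
    and lab: "lab \<noteq> c (ei r)"
  shows "\<exists>rm. (\<forall>y. rp y \<longrightarrow> rm y \<in> K \<and> cy (rm y) = cy y) \<and>
      {i. i < m \<and> (out(ei r := lab)) i \<noteq> c i} = ei ` rm ` {y. rp y \<and> y mod n \<in> insert (x mod n) T}"
    and "out (ei r) = c (ei r)"
proof -
  obtain rm where rm: "\<And>y. rp y \<Longrightarrow> rm y \<in> K \<and> cy (rm y) = cy y"
    "{i. i < m \<and> out i \<noteq> c i} = ei ` rm ` {y. rp y \<and> y mod n \<in> T}"
    using inv unfolding label_inv_def by blast
  show "out (ei r) = c (ei r)"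
  proof (rule ccontr)
    assume "out (ei r) \<noteq> c (ei r)"
    then have "ei r \<in> ei ` rm ` {y. rp y \<and> y mod n \<in> T}" using rm(2) ei_less r by blast
    then obtain y where y: "rp y" "y mod n \<in> T" "ei r = ei (rm y)" by auto
    then have "r = rm y" using ei_inj rm(1) r by (meson inj_onD)
    then have "y = x" using rm(1)[OF y(1)] y r x rp_unique by metis
    then show False using x y by simp
  qed
  \<comment> \<open>A vertex represents at most one cycle, so adding the vertex of \<open>x\<close>
    adds no other representative.\<close>
  have "{y. rp y \<and> y mod n \<in> insert (x mod n) T} = insert x {y. rp y \<and> y mod n \<in> T}"
    using x rp_vertex_unique by blast
  moreover have "(rm(x := r)) ` {y. rp y \<and> y mod n \<in> T} = rm ` {y. rp y \<and> y mod n \<in> T}"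
    using x by (intro image_cong) auto
  ultimately have "ei ` (rm(x := r)) ` {y. rp y \<and> y mod n \<in> insert (x mod n) T} =
      insert (ei r) (ei ` rm ` {y. rp y \<and> y mod n \<in> T})"
    by (simp only: image_insert fun_upd_same)
  also have "\<dots> = {i. i < m \<and> (out(ei r := lab)) i \<noteq> c i}"
    unfolding rm(2)[symmetric] using lab ei_less[OF r(1)] by auto
  finally have "{i. i < m \<and> (out(ei r := lab)) i \<noteq> c i} =
      ei ` (rm(x := r)) ` {y. rp y \<and> y mod n \<in> insert (x mod n) T}" by simp
  moreover have "\<forall>y. rp y \<longrightarrow> (rm(x := r)) y \<in> K \<and> cy ((rm(x := r)) y) = cy y" using rm(1) r by simp
  ultimately show "\<exists>rm. (\<forall>y. rp y \<longrightarrow> rm y \<in> K \<and> cy (rm y) = cy y) \<and>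
      {i. i < m \<and> (out(ei r := lab)) i \<noteq> c i} = ei ` rm ` {y. rp y \<and> y mod n \<in> insert (x mod n) T}"
    by blast
qed

text \<open>The relabelled edge still had its original part, so it is none of the moved ones and the
  data about \<open>D\<close> persist.\<close>

lemma label_inv_three:
  assumes inv: "label_inv out T D" and x: "rp x" "x mod n \<notin> T" and r: "r \<in> K" "cy r = cy x"
  shows "label_inv (out(ei r := 3)) (insert (x mod n) T) D"
proof -
  have c3: "3 \<noteq> c (ei r)" using c_less[OF ei_less[OF r(1)]] by simp
  note L = label_inv_label[OF inv x r c3]
  have D: "{i. i < m \<and> out i \<noteq> c i \<and> out i \<noteq> 3} = ei ` D"
    "\<forall>x\<in>D. rp x \<and> x mod n \<in> T \<and> out (ei x) = next_color (c (ei x)) \<and> vr x \<in> K \<and> vr (su x) \<in> K"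
    "inj_on (\<lambda>(x, z). cy (if z then vr x else vr (su x))) (D \<times> UNIV)"
    using inv unfolding label_inv_def by blast+
  have neq: "ei y \<noteq> ei r" if "y \<in> D" for y
  proof
    assume "ei y = ei r"
    then have "out (ei r) = next_color (c (ei r))" using D(2) that by metis
    then show False using L(2) next_color_neq(1) by metis
  qed
  have "{i. i < m \<and> (out(ei r := 3)) i \<noteq> c i \<and> (out(ei r := 3)) i \<noteq> 3} = {i. i < m \<and> out i \<noteq> c i \<and> out i \<noteq> 3}"
    using L(2) by auto
  then show ?thesis unfolding label_inv_def
  proof (intro conjI)
    show "\<forall>y\<in>D. rp y \<and> y mod n \<in> insert (x mod n) T \<and>
      (out(ei r := 3)) (ei y) = next_color (c (ei y)) \<and> vr y \<in> K \<and> vr (su y) \<in> K"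
      using D(2) neq by simp
  qed (use L(1) D in simp_all)
qed

lemma label_inv_exposed:
  assumes "label_inv out T D" "\<And>x. rp x \<Longrightarrow> x mod n \<noteq> p"
  shows "label_inv out (insert p T) D"
proof -
  have "{x. rp x \<and> x mod n \<in> insert p T} = {x. rp x \<and> x mod n \<in> T}" using assms(2) by auto
  then show ?thesis using assms(1) unfolding label_inv_def by auto
qed

text \<open>By \<open>closed_covers\<close> the slot lies in the triple of a representative outside
  \<open>T\<close>. The cycle being a triangle, that triple is the whole cycle; so all its vertices
  are outside \<open>T\<close>, and any two of its slots are equal or adjacent.\<close>

lemma outside_cycle:
  assumes cl: "closed T" and ex: "\<forall>x < 3 * n. mt x \<and> \<not> rl x \<longrightarrow> x mod n \<in> T"
    and long: "\<forall>x. rp x \<and> su (su (su x)) \<noteq> x \<longrightarrow> x mod n \<in> T"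
    and y: "y < 3 * n" "y mod n \<notin> T"
  shows "y \<in> K" and "z \<in> K \<Longrightarrow> cy z = cy y \<Longrightarrow> z mod n \<notin> T"
    and "z \<in> K \<Longrightarrow> cy z = cy y \<Longrightarrow> z = y \<or> z = su y \<or> y = su z"
proof -
  show yK: "y \<in> K" using closed_covers[OF cl ex y] by blast
  obtain x where x: "rp x" "x mod n \<notin> T" "y = pr x \<or> y = x \<or> y = su x"
    using closed_covers[OF cl ex y] by blast
  have xK: "x \<in> K" using rp_K x by simp
  have tri: "su (su (su x)) = x" using long x by blast
  have pr: "pr x = su (su x)" using tri pr_su su_K xK by metis
  have cyx: "cy y = cy x" using x(3) cy_su cy_pr xK by metis
  {
    assume z: "z \<in> K" "cy z = cy y"
    then have zo: "z = x \<or> z = su x \<or> z = su (su x)" using triangle_orbit[OF xK tri z(1)] cyx by simp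
    then show "z mod n \<notin> T" using cl x(1,2) pr unfolding closed_def by metis
    show "z = y \<or> z = su y \<or> y = su z" using zo x(3) pr tri by auto
  }
qed

text \<open>In the next part both ends of the moved edge lie on triangles entirely outside
  \<open>T\<close>. These are different, since on one triangle the ends would be joined by a second
  edge with the same two vertices. Triangles joined at earlier moves contain a vertex of
  \<open>T\<close>, so none is joined twice.\<close>

lemma label_inv_kill:
  assumes inv: "label_inv out T D" and cl: "closed T"
    and ex: "\<forall>x < 3 * n. mt x \<and> \<not> rl x \<longrightarrow> x mod n \<in> T"
    and long: "\<forall>x. rp x \<and> su (su (su x)) \<noteq> x \<longrightarrow> x mod n \<in> T"
    and x: "rp x" "x mod n \<notin> T"
  shows "label_inv (out(ei x := next_color (c (ei x)))) (insert (x mod n) T) (insert x D)"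
proof -
  let ?lab = "next_color (c (ei x))"
  let ?out = "out(ei x := ?lab)"
  have xK: "x \<in> K" using rp_K x by simp
  have lab: "?lab \<noteq> c (ei x)" "?lab \<noteq> 3"
    using next_color_neq c_less[OF ei_less[OF xK]] by (auto simp: less_le)
  note L = label_inv_label[OF inv x xK refl lab(1)]
  note O = outside_cycle[OF cl ex long]
  have D: "{i. i < m \<and> out i \<noteq> c i \<and> out i \<noteq> 3} = ei ` D"
    "\<forall>x\<in>D. rp x \<and> x mod n \<in> T \<and> out (ei x) = next_color (c (ei x)) \<and> vr x \<in> K \<and> vr (su x) \<in> K"
    "inj_on (\<lambda>(x, z). cy (if z then vr x else vr (su x))) (D \<times> UNIV)"
    using inv unfolding label_inv_def by blast+
  have neq: "ei y \<noteq> ei x" if "y \<in> D" for y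
  proof
    assume "ei y = ei x"
    then have "out (ei x) = ?lab" using D(2) that by metis
    then show False using L(2) next_color_neq(1) by metis
  qed
  have sx: "su x mod n \<notin> T" using cl x unfolding closed_def by blast
  have less: "x < 3 * n" "su x < 3 * n" using K_less xK su_K by auto
  then have vless: "vr x < 3 * n" "vr (su x) < 3 * n" using vr_less by auto
  have out1: "vr x mod n \<notin> T" "vr (su x) mod n \<notin> T" using x sx vr_mod by auto
  have vK: "vr x \<in> K" "vr (su x) \<in> K" using O(1) vless out1 by blast+
  have cyne: "cy (vr x) \<noteq> cy (vr (su x))"
  proof
    assume eq: "cy (vr x) = cy (vr (su x))"
    have "vr (su x) = vr x \<or> vr (su x) = su (vr x) \<or> vr x = su (vr (su x))"
      using O(3)[OF vless(1) out1(1) vK(2)] eq by simp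
    moreover have "vr (su x) \<noteq> vr x"
    proof
      assume "vr (su x) = vr x"
      then have "su x mod n = x mod n" by (metis vr_mod)
      moreover have "su x div n = x div n" using su_div xK by simp
      ultimately show False using su_neq xK by (metis div_mult_mod_eq)
    qed
    ultimately obtain z where z: "z \<in> K" "{z, su z} = {vr x, vr (su x)}"
      using vK by (metis insert_commute)
    then have "vedge (ei z) = (\<lambda>p. p mod n) ` {vr x, vr (su x)}" using vedge_ei by (metis image_insert image_empty)
    then have "vedge (ei z) = vedge (ei x)" using vedge_ei[OF xK] vr_mod by simp
    then have "ei z = ei x" using vedge_inj ei_less z(1) xK by blast
    then have "z = x" using ei_inj z(1) xK by (meson inj_onD)
    \<comment> \<open>The edge found would have to be \<open>ei x\<close> itself, but it lies in the
      next part.\<close>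
    moreover have "z div n = vr x div n" using z su_div[OF z(1)] su_div[OF xK] vr_div[OF less(1)] vr_div[OF less(2)]
      by (metis doubleton_eq_iff)
    ultimately show False using vr_div[OF less(1)] next_color_neq(1) by metis
  qed
  \<comment> \<open>\<open>d\<close> is in \<open>T\<close> since its move, and \<open>su d\<close>
    must be too: otherwise the triangle of \<open>d\<close> would lie entirely outside
    \<open>T\<close>.\<close>
  have old: "z mod n \<in> T" if "d \<in> D" "z = vr d \<or> z = vr (su d)" for d z
  proof -
    have d: "rp d" "d mod n \<in> T" using D(2) that by auto
    have "su d mod n \<in> T"
    proof (rule ccontr)
      assume "su d mod n \<notin> T"
      have dK: "d \<in> K" using rp_K d by simp
      have "cy d = cy (su d)" using cy_su dK by simp
      from O(2)[OF K_less[OF su_K[OF dK]] \<open>su d mod n \<notin> T\<close> dK this]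
      show False using d by simp
    qed
    then show ?thesis using that(2) d vr_mod by metis
  qed
  have new: "cy z \<noteq> cy w" if "d \<in> D" "z = vr d \<or> z = vr (su d)" "w = vr x \<or> w = vr (su x)" for d z w
  proof
    assume eq: "cy z = cy w"
    have "z \<in> K" using D(2) that by auto
    have "w < 3 * n" "w mod n \<notin> T" using that(3) vless out1 by auto
    from O(2)[OF this \<open>z \<in> K\<close> eq] show False using old[OF that(1,2)] by simp
  qed
  show ?thesis unfolding label_inv_def
  proof (intro conjI)
    show "{i. i < m \<and> ?out i \<noteq> c i \<and> ?out i \<noteq> 3} = ei ` insert x D"
    proof -
      have "{i. i < m \<and> ?out i \<noteq> c i \<and> ?out i \<noteq> 3} = insert (ei x) {i. i < m \<and> out i \<noteq> c i \<and> out i \<noteq> 3}"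
        using L(2) lab ei_less[OF xK] by auto
      then show ?thesis using D(1) by simp
    qed
    show "\<forall>y\<in>insert x D. rp y \<and> y mod n \<in> insert (x mod n) T \<and>
      ?out (ei y) = next_color (c (ei y)) \<and> vr y \<in> K \<and> vr (su y) \<in> K"
      using D(2) neq x vK by simp
    show "inj_on (\<lambda>(x, z). cy (if z then vr x else vr (su x))) (insert x D \<times> UNIV)"
    proof (rule inj_onI, clarify)
      fix y z y' z'
      assume A: "y \<in> insert x D" "y' \<in> insert x D"
        "cy (if z then vr y else vr (su y)) = cy (if z' then vr y' else vr (su y'))"
      consider "y \<in> D" "y' \<in> D" | "y = x" "y' = x" | "y \<in> D" "y' = x" | "y = x" "y' \<in> D"
        using A by blast
      then show "y = y' \<and> z = z'"
      proof cases
        case 1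
        then show ?thesis using inj_onD[OF D(3), of "(y, z)" "(y', z')"] A(3) by simp
      next
        case 2
        then show ?thesis using A(3) cyne by (auto split: if_splits)
      next
        case 3
        have "cy (if z then vr y else vr (su y)) \<noteq> cy (if z' then vr x else vr (su x))"
          by (rule new[OF 3(1)]) auto
        then have False using A(3) 3(2) by metis
        then show ?thesis ..
      next
        case 4
        have "cy (if z' then vr y' else vr (su y')) \<noteq> cy (if z then vr x else vr (su x))"
          by (rule new[OF 4(2)]) auto
        then have False using A(3) 4(1) by metis
        then show ?thesis ..
      qed
    qed
  qed (use L(1) in simp)
qed

section \<open>The four parts at the end of the growth\<close>

lemma final_labels:
  assumes inv: "label_inv out {..<n} D" and i: "i < m"
  shows "out i < 4"
proof -
  have "out i = c i \<or> out i = 3 \<or> i \<in> ei ` D" using inv i unfolding label_inv_def by blast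
  moreover have "out (ei x) < 3" if "x \<in> D" for x
    using inv that c_less[OF ei_less[OF rp_K]] next_color_neq(2) unfolding label_inv_def by metis
  ultimately show ?thesis using c_less[OF i] by fastforce
qed

text \<open>A cycle of original edges is a cycle of its part, and that has lost an edge. A cycle
  with a moved edge contains a bypass of this edge, which cannot leave the old component of one end:
  by the injectivity in \<open>label_inv\<close>, every other moved edge joins components with other
  cycles. So the two ends would share a cycle, against the same injectivity.\<close>

lemma final_color_forest:
  assumes inv: "label_inv out {..<n} D" and k: "k < 3"
  shows "forest {vedge i | i. i < m \<and> out i = k}"
  unfolding forest_def
proof (rule notI, elim exE)
  let ?F = "{vedge i | i. i < m \<and> out i = k}"
  fix C assume C: "is_cycle ?F C"
  obtain rm where rm: "\<And>y. rp y \<Longrightarrow> rm y \<in> K \<and> cy (rm y) = cy y"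
    "{i. i < m \<and> out i \<noteq> c i} = ei ` rm ` {y. rp y \<and> y mod n \<in> {..<n}}"
    using inv unfolding label_inv_def by blast
  have D: "{i. i < m \<and> out i \<noteq> c i \<and> out i \<noteq> 3} = ei ` D"
    "\<And>x. x \<in> D \<Longrightarrow> rp x \<and> out (ei x) = next_color (c (ei x)) \<and> vr x \<in> K \<and> vr (su x) \<in> K"
    "inj_on (\<lambda>(x, z). cy (if z then vr x else vr (su x))) (D \<times> UNIV)"
    using inv unfolding label_inv_def by blast+
  show False
  proof (cases "\<exists>i. i < m \<and> out i = k \<and> c i \<noteq> k \<and> vedge i \<in> C")
    case False
    let ?E = "{vedge i | i. i < m \<and> out i = k \<and> c i = k}"
    have "C \<subseteq> ?F" using C by (auto simp: is_cycle_def)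
    then have "C \<subseteq> ?E" using False by blast
    then have CE: "is_cycle ?E C" using is_cycle_restrict[OF C] by blast
    have C': "is_cycle ((`) (\<lambda>p. p + n * k) ` ?E) ((`) (\<lambda>p. p + n * k) ` C)"
      by (rule is_cycle_image[OF CE]) (auto simp: inj_on_def)
    have "(`) (\<lambda>p. p + n * k) ` ?E \<subseteq> sgraph"
    proof
      fix f assume "f \<in> (`) (\<lambda>p. p + n * k) ` ?E"
      then obtain e where e: "e \<in> ?E" "f = (\<lambda>p. p + n * k) ` e" by (rule imageE)
      then obtain i where i: "i < m" "c i = k" "f = (\<lambda>p. p + n * k) ` vedge i" by auto
      then have "f = sedge i" using sedge_vedge by simp
      then show "f \<in> sgraph" using i(1) by (simp add: sgraph_def)
    qed
    note is_cycle_mono[OF C' this]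
    then obtain x where x: "x \<in> K" "(`) (\<lambda>p. p + n * k) ` C = sedge ` ei ` {y \<in> K. cy y = cy x}"
      using cycle_K by blast
    obtain y where y: "rp y" "cy y = cy x" using rp_ex x(1) by blast
    let ?i = "ei (rm y)"
    have "n > 0" using y by (auto simp: rp_def)
    then have "?i \<in> {i. i < m \<and> out i \<noteq> c i}" unfolding rm(2) using y by simp
    then have i: "?i < m" "out ?i \<noteq> c ?i" by auto
    have "sedge ?i \<in> (`) (\<lambda>p. p + n * k) ` C" unfolding x(2) using rm(1)[OF y(1)] y(2) by auto
    then obtain e where e: "e \<in> C" "sedge ?i = (\<lambda>p. p + n * k) ` e" by blast
    then obtain j where j: "j < m" "out j = k" "c j = k" "e = vedge j" using \<open>C \<subseteq> ?E\<close> by blast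
    have "sedge ?i = sedge j" using e j sedge_vedge by simp
    then have "?i = j" using sedge_inj i j by blast
    then show False using i j by simp
  next
    case True
    then obtain i where i: "i < m" "out i = k" "c i \<noteq> k" "vedge i \<in> C" by blast
    then have "i \<in> ei ` D" unfolding D(1)[symmetric] using k by auto
    then obtain x where x: "x \<in> D" "i = ei x" by blast
    have xr: "rp x" "vr x \<in> K" "vr (su x) \<in> K" using D(2)[OF x(1)] by auto
    have xK: "x \<in> K" using rp_K xr by simp
    have slot: "z mod n + n * k = vr z" if "z \<in> K" "c (ei w) = z div n" "out (ei w) = k" "w \<in> D" for z w
    proof -
      have "vr z div n = k" using vr_div[OF K_less[OF that(1)]] D(2)[OF that(4)] that by simp
      then show ?thesis using vr_mod[of z] by (metis mod_div_decomp add.commute mult.commute)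
    qed
    let ?p = "x mod n" and ?q = "su x mod n"
    have ve: "vedge i = {?p, ?q}" using vedge_ei[OF xK] x by simp
    have sp: "?p + n * k = vr x" using slot[OF xK _ _ x(1)] c_ei[OF xK] x i by simp
    have sq: "?q + n * k = vr (su x)" using slot[OF su_K[OF xK] _ _ x(1)] c_ei[OF xK] su_div[OF xK] x i by simp
    \<comment> \<open>\<open>z + n * k\<close> is the slot of vertex \<open>z\<close> in part
      \<open>k\<close>; the predicate says that it lies in the component that \<open>vr x\<close>
      had before any edge was moved.\<close>
    let ?P = "\<lambda>z. (vr x, z + n * k) \<in> (adj_rel sgraph)\<^sup>*"
    have byp: "(?p, ?q) \<in> (adj_rel (C - {{?p, ?q}}))\<^sup>*" using cycle_bypass[OF C] i ve by simp
    have "?P ?q"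
    proof (rule adj_rel_invariant[OF byp])
      show "?P ?p" using sp by simp
      fix p q assume pq: "{p, q} \<in> C - {{?p, ?q}}" "?P p"
      then have "{p, q} \<in> ?F" using C unfolding is_cycle_def by blast
      then obtain j where j: "j < m" "out j = k" "{p, q} = vedge j" by blast
      show "?P q"
      proof (cases "c j = k")
        case True
        then have "sedge j = {p + n * k, q + n * k}" using sedge_vedge[of j] j(3)[symmetric] by simp
        then have "(p + n * k, q + n * k) \<in> adj_rel sgraph" using j unfolding adj_rel_def sgraph_def by auto
        then show ?thesis using pq(2) by (simp add: rtrancl_into_rtrancl)
      next
        case False
        then have "j \<in> ei ` D" unfolding D(1)[symmetric] using j k by auto
        then obtain y where y: "y \<in> D" "j = ei y" by blast
        have yr: "rp y" "vr y \<in> K" "vr (su y) \<in> K" using D(2)[OF y(1)] by auto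
        have yK: "y \<in> K" using rp_K yr by simp
        have "y mod n + n * k = vr y" using slot[OF yK _ _ y(1)] c_ei[OF yK] y j by simp
        moreover have "su y mod n + n * k = vr (su y)"
          using slot[OF su_K[OF yK] _ _ y(1)] c_ei[OF yK] su_div[OF yK] y j by simp
        moreover have "p = y mod n \<or> p = su y mod n" using vedge_ei[OF yK] j y by (metis insertCI insertE singletonD)
        ultimately have "p + n * k = vr y \<or> p + n * k = vr (su y)" by auto
        then have "cy (vr x) = cy (vr y) \<or> cy (vr x) = cy (vr (su y))"
          using cy_connected xr yr pq(2) by metis
        moreover have "cy (vr x) \<noteq> cy (vr (su y))"
          using inj_onD[OF D(3), of "(x, True)" "(y, False)"] x y by auto
        moreover have "cy (vr x) = cy (vr y) \<Longrightarrow> x = y"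
          using inj_onD[OF D(3), of "(x, True)" "(y, True)"] x y by auto
        ultimately have "x = y" by blast
        then show ?thesis using pq(1) ve j y x by auto
      qed
    qed
    then have "cy (vr x) = cy (vr (su x))" using cy_connected xr sq by metis
    then show False using inj_onD[OF D(3), of "(x, True)" "(x, False)"] x by auto
  qed
qed

text \<open>Edges with label 3 at \<open>p\<close> come from different parts: within one part the
  slot of \<open>p\<close> is on at most one cycle, and each cycle loses a single edge.\<close>

lemma final_degree:
  assumes inv: "label_inv out {..<n} D"
  shows "card {i. i < m \<and> out i = 3 \<and> p \<in> vedge i} \<le> 3"
proof -
  obtain rm where rm: "\<And>y. rp y \<Longrightarrow> rm y \<in> K \<and> cy (rm y) = cy y"
    "{i. i < m \<and> out i \<noteq> c i} = ei ` rm ` {y. rp y \<and> y mod n \<in> {..<n}}"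
    using inv unfolding label_inv_def by blast
  let ?A = "{i. i < m \<and> out i = 3 \<and> p \<in> vedge i}"
  have "inj_on c ?A"
  proof (rule inj_onI)
    fix i j assume ij: "i \<in> ?A" "j \<in> ?A" "c i = c j"
    have ex: "\<exists>x. rp x \<and> i = ei (rm x) \<and> cy (p + n * c i) = cy x \<and> p + n * c i \<in> K" if "i \<in> ?A" for i
    proof -
      have "out i \<noteq> c i" using c_less[of i] that by auto
      then have "i \<in> ei ` rm ` {y. rp y \<and> y mod n \<in> {..<n}}" using rm(2) that by blast
      then obtain x where x: "rp x" "i = ei (rm x)" by blast
      have "p + n * c i \<in> sedge i" using that sedge_vedge by auto
      then have "p + n * c i = rm x \<or> p + n * c i = su (rm x)" using sedge_ei rm(1) x by auto
      then have "cy (p + n * c i) = cy x \<and> p + n * c i \<in> K"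
        using rm(1)[OF x(1)] cy_su su_K by metis
      then show ?thesis using x by blast
    qed
    obtain x y where "rp x" "i = ei (rm x)" "cy (p + n * c i) = cy x"
      "rp y" "j = ei (rm y)" "cy (p + n * c j) = cy y" using ex ij by meson
    then show "i = j" using ij(3) rp_unique by metis
  qed
  moreover have "c ` ?A \<subseteq> {..<3}" using c_less by auto
  ultimately show ?thesis using card_inj_on_le[of c ?A "{..<3}"] by simp
qed

end

section \<open>Rounding a fractional matching along alternating cycles\<close>

text \<open>Encodes a partition of the slots into blocks of three, each in a cyclic order.\<close>

definition ring3 :: "nat \<Rightarrow> (nat \<Rightarrow> nat) \<Rightarrow> bool" where
  "ring3 N f \<longleftrightarrow> (\<forall>x<N. f x < N \<and> f x \<noteq> x \<and> f (f x) \<noteq> x \<and> f (f (f x)) = x)"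

lemma ring3D: "ring3 N f \<Longrightarrow> x < N \<Longrightarrow> f x < N \<and> f (f x) < N \<and> f x \<noteq> x \<and> f (f x) \<noteq> x \<and> f (f x) \<noteq> f x \<and> f (f (f x)) = x"
  unfolding ring3_def by metis

text \<open>Weights count thirds, so this is a fractional matching saturating every block; the
  uniform one has weight 1 everywhere.\<close>

definition balanced :: "nat \<Rightarrow> (nat \<Rightarrow> nat) \<Rightarrow> (nat \<Rightarrow> nat) \<Rightarrow> bool" where
  "balanced N f w \<longleftrightarrow> (\<forall>x<N. w x + w (f x) + w (f (f x)) = 3)"

definition frac :: "(nat \<Rightarrow> nat) \<Rightarrow> nat \<Rightarrow> bool" where
  "frac w x \<longleftrightarrow> 0 < w x \<and> w x < 3"

text \<open>A second weight that is not fractional must be 0, as 3 would exceed the total, and the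
  third weight is then 3 minus the first. So the walk can always be continued.\<close>

lemma frac_candidate:
  "balanced N f w \<Longrightarrow> x < N \<Longrightarrow> frac w x \<Longrightarrow> \<not> frac w (f x) \<Longrightarrow> frac w (f (f x))"
  unfolding balanced_def frac_def by (drule spec[of _ x]) linarith

lemma balanced_integral:
  assumes "ring3 N f" "balanced N f w" "\<And>x. x < N \<Longrightarrow> \<not> frac w x" "x < N"
  shows "\<exists>y\<in>{x, f x, f (f x)}. w y = 3 \<and> (\<forall>z\<in>{x, f x, f (f x)}. w z = 3 \<longrightarrow> z = y)"
proof -
  note R = ring3D[OF assms(1,4)]
  have "w x + w (f x) + w (f (f x)) = 3" using assms(2,4) by (simp add: balanced_def)
  moreover have "\<not> frac w x" "\<not> frac w (f x)" "\<not> frac w (f (f x))" using assms(3,4) R by auto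
  ultimately consider "w x = 3" "w (f x) = 0" "w (f (f x)) = 0" | "w x = 0" "w (f x) = 3" "w (f (f x)) = 0"
    | "w x = 0" "w (f x) = 0" "w (f (f x)) = 3"
    unfolding frac_def by linarith
  then show ?thesis by cases auto
qed

text \<open>The walk leaves even positions inside a block of \<open>f\<close> and odd ones inside a
  block of \<open>g\<close>, so consecutive slots alternately share a vertex and a triple.\<close>

definition ring_of :: "(nat \<Rightarrow> nat) \<Rightarrow> (nat \<Rightarrow> nat) \<Rightarrow> nat \<Rightarrow> nat \<Rightarrow> nat" where
  "ring_of f g k = (if k mod 2 = 0 then f else g)"

definition alternating :: "nat \<Rightarrow> (nat \<Rightarrow> nat) \<Rightarrow> (nat \<Rightarrow> nat) \<Rightarrow> (nat \<Rightarrow> nat) \<Rightarrow> nat \<Rightarrow> bool" where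
  "alternating N f g st p \<longleftrightarrow> (\<forall>j<p. st j < N) \<and> inj_on st {..<p} \<and>
    (\<forall>j. Suc j < p \<longrightarrow> st (Suc j) = ring_of f g j (st j) \<or> st (Suc j) = ring_of f g j (ring_of f g j (st j)))"

text \<open>The weights after popping the stack down to position \<open>j\<close>: positions of parity \<open>fl\<close> gain one and the
  others lose one. Here \<open>pos x = 0\<close> means that \<open>x\<close> is not on the stack, otherwise \<open>x\<close> is at \<open>pos x - 1\<close>.\<close>

definition shifted :: "(nat \<Rightarrow> nat) \<Rightarrow> (nat \<Rightarrow> nat) \<Rightarrow> nat \<Rightarrow> nat \<Rightarrow> nat \<Rightarrow> nat" where
  "shifted w pos j fl x =
    (if j < pos x then (if (pos x - 1) mod 2 = fl then w x + 1 else w x - 1) else w x)"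

definition stacked :: "nat \<Rightarrow> (nat \<Rightarrow> nat) \<Rightarrow> nat \<Rightarrow> (nat \<Rightarrow> nat) \<Rightarrow> bool" where
  "stacked N st p pos \<longleftrightarrow> (\<forall>j<p. pos (st j) = Suc j) \<and>
    (\<forall>x<N. pos x \<noteq> 0 \<longrightarrow> pos x \<le> p \<and> st (pos x - 1) = x)"

lemma alternating_le: "alternating N f g st p \<Longrightarrow> p \<le> N"
  unfolding alternating_def using card_inj_on_le[of st "{..<p}" "{..<N}"] by auto

locale closing =
  fixes N :: nat and f g w st pos :: "nat \<Rightarrow> nat" and p j0 z :: nat
  assumes rings: "ring3 N f" "ring3 N g"
    and bal: "balanced N f w" "balanced N g w"
    and alt: "alternating N f g st p" and stk: "stacked N st p pos"
    and fr: "\<And>j. j < p \<Longrightarrow> frac w (st j)"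
    and p: "0 < p" and j0: "j0 < p" "st j0 = z"
    and z: "z = ring_of f g (p - 1) (st (p - 1)) \<or>
      z = ring_of f g (p - 1) (ring_of f g (p - 1) (st (p - 1)))"
begin

text \<open>If \<open>j0\<close> has the parity of \<open>p - 1\<close>, then
  \<open>st (Suc j0)\<close> shares a block with \<open>z\<close> and with the top of the stack;
  dropping \<open>z\<close> from the closed walk restores even length.\<close>

definition j :: nat where "j = (if j0 mod 2 = (p - 1) mod 2 then Suc j0 else j0)"

lemma st_less: "k < p \<Longrightarrow> st k < N" using alt by (auto simp: alternating_def)
lemma st_inj: "k < p \<Longrightarrow> l < p \<Longrightarrow> st k = st l \<longleftrightarrow> k = l"
  using alt by (auto simp: alternating_def inj_on_def)

lemma ring_ring_of: "ring3 N (ring_of f g k)"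
  using rings by (simp add: ring_of_def)

text \<open>That at least two slots get popped is what makes the potential in
  \<open>match_correct\<close> drop when a walk closes.\<close>

lemma j_bounds: "j0 \<le> j" "j + 2 \<le> p" "j mod 2 \<noteq> (p - 1) mod 2"
proof -
  have "p - 1 < p" using p by simp
  then have "z \<noteq> st (p - 1)" using z ring3D[OF ring_ring_of[of "p - 1"] st_less] by metis
  then have j0p: "j0 \<noteq> p - 1" using j0 by auto
  show "j0 \<le> j" by (simp add: j_def)
  show par: "j mod 2 \<noteq> (p - 1) mod 2" unfolding j_def by (auto simp: mod_Suc)
  have "j \<noteq> p - 1" using par by auto
  moreover have "j \<le> p - 1" using j0 j0p unfolding j_def by auto
  ultimately show "j + 2 \<le> p" by linarith
qed

definition blk :: "nat \<Rightarrow> nat \<Rightarrow> nat set" where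
  "blk r x = {x, ring_of f g r x, ring_of f g r (ring_of f g r x)}"

lemma blk_step:
  assumes "x < N" "y < N" "y' = ring_of f g r y \<or> y' = ring_of f g r (ring_of f g r y)"
  shows "y' \<in> blk r x \<longleftrightarrow> y \<in> blk r x"
proof -
  note R = ring3D[OF ring_ring_of[of r]]
  let ?F = "ring_of f g r"
  have "?F (?F (?F x)) = x" "?F (?F (?F y)) = y" using R assms by auto
  then show ?thesis using assms(3) unfolding blk_def by (metis insertE insertI1 insertI2 singletonD)
qed

text \<open>Closes the walk: from the top one returns to position \<open>j\<close> inside a block of
  the ring that is next in turn.\<close>

lemma last_blk:
  assumes "x < N"
  shows "st j \<in> blk (p - 1) x \<longleftrightarrow> st (p - 1) \<in> blk (p - 1) x"
proof -
  have "z \<in> blk (p - 1) x \<longleftrightarrow> st (p - 1) \<in> blk (p - 1) x"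
    by (rule blk_step[OF assms _ z]) (use st_less p in auto)
  moreover have "st j \<in> blk (p - 1) x \<longleftrightarrow> z \<in> blk (p - 1) x"
  proof (cases "j = j0")
    case False
    then have "j = Suc j0" and eq: "j0 mod 2 = (p - 1) mod 2" by (auto simp: j_def split: if_splits)
    then have "st j = ring_of f g j0 (st j0) \<or> st j = ring_of f g j0 (ring_of f g j0 (st j0))"
      using alt j_bounds by (auto simp: alternating_def)
    then have "st j = ring_of f g (p - 1) z \<or> st j = ring_of f g (p - 1) (ring_of f g (p - 1) z)"
      using eq j0 by (simp add: ring_of_def)
    then show ?thesis by (intro blk_step[OF assms]) (use j0 st_less in auto)
  qed (use j0 in simp)
  ultimately show ?thesis by simp
qed

definition sgn_at :: "nat \<Rightarrow> nat \<Rightarrow> int" where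
  "sgn_at fl k = (if k mod 2 = fl then 1 else - 1)"

text \<open>Within each block of the ring of parity \<open>r\<close> the entries of the closed alternating walk pair up with
  opposite signs.\<close>

definition partner :: "nat \<Rightarrow> nat \<Rightarrow> nat" where
  "partner r k = (if k mod 2 = r then (if k = p - 1 then j else Suc k) else (if k = j then p - 1 else k - 1))"

text \<open>In the ring of parity \<open>r\<close>, a position of that parity is paired with its
  cyclic successor among \<open>j\<close> to \<open>p - 1\<close>. As the closed walk has even
  length, this is an involution that switches parity.\<close>

lemma partner:
  assumes "r < 2" "fl < 2" "j \<le> k" "k < p"
  shows "j \<le> partner r k" "partner r k < p" "partner r (partner r k) = k"
    "sgn_at fl (partner r k) = - sgn_at fl k"
    "x < N \<Longrightarrow> st (partner r k) \<in> blk r x \<longleftrightarrow> st k \<in> blk r x"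
proof -
  have jp: "j + 2 \<le> p" "j mod 2 \<noteq> (p - 1) mod 2" using j_bounds by auto
  have mp: "(k - 1) mod 2 \<noteq> k mod 2" if "0 < k" using that by (cases k) (auto simp: mod_Suc)
  have ms: "Suc k mod 2 \<noteq> k mod 2" by (auto simp: mod_Suc)
  consider (A) "k mod 2 = r" "k = p - 1" | (B) "k mod 2 = r" "k \<noteq> p - 1"
    | (C) "k mod 2 \<noteq> r" "k = j" | (D) "k mod 2 \<noteq> r" "k \<noteq> j" by blast
  note cs = this
  have F: "ring_of f g k = ring_of f g r" if "k mod 2 = r" for k using that by (auto simp: ring_of_def)
  have B: "blk r x = blk k x" if "k mod 2 = r" for k x using F[OF that] by (simp add: blk_def)
  have step: "st (Suc k) \<in> blk r x \<longleftrightarrow> st k \<in> blk r x" if "k mod 2 = r" "Suc k < p" "x < N" for k x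
    unfolding B[OF that(1)] by (rule blk_step) (use alt that in \<open>auto simp: alternating_def\<close>)
  have last: "st j \<in> blk r x \<longleftrightarrow> st (p - 1) \<in> blk r x" if "(p - 1) mod 2 = r" "x < N" for x
    using last_blk[OF that(2)] B[OF that(1)] by simp
  have D: "0 < k" "(k - 1) mod 2 = r" if "k mod 2 \<noteq> r" "k \<noteq> j"
  proof -
    show "0 < k" using that assms(3) by linarith
    then have "(k - 1) mod 2 \<noteq> k mod 2" by (rule mp)
    moreover have "(k - 1) mod 2 < 2" "k mod 2 < 2" by simp_all
    ultimately show "(k - 1) mod 2 = r" using that(1) assms(1) by linarith
  qed
  have C: "(p - 1) mod 2 = r" if "j mod 2 \<noteq> r" proof -
    have "j mod 2 < 2" "(p - 1) mod 2 < 2" by simp_all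
    then show ?thesis using that jp(2) assms(1) by linarith
  qed
  have v: "partner r k = (if k mod 2 = r then (if k = p - 1 then j else Suc k) else (if k = j then p - 1 else k - 1))" for k
    by (simp add: partner_def)
  show "j \<le> partner r k" unfolding v using assms jp(1) by auto
  show "partner r k < p" unfolding v using assms jp(1) by auto
  have ev: "sgn_at fl l = - sgn_at fl k" if "l mod 2 \<noteq> k mod 2" for k l
  proof -
    have "l mod 2 = 0 \<or> l mod 2 = 1" "k mod 2 = 0 \<or> k mod 2 = 1" "fl = 0 \<or> fl = 1" using assms(2) by auto
    then show ?thesis using that unfolding sgn_at_def by (elim disjE) simp_all
  qed
  show "partner r (partner r k) = k"
    using cs
  proof cases
    case A
    then have "j mod 2 \<noteq> r" using jp(2) by simp
    then show ?thesis unfolding v using A by simp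
  next
    case B
    then have "Suc k mod 2 \<noteq> r" "Suc k \<noteq> j" using ms assms(3) by auto
    then show ?thesis unfolding v using B by simp
  next
    case C': C
    then show ?thesis unfolding v using C by simp
  next
    case D': D
    then have "k - 1 \<noteq> p - 1" using D assms(4) by simp
    then show ?thesis unfolding v using D[OF D'] D' by simp
  qed
  show "sgn_at fl (partner r k) = - sgn_at fl k"
  proof (rule ev)
    show "partner r k mod 2 \<noteq> k mod 2"
      using cs by cases (use jp(2) C D ms in \<open>simp_all add: v\<close>)
  qed
  show "st (partner r k) \<in> blk r x \<longleftrightarrow> st k \<in> blk r x" if x: "x < N"
    using cs
  proof cases
    case A
    then show ?thesis unfolding v using last[OF _ x] by simp
  next
    case B
    then show ?thesis unfolding v using step[OF _ _ x, of k] assms(4) by simp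
  next
    case C': C
    then show ?thesis unfolding v using last[OF _ x] C by simp
  next
    case D': D
    then show ?thesis unfolding v using step[OF _ _ x, of "k - 1"] D[OF D'] assms(4) by simp
  qed
qed

text \<open>Signed changes call for integers. The subtraction on naturals in \<open>shifted\<close>
  is exact because stacked weights are positive.\<close>

lemma shifted_int:
  assumes "x < N" "fl < 2"
  shows "int (shifted w pos j fl x) = int (w x) + (\<Sum>k\<in>{j..<p}. if st k = x then sgn_at fl k else 0)"
proof (cases "j < pos x")
  case True
  let ?k = "pos x - 1"
  have k: "?k < p" "st ?k = x" "j \<le> ?k" "pos x \<le> p" using stk True assms unfolding stacked_def by fastforce+
  have "(\<Sum>k\<in>{j..<p}. if st k = x then sgn_at fl k else 0) = (\<Sum>k\<in>{j..<p}. if k = ?k then sgn_at fl k else 0)"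
    by (rule sum.cong) (use k st_inj in auto)
  also have "\<dots> = sgn_at fl ?k" using k by simp
  finally show ?thesis using True fr[OF k(1)] k(2) by (auto simp: shifted_def sgn_at_def frac_def)
next
  case False
  have "st k \<noteq> x" if "k \<in> {j..<p}" for k using stk that False unfolding stacked_def by force
  then show ?thesis using False by (simp add: shifted_def)
qed

text \<open>The signs met in a block cancel: reindexing by \<open>partner\<close> turns the signed
  sum \<open>S\<close> into \<open>- S\<close>.\<close>

lemma balanced_shifted:
  assumes r: "r < 2" and fl: "fl < 2"
  shows "balanced N (ring_of f g r) (shifted w pos j fl)"
  unfolding balanced_def
proof (intro allI impI)
  fix x assume x: "x < N"
  let ?F = "ring_of f g r"
  let ?W = "shifted w pos j fl"
  note R = ring3D[OF ring_ring_of[of r] x]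
  define S where "S = (\<Sum>k\<in>{j..<p}. if st k \<in> blk r x then sgn_at fl k else 0)"
  have "S = (\<Sum>k\<in>{j..<p}. if st k \<in> blk r x then - sgn_at fl k else 0)"
    unfolding S_def
    by (rule sum.reindex_bij_witness[of _ "partner r" "partner r"]) (use partner[OF r fl] x in auto)
  also have "\<dots> = - S" unfolding S_def sum_negf[symmetric] by (rule sum.cong) auto
  finally have "S = 0" by simp
  have "int (?W x) + int (?W (?F x)) + int (?W (?F (?F x))) =
     int (w x) + int (w (?F x)) + int (w (?F (?F x))) +
       ((\<Sum>k\<in>{j..<p}. if st k = x then sgn_at fl k else 0) +
        (\<Sum>k\<in>{j..<p}. if st k = ?F x then sgn_at fl k else 0) +
        (\<Sum>k\<in>{j..<p}. if st k = ?F (?F x) then sgn_at fl k else 0))"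
    using shifted_int[OF _ fl] R x by simp
  also have "(\<Sum>k\<in>{j..<p}. if st k = x then sgn_at fl k else 0) +
        (\<Sum>k\<in>{j..<p}. if st k = ?F x then sgn_at fl k else 0) +
        (\<Sum>k\<in>{j..<p}. if st k = ?F (?F x) then sgn_at fl k else 0) = S"
    unfolding S_def sum.distrib[symmetric] by (rule sum.cong) (use R in \<open>auto simp: blk_def\<close>)
  finally show "?W x + ?W (?F x) + ?W (?F (?F x)) = 3"
    using \<open>S = 0\<close> bal x unfolding balanced_def ring_of_def by (auto split: if_splits)
qed

text \<open>A unit change adds \<open>2 * w + 1\<close> or \<open>- 2 * w + 1\<close> to the
  squares. The linear terms sum to twice the signed weight sum, which is nonnegative by the choice
  of \<open>fl\<close>; the ones sum to \<open>p - j\<close>.\<close>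

lemma sum_squares_shifted:
  assumes fl: "fl = (if (\<Sum>k\<in>{k\<in>{j..<p}. k mod 2 = 0}. w (st k)) < (\<Sum>k\<in>{k\<in>{j..<p}. k mod 2 = 1}. w (st k)) then 1 else 0)"
  shows "(\<Sum>x<N. (w x)\<^sup>2) + (p - j) \<le> (\<Sum>x<N. (shifted w pos j fl x)\<^sup>2)"
proof -
  let ?W = "shifted w pos j fl"
  let ?d = "\<lambda>x. (int (?W x))\<^sup>2 - (int (w x))\<^sup>2"
  have f2: "fl < 2" using fl by auto
  have jp: "j < p" using j_bounds by simp
  have S: "st ` {j..<p} \<subseteq> {..<N}" using st_less by auto
  have "(\<Sum>x<N. ?d x) = (\<Sum>x\<in>st ` {j..<p}. ?d x)"
  proof (rule sum.mono_neutral_right)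
    show "\<forall>i\<in>{..<N} - st ` {j..<p}. ?d i = 0"
    proof
      fix x assume x: "x \<in> {..<N} - st ` {j..<p}"
      then have "\<And>k. k \<in> {j..<p} \<Longrightarrow> st k \<noteq> x" by auto
      then have "int (?W x) = int (w x)" using shifted_int[OF _ f2, of x] x by simp
      then show "?d x = 0" by simp
    qed
  qed (use S in auto)
  also have "\<dots> = (\<Sum>k\<in>{j..<p}. ?d (st k))"
    by (rule sum.reindex_cong[of st]) (use st_inj in \<open>auto simp: inj_on_def\<close>)
  also have "\<dots> = (\<Sum>k\<in>{j..<p}. 2 * (sgn_at fl k * int (w (st k))) + 1)"
  proof (rule sum.cong)
    fix k assume k: "k \<in> {j..<p}"
    have "(\<Sum>l\<in>{j..<p}. if st l = st k then sgn_at fl l else 0) = (\<Sum>l\<in>{j..<p}. if l = k then sgn_at fl l else 0)"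
      by (rule sum.cong) (use k st_inj in auto)
    then have "int (?W (st k)) = int (w (st k)) + sgn_at fl k"
      using shifted_int[OF st_less f2, of k] k by simp
    then show "?d (st k) = 2 * (sgn_at fl k * int (w (st k))) + 1"
      by (simp add: power2_sum sgn_at_def)
  qed simp
  also have "\<dots> = 2 * (\<Sum>k\<in>{j..<p}. sgn_at fl k * int (w (st k))) + int (p - j)"
    by (simp add: sum.distrib sum_distrib_left)
  finally have eq: "(\<Sum>x<N. ?d x) = 2 * (\<Sum>k\<in>{j..<p}. sgn_at fl k * int (w (st k))) + int (p - j)" .
  have "(\<Sum>k\<in>{j..<p}. sgn_at fl k * int (w (st k))) \<ge> 0"
  proof -
    let ?E = "{k\<in>{j..<p}. k mod 2 = 0}" and ?O = "{k\<in>{j..<p}. k mod 2 = 1}"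
    have un: "{j..<p} = ?E \<union> ?O" by auto
    have "(\<Sum>k\<in>?E \<union> ?O. sgn_at fl k * int (w (st k))) =
        (\<Sum>k\<in>?E. sgn_at fl k * int (w (st k))) + (\<Sum>k\<in>?O. sgn_at fl k * int (w (st k)))"
      by (rule sum.union_disjoint) auto
    then have "(\<Sum>k\<in>{j..<p}. sgn_at fl k * int (w (st k))) =
        (\<Sum>k\<in>?E. sgn_at fl k * int (w (st k))) + (\<Sum>k\<in>?O. sgn_at fl k * int (w (st k)))"
      by (simp only: un[symmetric])
    also have "(\<Sum>k\<in>?E. sgn_at fl k * int (w (st k))) = sgn_at fl 0 * int (\<Sum>k\<in>?E. w (st k))"
      unfolding of_nat_sum sum_distrib_left by (rule sum.cong) (simp_all add: sgn_at_def)
    also have "(\<Sum>k\<in>?O. sgn_at fl k * int (w (st k))) = sgn_at fl 1 * int (\<Sum>k\<in>?O. w (st k))"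
      unfolding of_nat_sum sum_distrib_left by (rule sum.cong) (simp_all add: sgn_at_def)
    also have "sgn_at fl 0 * int (\<Sum>k\<in>?E. w (st k)) + sgn_at fl 1 * int (\<Sum>k\<in>?O. w (st k)) \<ge> 0"
    proof (cases "(\<Sum>k\<in>?E. w (st k)) < (\<Sum>k\<in>?O. w (st k))")
      case True
      then have "fl = 1" using fl by simp
      then show ?thesis using True by (simp add: sgn_at_def del: of_nat_sum)
    next
      case False
      then have "fl = 0" using fl by simp
      then show ?thesis using False by (simp add: sgn_at_def del: of_nat_sum)
    qed
    finally show ?thesis .
  qed
  then have "int (p - j) \<le> (\<Sum>x<N. ?d x)" unfolding eq by linarith
  then have "int ((\<Sum>x<N. (w x)\<^sup>2) + (p - j)) \<le> int (\<Sum>x<N. (?W x)\<^sup>2)"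
    by (simp add: sum_subtractf of_nat_power)
  then show ?thesis by (simp only: of_nat_le_iff)
qed

end

section \<open>The program\<close>

abbreviation sc :: "string \<Rightarrow> aexp" where "sc x \<equiv> Cell x (Const 0)"
abbreviation setv :: "string \<Rightarrow> aexp \<Rightarrow> com" where "setv x e \<equiv> Assign x (Const 0) e"
abbreviation inc_var :: "string \<Rightarrow> com" where "inc_var x \<equiv> setv x (Plus (sc x) (Const 1))"
notation Seq (infixr ";;" 60)

text \<open>Frame condition of a program phase: \<open>X\<close> lists the arrays it may
  change.\<close>

definition agree :: "string set \<Rightarrow> store \<Rightarrow> store \<Rightarrow> bool" where
  "agree X s s0 \<longleftrightarrow> (\<forall>x. x \<notin> X \<longrightarrow> s x = s0 x)"

lemma agree_refl: "agree X s s" by (simp add: agree_def)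

lemma agree_upd: "agree X s s0 \<Longrightarrow> x \<in> X \<Longrightarrow> agree X (s(x := f)) s0"
  by (auto simp: agree_def)

lemma agreeD: "agree X s s0 \<Longrightarrow> x \<notin> X \<Longrightarrow> s x = s0 x"
  by (auto simp: agree_def)

text \<open>\<open>S x\<close> is the sum of the edges at slot \<open>x\<close> that are still present, reduced modulo \<open>m\<close> to fit into a
  cell. It reveals the last edge at a leaf, and on a cycle the edge following a given one, without
  adjacency lists.\<close>

definition init_body :: com where
  "init_body =
    If (Equal (Cell ''part'' (sc ''i0'')) (Const 0)) (setv ''o'' (Const 0))
      (If (Equal (Cell ''part'' (sc ''i0'')) (Const 1)) (setv ''o'' (sc ''n'')) (setv ''o'' (Plus (sc ''n'') (sc ''n'')))) ;;
    Assign ''a'' (sc ''i0'') (Plus (Cell ''u'' (sc ''i0'')) (sc ''o'')) ;;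
    Assign ''b'' (sc ''i0'') (Plus (Cell ''v'' (sc ''i0'')) (sc ''o'')) ;;
    Assign ''out'' (sc ''i0'') (Cell ''part'' (sc ''i0'')) ;;
    (let ai = Cell ''a'' (sc ''i0''); bi = Cell ''b'' (sc ''i0'') in
    Assign ''deg'' ai (Plus (Cell ''deg'' ai) (Const 1)) ;;
    Assign ''deg'' bi (Plus (Cell ''deg'' bi) (Const 1)) ;;
    If (Less (Plus (Cell ''S'' ai) (sc ''i0'')) (sc ''m''))
      (Assign ''S'' ai (Plus (Cell ''S'' ai) (sc ''i0'')))
      (Assign ''S'' ai (Minus (Plus (Cell ''S'' ai) (sc ''i0'')) (sc ''m''))) ;;
    If (Less (Plus (Cell ''S'' bi) (sc ''i0'')) (sc ''m''))
      (Assign ''S'' bi (Plus (Cell ''S'' bi) (sc ''i0'')))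
      (Assign ''S'' bi (Minus (Plus (Cell ''S'' bi) (sc ''i0'')) (sc ''m'')))) ;;
    inc_var ''i0''"

text \<open>After an edge is stripped, \<open>y1\<close> follows it to its other end, the only slot
  that can have become a leaf. Since \<open>a + b\<close> is the sum of both ends, the other end is
  found by subtraction.\<close>

definition peel_body :: com where
  "peel_body =
    If (Equal (Cell ''deg'' (sc ''y1'')) (Const 1))
      (setv ''e1'' (Cell ''S'' (sc ''y1'')) ;;
       setv ''z1'' (Minus (Plus (Cell ''a'' (sc ''e1'')) (Cell ''b'' (sc ''e1''))) (sc ''y1'')) ;;
       Assign ''deg'' (sc ''y1'') (Const 0) ;;
       Assign ''S'' (sc ''y1'') (Const 0) ;;
       Assign ''deg'' (sc ''z1'') (Minus (Cell ''deg'' (sc ''z1'')) (Const 1)) ;;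
       If (Less (Cell ''S'' (sc ''z1'')) (sc ''e1''))
         (Assign ''S'' (sc ''z1'') (Minus (Plus (Cell ''S'' (sc ''z1'')) (sc ''m'')) (sc ''e1'')))
         (Assign ''S'' (sc ''z1'') (Minus (Cell ''S'' (sc ''z1'')) (sc ''e1''))) ;;
       Assign ''rem'' (sc ''e1'') (Const 1) ;;
       setv ''y1'' (sc ''z1''))
      (inc_var ''x1'' ;; setv ''y1'' (sc ''x1''))"

definition walk_edge :: com where
  "walk_edge =
    setv ''z2'' (Minus (Plus (Cell ''a'' (sc ''e2'')) (Cell ''b'' (sc ''e2''))) (sc ''cur'')) ;;
    Assign ''su'' (sc ''cur'') (sc ''z2'') ;;
    Assign ''pr'' (sc ''z2'') (sc ''cur'') ;;
    Assign ''ei'' (sc ''cur'') (sc ''e2'') ;;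
    Assign ''rem'' (sc ''e2'') (Const 1)"

text \<open>Every cycle has at least three slots, so the third visit always comes and the triple can
  be completed during the walk.\<close>

definition record_head :: com where
  "record_head =
    If (Equal (sc ''k'') (Const 0)) (setv ''f1'' (sc ''cur''))
      (If (Equal (sc ''k'') (Const 1)) (setv ''f2'' (sc ''cur''))
        (If (Equal (sc ''k'') (Const 2))
          (Assign ''rot'' (sc ''f1'') (sc ''f2'') ;; Assign ''rot'' (sc ''f2'') (sc ''cur'') ;;
           Assign ''rot'' (sc ''cur'') (sc ''f1'') ;;
           Assign ''real'' (sc ''f1'') (Const 1) ;; Assign ''real'' (sc ''f2'') (Const 1) ;;
           Assign ''real'' (sc ''cur'') (Const 1))
          Skip))"

definition next_edge_com :: com where
  "next_edge_com =
    If (Less (Cell ''S'' (sc ''z2'')) (sc ''e2''))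
      (setv ''e2'' (Minus (Plus (Cell ''S'' (sc ''z2'')) (sc ''m'')) (sc ''e2'')))
      (setv ''e2'' (Minus (Cell ''S'' (sc ''z2'')) (sc ''e2'')))"

definition walk_advance :: com where
  "walk_advance =
    inc_var ''k'' ;;
    setv ''cur'' (sc ''z2'') ;;
    If (Equal (Cell ''rem'' (sc ''e2'')) (Const 1)) (setv ''md2'' (Const 0)) Skip"

text \<open>Mode 0 searches for an edge not yet traversed; mode 1 follows its cycle until the next
  edge is already marked.\<close>

definition walk_body :: com where
  "walk_body =
    If (Equal (sc ''md2'') (Const 0))
      (If (Equal (Cell ''rem'' (sc ''i2'')) (Const 1)) (inc_var ''i2'')
        (setv ''md2'' (Const 1) ;; setv ''cur'' (Cell ''a'' (sc ''i2'')) ;; setv ''e2'' (sc ''i2'') ;; setv ''k'' (Const 0)))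
      (walk_edge ;; record_head ;; next_edge_com ;; walk_advance)"

text \<open>\<open>vr\<close> cycles through the three slots of a vertex and \<open>rot\<close> through the three slots of a triple; these
  are the blocks of the two sides of the cubic bipartite graph.\<close>

definition group_body :: com where
  "group_body =
    If (Equal (Cell ''real'' (sc ''x3'')) (Const 0))
      (If (Equal (sc ''g'') (Const 0)) (setv ''d1'' (sc ''x3'') ;; setv ''g'' (Const 1))
        (If (Equal (sc ''g'') (Const 1)) (setv ''d2'' (sc ''x3'') ;; setv ''g'' (Const 2))
          (Assign ''rot'' (sc ''d1'') (sc ''d2'') ;; Assign ''rot'' (sc ''d2'') (sc ''x3'') ;;
           Assign ''rot'' (sc ''x3'') (sc ''d1'') ;; setv ''g'' (Const 0))))
      Skip ;;
    Assign ''w'' (sc ''x3'') (Const 1) ;;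
    If (Less (Plus (sc ''x3'') (sc ''n'')) (sc ''N''))
      (Assign ''vr'' (sc ''x3'') (Plus (sc ''x3'') (sc ''n'')))
      (Assign ''vr'' (sc ''x3'') (Minus (Plus (sc ''x3'') (sc ''n'')) (sc ''N''))) ;;
    Assign ''par'' (Plus (sc ''x3'') (Const 1)) (Minus (Const 1) (Cell ''par'' (sc ''x3''))) ;;
    inc_var ''x3''"

definition is_frac :: "aexp \<Rightarrow> bexp" where
  "is_frac x = And (Less (Const 0) (Cell ''w'' x)) (Less (Cell ''w'' x) (Const 3))"

definition push_z :: com where
  "push_z =
    Assign ''st'' (sc ''p'') (sc ''z5'') ;;
    Assign ''pos'' (sc ''z5'') (Plus (sc ''p'') (Const 1)) ;;
    If (Equal (Cell ''par'' (sc ''p'')) (Const 0))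
      (Assign ''pe'' (Plus (sc ''p'') (Const 1)) (Plus (Cell ''pe'' (sc ''p'')) (Cell ''w'' (sc ''z5''))) ;;
       Assign ''po'' (Plus (sc ''p'') (Const 1)) (Cell ''po'' (sc ''p'')))
      (Assign ''po'' (Plus (sc ''p'') (Const 1)) (Plus (Cell ''po'' (sc ''p'')) (Cell ''w'' (sc ''z5''))) ;;
       Assign ''pe'' (Plus (sc ''p'') (Const 1)) (Cell ''pe'' (sc ''p''))) ;;
    inc_var ''p''"

definition candidate :: com where
  "candidate =
    setv ''y5'' (Cell ''st'' (Minus (sc ''p'') (Const 1))) ;;
    If (Equal (Cell ''par'' (Minus (sc ''p'') (Const 1))) (Const 0))
      (setv ''z5'' (Cell ''vr'' (sc ''y5'')) ;;
       If (is_frac (sc ''z5'')) Skip (setv ''z5'' (Cell ''vr'' (sc ''z5''))))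
      (setv ''z5'' (Cell ''rot'' (sc ''y5'')) ;;
       If (is_frac (sc ''z5'')) Skip (setv ''z5'' (Cell ''rot'' (sc ''z5''))))"

definition close_cycle :: com where
  "close_cycle =
    setv ''jj'' (Minus (Cell ''pos'' (sc ''z5'')) (Const 1)) ;;
    If (Equal (Cell ''par'' (sc ''jj'')) (Cell ''par'' (Minus (sc ''p'') (Const 1)))) (inc_var ''jj'') Skip ;;
    If (Less (Minus (Cell ''pe'' (sc ''p'')) (Cell ''pe'' (sc ''jj''))) (Minus (Cell ''po'' (sc ''p'')) (Cell ''po'' (sc ''jj''))))
      (setv ''fl'' (Const 1)) (setv ''fl'' (Const 0)) ;;
    setv ''md5'' (Const 1)"

definition pop_step :: com where
  "pop_step =
    setv ''p'' (Minus (sc ''p'') (Const 1)) ;;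
    setv ''y5'' (Cell ''st'' (sc ''p'')) ;;
    Assign ''pos'' (sc ''y5'') (Const 0) ;;
    If (Equal (Cell ''par'' (sc ''p'')) (sc ''fl''))
      (Assign ''w'' (sc ''y5'') (Plus (Cell ''w'' (sc ''y5'')) (Const 1)))
      (Assign ''w'' (sc ''y5'') (Minus (Cell ''w'' (sc ''y5'')) (Const 1)))"

text \<open>Mode 0 extends an alternating walk of slots of weight 1 or 2; when it closes, mode 1 pops the closed
  part and shifts its weights. The arrays \<open>pe\<close> and \<open>po\<close> hold the sums of the weights at even and odd
  positions below, which decide the direction of the shift that does not decrease the sum of squares.\<close>

definition match_body :: com where
  "match_body =
    If (Equal (sc ''md5'') (Const 0))
      (If (Equal (sc ''p'') (Const 0))
        (If (is_frac (sc ''i5'')) (setv ''z5'' (sc ''i5'') ;; push_z) (inc_var ''i5''))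
        (candidate ;; If (Equal (Cell ''pos'' (sc ''z5'')) (Const 0)) push_z close_cycle))
      (If (Less (sc ''jj'') (sc ''p'')) pop_step (setv ''md5'' (Const 0)))"

text \<open>All three slots of a vertex enter the queue, so that its cycles in all parts get
  inspected.\<close>

definition add_z :: com where
  "add_z =
    Assign ''T'' (sc ''z6'') (Const 1) ;;
    Assign ''T'' (Cell ''vr'' (sc ''z6'')) (Const 1) ;;
    Assign ''T'' (Cell ''vr'' (Cell ''vr'' (sc ''z6''))) (Const 1) ;;
    Assign ''q'' (sc ''qt'') (sc ''z6'') ;;
    Assign ''q'' (Plus (sc ''qt'') (Const 1)) (Cell ''vr'' (sc ''z6'')) ;;
    Assign ''q'' (Plus (sc ''qt'') (Const 2)) (Cell ''vr'' (Cell ''vr'' (sc ''z6''))) ;;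
    setv ''qt'' (Plus (sc ''qt'') (Const 3))"

definition check_z :: com where
  "check_z =
    If (And (Equal (Cell ''real'' (sc ''z6'')) (Const 1))
        (And (Equal (Cell ''w'' (sc ''z6'')) (Const 3)) (Equal (Cell ''T'' (sc ''z6'')) (Const 0))))
      (Assign ''out'' (sc ''e6'') (Const 3) ;; add_z) Skip"

text \<open>Phase 0 starts the growth at vertices representing no cycle, phase 1 at representatives of cycles
  with at least four vertices, phase 2 at representatives of triangles.\<close>

definition scan_step :: com where
  "scan_step =
    If (And (Equal (Cell ''w'' (sc ''x6'')) (Const 3)) (Equal (Cell ''T'' (sc ''x6'')) (Const 0)))
      (setv ''z6'' (sc ''x6'') ;;
       If (Equal (Cell ''real'' (sc ''z6'')) (Const 0)) add_z
        (If (Equal (sc ''ph'') (Const 0)) Skip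
          (If (Equal (sc ''ph'') (Const 1))
            (If (Equal (Cell ''su'' (Cell ''su'' (Cell ''su'' (sc ''z6'')))) (sc ''z6'')) Skip
              (Assign ''out'' (Cell ''ei'' (Cell ''su'' (sc ''z6''))) (Const 3) ;; add_z))
            (If (Less (Cell ''part'' (Cell ''ei'' (sc ''z6''))) (Const 2))
               (Assign ''out'' (Cell ''ei'' (sc ''z6'')) (Plus (Cell ''part'' (Cell ''ei'' (sc ''z6''))) (Const 1)))
               (Assign ''out'' (Cell ''ei'' (sc ''z6'')) (Const 0)) ;;
             add_z))))
      Skip ;;
    inc_var ''x6''"

text \<open>The scan advances only when the queue is empty, so restarts take place in a
  \<open>closed\<close> state.\<close>

definition grow_body :: com where
  "grow_body =
    If (Less (sc ''qh'') (sc ''qt''))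
      (setv ''t6'' (Cell ''q'' (sc ''qh'')) ;; inc_var ''qh'' ;;
       If (Equal (Cell ''deg'' (sc ''t6'')) (Const 2))
         (setv ''z6'' (Cell ''su'' (sc ''t6'')) ;; setv ''e6'' (Cell ''ei'' (sc ''t6'')) ;; check_z ;;
          setv ''z6'' (Cell ''pr'' (sc ''t6'')) ;; setv ''e6'' (Cell ''ei'' (sc ''z6'')) ;; check_z)
         Skip)
      (If (Less (sc ''x6'') (sc ''N'')) scan_step (setv ''x6'' (Const 0) ;; inc_var ''ph''))"

text \<open>The machine has no remainder operation; conditionals of this kind are its modular
  addition and, in \<open>mod_sum_diff\<close>, subtraction.\<close>

lemma mod_sum_add:
  assumes "i < (m::nat)"
  shows "(if x mod m + i < m then x mod m + i else x mod m + i - m) = (x + i) mod m"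
proof -
  have x: "x mod m < m" using assms by simp
  have "(x + i) mod m = (x mod m + i) mod m" by (simp add: mod_add_left_eq)
  moreover have "(x mod m + i) mod m = (x mod m + i - m) mod m" if "\<not> x mod m + i < m"
    using that by (intro le_mod_geq) simp
  moreover have "x mod m + i - m < m" using x assms by linarith
  ultimately show ?thesis by simp
qed

lemma mod_sum_diff:
  assumes "i < (m::nat)" "i \<le> x"
  shows "(if x mod m < i then x mod m + m - i else x mod m - i) = (x - i) mod m"
proof -
  have x: "x mod m < m" "(x - i) mod m < m" using assms by simp_all
  have "x mod m = (if (x - i) mod m + i < m then (x - i) mod m + i else (x - i) mod m + i - m)"
    using mod_sum_add[OF assms(1), of "x - i"] assms(2) by simp
  then show ?thesis using x assms(1) by (simp split: if_splits; linarith)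
qed

section \<open>Degrees and edge sums of the slots\<close>

context colored_graph
begin

definition incident :: "nat set \<Rightarrow> nat \<Rightarrow> nat set" where
  "incident al x = {i \<in> al. x \<in> sedge i}"

definition counts :: "nat set \<Rightarrow> (nat \<Rightarrow> nat) \<Rightarrow> (nat \<Rightarrow> nat) \<Rightarrow> bool" where
  "counts al deg S \<longleftrightarrow> (\<forall>x. deg x = card (incident al x) \<and> S x = (\<Sum>i\<in>incident al x. i) mod m)"

definition basic :: "store \<Rightarrow> bool" where
  "basic s \<longleftrightarrow> s ''n'' 0 = n \<and> s ''m'' 0 = m \<and> s ''N'' 0 = 3 * n \<and>
    (\<forall>i<m. s ''u'' i = u i \<and> s ''v'' i = v i \<and> s ''part'' i = c i)"

definition basic_ab :: "store \<Rightarrow> bool" where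
  "basic_ab s \<longleftrightarrow> basic s \<and> (\<forall>i<m. s ''a'' i = a i \<and> s ''b'' i = b i)"

lemma counts_add:
  assumes "counts {..<i} deg S" "i < m"
  shows "counts {..<Suc i} (deg(a i := deg (a i) + 1, b i := deg (b i) + 1))
    (S(a i := (S (a i) + i) mod m, b i := (S (b i) + i) mod m))"
proof -
  have I: "incident {..<Suc i} x = (if x \<in> sedge i then insert i (incident {..<i} x) else incident {..<i} x)" for x
    by (auto simp: incident_def less_Suc_eq)
  have F: "finite (incident {..<i} x)" "i \<notin> incident {..<i} x" for x by (auto simp: incident_def)
  show ?thesis using assms(1) a_neq_b[OF assms(2)] F
    unfolding counts_def I by (auto simp: sedge_def mod_add_left_eq mod_add_right_eq add.commute)
qed

lemma counts_remove:
  assumes "counts al deg S" "i \<in> al" "finite al" "al \<subseteq> {..<m}" "sedge i = {y, z}" "deg y = 1"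
  shows "counts (al - {i}) (deg(y := 0, z := deg z - 1))
    (S(y := 0, z := (if S z < i then S z + m - i else S z - i)))"
proof -
  have im: "i < m" using assms by auto
  have yz: "y \<noteq> z" using a_neq_b[OF im] assms(5) unfolding sedge_def by (metis doubleton_eq_iff)
  have I: "incident (al - {i}) x = incident al x - {i}" for x by (auto simp: incident_def)
  have F: "finite (incident al x)" for x using assms(3) by (auto simp: incident_def)
  have iy: "i \<in> incident al y" "i \<in> incident al z" using assms by (auto simp: incident_def)
  have "card (incident al y) = 1" using assms by (auto simp: counts_def)
  then have y: "incident al y = {i}" using iy by (metis card_1_singletonE singletonD)
  have "x = y \<or> x = z" if "i \<in> incident al x" for x using that assms(5) by (auto simp: incident_def)
  then have other: "incident al x - {i} = incident al x" if "x \<noteq> y" "x \<noteq> z" for x using that by blast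
  \<comment> \<open>The removed edge is a summand, so the subtraction on naturals is exact.\<close>
  have le: "i \<le> (\<Sum>j\<in>incident al z. j)"
    using sum_nonneg_leq_bound[of "incident al z" "\<lambda>j. j" _ i] F iy by simp
  have "(\<Sum>j\<in>incident al z - {i}. j) = (\<Sum>j\<in>incident al z. j) - i"
    using F iy by (simp add: sum_diff1_nat)
  then have Sz: "(if S z < i then S z + m - i else S z - i) = (\<Sum>j\<in>incident al z - {i}. j) mod m"
  proof -
    have "S z = (\<Sum>j\<in>incident al z. j) mod m" using assms(1) by (simp add: counts_def)
    then show ?thesis by (simp only: mod_sum_diff[OF im le] \<open>(\<Sum>j\<in>incident al z - {i}. j) = _\<close>)
  qed
  show ?thesis unfolding counts_def I
  proof (intro allI conjI)
    fix x
    show "(deg(y := 0, z := deg z - 1)) x = card (incident al x - {i})"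
      using assms(1) iy F yz y other[of x] by (auto simp: counts_def card_Diff_singleton)
    show "(S(y := 0, z := (if S z < i then S z + m - i else S z - i))) x = (\<Sum>j\<in>incident al x - {i}. j) mod m"
      unfolding Sz using assms(1) yz y other[of x] by (auto simp: counts_def)
  qed
qed

lemma init_correct:
  assumes s0: "basic s0" "\<And>i. s0 ''i0'' i = 0" "\<And>i. s0 ''deg'' i = 0" "\<And>i. s0 ''S'' i = 0"
    and W: "10 * n + 10 * m + 10 \<le> W" and bd: "bounded W s0"
  shows "runs W (While (Less (sc ''i0'') (sc ''m'')) init_body) s0 (1 + m * (1 + cost init_body))
    (\<lambda>s. agree {''i0'', ''o'', ''a'', ''b'', ''out'', ''deg'', ''S''} s s0 \<and> basic_ab s \<and>
      counts {..<m} (s ''deg'') (s ''S'') \<and> (\<forall>i<m. s ''out'' i = c i))"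
proof -
  define I where "I s \<longleftrightarrow> agree {''i0'', ''o'', ''a'', ''b'', ''out'', ''deg'', ''S''} s s0 \<and> s ''i0'' 0 \<le> m \<and>
    (\<forall>i<s ''i0'' 0. s ''a'' i = a i \<and> s ''b'' i = b i \<and> s ''out'' i = c i) \<and>
    counts {..<s ''i0'' 0} (s ''deg'') (s ''S'')" for s
  let ?\<phi> = "\<lambda>s::store. m - s ''i0'' 0"
  have "runs W (While (Less (sc ''i0'') (sc ''m'')) init_body) s0 (1 + ?\<phi> s0 * (1 + cost init_body))
     (\<lambda>s. I s \<and> \<not> bval (Less (sc ''i0'') (sc ''m'')) s)"
  proof (rule runs_While[OF _ bd])
    show "I s0" using s0 by (simp add: I_def agree_refl counts_def incident_def)
    fix s assume s: "I s" "bval (Less (sc ''i0'') (sc ''m'')) s" "bounded W s"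
    let ?i = "s ''i0'' 0"
    have ag: "agree {''i0'', ''o'', ''a'', ''b'', ''out'', ''deg'', ''S''} s s0" using s(1) by (simp add: I_def)
    have B: "basic s" using s0(1) unfolding basic_def by (simp add: agreeD[OF ag])
    have i: "?i < m" using s(2) B by (simp add: basic_def)
    have cn: "counts {..<?i} (s ''deg'') (s ''S'')" using s(1) by (simp add: I_def)
    have Wn: "n + n \<le> W" "u ?i + (n + n) \<le> W" "v ?i + (n + n) \<le> W" "u ?i + n \<le> W" "v ?i + n \<le> W" "Suc ?i \<le> W" "n \<le> W" "u ?i \<le> W" "v ?i \<le> W" "c ?i \<le> W"
    proof -
      have "u ?i < n" "v ?i < n" "c ?i < 3" using u_less v_less c_less i by simp_all
      then show "n + n \<le> W" "u ?i + (n + n) \<le> W" "v ?i + (n + n) \<le> W" "u ?i + n \<le> W" "v ?i + n \<le> W" "Suc ?i \<le> W" "n \<le> W" "u ?i \<le> W" "v ?i \<le> W" "c ?i \<le> W"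
        using W i by simp_all
    qed
    have dle: "s ''deg'' x \<le> m" for x
    proof -
      have "card (incident {..<?i} x) \<le> card {..<?i}" by (rule card_mono) (auto simp: incident_def)
      then show ?thesis using cn i by (simp add: counts_def)
    qed
    have Sle: "s ''S'' x < m" for x using cn i by (simp add: counts_def)
    have dW: "Suc (s ''deg'' x) \<le> W" for x using dle[of x] W by linarith
    have SW: "s ''S'' x + ?i \<le> W" "s ''S'' x + ?i - m \<le> W" for x using Sle[of x] W i by linarith+
    have md: "m \<le> s ''S'' x + ?i \<Longrightarrow> (s ''S'' x + ?i) mod m = s ''S'' x + ?i - m" for x
      using mod_sum_add[OF i, of "s ''S'' x"] Sle[of x] by auto
    have abW: "a ?i \<le> W" "b ?i \<le> W" using a_less[OF i] b_less[OF i] W by linarith+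
    have ab: "u ?i + n * c ?i = a ?i" "v ?i + n * c ?i = b ?i" by (simp_all add: a_def b_def)
    have ne: "a ?i \<noteq> b ?i" using a_neq_b[OF i] .
    \<comment> \<open>The offset \<open>n * c i\<close> arises from a case distinction, as the
      machine does not multiply.\<close>
    have off: "c ?i = 0 \<Longrightarrow> u ?i = a ?i \<and> v ?i = b ?i" "c ?i = 1 \<Longrightarrow> u ?i + n = a ?i \<and> v ?i + n = b ?i"
      "c ?i \<noteq> 0 \<Longrightarrow> c ?i \<noteq> 1 \<Longrightarrow> u ?i + (n + n) = a ?i \<and> v ?i + (n + n) = b ?i"
      using ab c_less[OF i] by (auto simp: numeral_3_eq_3 less_Suc_eq)
    have V: "s ''m'' 0 = m" "s ''n'' 0 = n" "s ''u'' ?i = u ?i" "s ''v'' ?i = v ?i" "s ''part'' ?i = c ?i"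
      using B i by (auto simp: basic_def)
    define I' where "I' s' \<longleftrightarrow> I s' \<and> ?\<phi> s' < ?\<phi> s" for s'
    \<comment> \<open>\<open>fin\<close> states the round purely by the new contents of the changed
      arrays, so symbolic execution only has to match these equations. The later loops use the same
      device.\<close>
    have fin: "I' s'" if "agree {''i0'', ''o'', ''a'', ''b'', ''out'', ''deg'', ''S''} s' s"
      "s' ''i0'' = (s ''i0'')(0 := Suc ?i)" "s' ''a'' = (s ''a'')(?i := a ?i)"
      "s' ''b'' = (s ''b'')(?i := b ?i)" "s' ''out'' = (s ''out'')(?i := c ?i)"
      "s' ''deg'' = (s ''deg'')(a ?i := s ''deg'' (a ?i) + 1, b ?i := s ''deg'' (b ?i) + 1)"
      "s' ''S'' = (s ''S'')(a ?i := (s ''S'' (a ?i) + ?i) mod m, b ?i := (s ''S'' (b ?i) + ?i) mod m)" for s'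
    proof -
      have "agree {''i0'', ''o'', ''a'', ''b'', ''out'', ''deg'', ''S''} s' s0"
        using that(1) ag by (simp add: agree_def)
      then show ?thesis using s(1) i counts_add[OF cn i] unfolding I'_def I_def that(2-)
        by (simp add: less_Suc_eq)
    qed
    show "wp W init_body (\<lambda>s'. I s' \<and> ?\<phi> s' < ?\<phi> s) s"
      unfolding I'_def[symmetric] init_body_def Let_def
      using ne i Wn dW SW abW
      by (simp add: V off) (auto intro!: fin agree_upd agree_refl simp: md V off not_less)
  qed
  then show ?thesis
  proof (rule runs_mono)
    fix s assume s: "I s \<and> \<not> bval (Less (sc ''i0'') (sc ''m'')) s"
    then have ag: "agree {''i0'', ''o'', ''a'', ''b'', ''out'', ''deg'', ''S''} s s0" by (simp add: I_def)
    have B: "basic s" using s0(1) unfolding basic_def by (simp add: agreeD[OF ag])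
    then have "s ''i0'' 0 = m" using s by (simp add: I_def basic_def)
    then show "agree {''i0'', ''o'', ''a'', ''b'', ''out'', ''deg'', ''S''} s s0 \<and> basic_ab s \<and>
      counts {..<m} (s ''deg'') (s ''S'') \<and> (\<forall>i<m. s ''out'' i = c i)"
      using s B by (simp add: I_def basic_ab_def)
  qed (use s0 in simp)
qed

end

section \<open>Removing leaves\<close>

context colored_graph
begin

lemma incident_less: "x \<in> sedge i \<Longrightarrow> i < m \<Longrightarrow> x < 3 * n"
  using a_less b_less by (auto simp: sedge_def)

text \<open>With a single edge left, the sum is that edge, and being below \<open>m\<close> it is
  not altered by the reduction.\<close>

lemma leaf_edge:
  assumes cn: "counts al deg S" and al: "al \<subseteq> {..<m}" and y: "deg y = 1"
  shows "S y \<in> al" "incident al y = {S y}" "sedge (S y) = {y, a (S y) + b (S y) - y}"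
    "a (S y) + b (S y) - y < 3 * n" "a (S y) + b (S y) - y \<noteq> y"
proof -
  obtain i where i: "incident al y = {i}" using cn y by (metis counts_def card_1_singletonE)
  then have im: "i \<in> al" "i < m" "y \<in> sedge i" using al by (auto simp: incident_def)
  have S: "S y = i" using cn i im(2) by (simp add: counts_def)
  show "S y \<in> al" "incident al y = {S y}" using i im S by auto
  have "y = a i \<or> y = b i" using im(3) by (auto simp: sedge_def)
  then have z: "a i + b i - y = (if y = a i then b i else a i)" by auto
  show "sedge (S y) = {y, a (S y) + b (S y) - y}" using S z im(3) by (auto simp: sedge_def)
  show "a (S y) + b (S y) - y < 3 * n" using S z a_less[OF im(2)] b_less[OF im(2)] by simp
  show "a (S y) + b (S y) - y \<noteq> y" using S z a_neq_b[OF im(2)] \<open>y = a i \<or> y = b i\<close> by auto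
qed

text \<open>A cycle has two edges at each of its vertices.\<close>

lemma cycle_avoids_leaf:
  assumes "is_cycle sgraph C" "C \<subseteq> sedge ` al" "al \<subseteq> {..<m}" "incident al y = {e}"
  shows "C \<subseteq> sedge ` (al - {e})"
proof
  fix f assume f: "f \<in> C"
  then obtain i where i: "i \<in> al" "f = sedge i" using assms(2) by auto
  have "i \<noteq> e"
  proof
    assume "i = e"
    have "y \<in> sedge e" using assms(4) by (auto simp: incident_def)
    then have "y \<in> \<Union>C" using f i \<open>i = e\<close> by auto
    then obtain p q where pq: "{y, p} \<in> C" "{y, q} \<in> C" "p \<noteq> q" "y \<noteq> p" "y \<noteq> q"
      using cycle_two_edges[OF assms(1)] by metis
    have "g = sedge e" if "g \<in> C" "y \<in> g" for g
    proof -
      obtain j where "j \<in> al" "g = sedge j" using assms(2) \<open>g \<in> C\<close> by auto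
      then show ?thesis using assms(4) that by (auto simp: incident_def)
    qed
    then have "{y, p} = {y, q}" using pq by (metis insertI1)
    then show False using pq by (auto simp: doubleton_eq_iff)
  qed
  then show "f \<in> sedge ` (al - {e})" using i by auto
qed

text \<open>Among the slots up to \<open>x1\<close>, only \<open>y1\<close> may be a leaf. Each
  round strips an edge or advances \<open>x1\<close>, which gives \<open>3 * n + m\<close> rounds,
  and stripping never touches a cycle.\<close>

lemma peel_correct:
  assumes s0: "basic_ab s0" "\<And>i. s0 ''x1'' i = 0" "\<And>i. s0 ''y1'' i = 0" "\<And>i. s0 ''rem'' i = 0"
    "counts {..<m} (s0 ''deg'') (s0 ''S'')"
    and W: "10 * n + 10 * m + 10 \<le> W" and bd: "bounded W s0"
  shows "runs W (While (Less (sc ''x1'') (sc ''N'')) peel_body) s0 (1 + (3 * n + m) * (1 + cost peel_body))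
    (\<lambda>s. agree {''x1'', ''y1'', ''e1'', ''z1'', ''deg'', ''S'', ''rem''} s s0 \<and>
      (\<exists>al \<subseteq> {..<m}. counts al (s ''deg'') (s ''S'') \<and>
        (\<forall>i. s ''rem'' i = (if i < m \<and> i \<notin> al then 1 else 0)) \<and>
        (\<forall>C. is_cycle sgraph C \<longrightarrow> C \<subseteq> sedge ` al) \<and> (\<forall>x < 3 * n. s ''deg'' x \<noteq> 1)))"
proof -
  let ?X = "{''x1'', ''y1'', ''e1'', ''z1'', ''deg'', ''S'', ''rem''}"
  define J where "J al s \<longleftrightarrow> al \<subseteq> {..<m} \<and> counts al (s ''deg'') (s ''S'') \<and>
        (\<forall>i. s ''rem'' i = (if i < m \<and> i \<notin> al then 1 else 0)) \<and>
        (\<forall>C. is_cycle sgraph C \<longrightarrow> C \<subseteq> sedge ` al) \<and> s ''x1'' 0 \<le> 3 * n \<and>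
        (if s ''x1'' 0 < 3 * n then s ''y1'' 0 < 3 * n else s ''y1'' 0 = s ''x1'' 0) \<and>
        (\<forall>x\<le>s ''x1'' 0. x \<noteq> s ''y1'' 0 \<longrightarrow> s ''deg'' x \<noteq> 1)" for al and s :: store
  define I where "I s \<longleftrightarrow> agree ?X s s0 \<and> (\<exists>al. J al s)" for s
  define \<phi> where "\<phi> s = (3 * n - s ''x1'' 0) + card {i. i < m \<and> s ''rem'' i = 0}" for s :: store
  have \<phi>J: "\<phi> s = (3 * n - s ''x1'' 0) + card al" if "J al s" for al s
  proof -
    have "{i. i < m \<and> s ''rem'' i = 0} = al" using that by (auto simp: J_def)
    then show ?thesis by (simp add: \<phi>_def)
  qed
  have J0: "J {..<m} s0"
    using s0 by (auto simp: J_def sgraph_def is_cycle_def)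
  have "runs W (While (Less (sc ''x1'') (sc ''N'')) peel_body) s0 (1 + \<phi> s0 * (1 + cost peel_body))
     (\<lambda>s. I s \<and> \<not> bval (Less (sc ''x1'') (sc ''N'')) s)"
  proof (rule runs_While[OF _ bd])
    show "I s0" using J0 by (auto simp: I_def agree_refl)
    fix s assume s: "I s" "bval (Less (sc ''x1'') (sc ''N'')) s" "bounded W s"
    then have ag: "agree ?X s s0" by (simp add: I_def)
    obtain al where J: "J al s" using s by (auto simp: I_def)
    have V: "s ''N'' 0 = 3 * n" "s ''m'' 0 = m" "\<And>i. i < m \<Longrightarrow> s ''a'' i = a i" "\<And>i. i < m \<Longrightarrow> s ''b'' i = b i"
      using s0(1) by (auto simp: basic_ab_def basic_def agreeD[OF ag])
    have x1: "s ''x1'' 0 < 3 * n" using s(2) V by simp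
    have al: "al \<subseteq> {..<m}" "finite al" and cn: "counts al (s ''deg'') (s ''S'')" using J finite_subset by (auto simp: J_def)
    have bW: "s x i \<le> W" for x i using s(3) by (simp add: bounded_def)
    define I' where "I' s' \<longleftrightarrow> I s' \<and> \<phi> s' < \<phi> s" for s'
    let ?y = "s ''y1'' 0"
    let ?e = "s ''S'' ?y"
    let ?z = "a ?e + b ?e - ?y"
    show "wp W peel_body (\<lambda>s'. I s' \<and> \<phi> s' < \<phi> s) s"
    proof (cases "s ''deg'' ?y = 1")
      case True
      note L = leaf_edge[OF cn al(1) True]
      have em: "?e < m" using L(1) al by auto
      have Sm: "s ''S'' ?z < m" using cn em by (simp add: counts_def)
      have Wz: "?z \<le> W" "s ''S'' ?z + m - ?e \<le> W" "1 \<le> W" using L(4) W Sm by linarith+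
      have fin: "I' s'" if t: "agree ?X s' s"
        "s' ''x1'' = s ''x1''" "s' ''y1'' = (s ''y1'')(0 := ?z)"
        "s' ''deg'' = (s ''deg'')(?y := 0, ?z := s ''deg'' ?z - 1)"
        "s' ''S'' = (s ''S'')(?y := 0, ?z := (if s ''S'' ?z < ?e then s ''S'' ?z + m - ?e else s ''S'' ?z - ?e))"
        "s' ''rem'' = (s ''rem'')(?e := 1)" for s'
      proof -
        have "J (al - {?e}) s'"
          unfolding J_def t(2-)
        proof (intro conjI)
          show "counts (al - {?e}) ((s ''deg'')(?y := 0, ?z := s ''deg'' ?z - 1))
            ((s ''S'')(?y := 0, ?z := (if s ''S'' ?z < ?e then s ''S'' ?z + m - ?e else s ''S'' ?z - ?e)))"
            by (rule counts_remove[OF cn L(1) al(2,1) L(3) True])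
          show "\<forall>C. is_cycle sgraph C \<longrightarrow> C \<subseteq> sedge ` (al - {?e})"
          proof (intro allI impI)
            fix C assume C: "is_cycle sgraph C"
            then have "C \<subseteq> sedge ` al" using J by (simp add: J_def)
            from cycle_avoids_leaf[OF C this al(1) L(2)] show "C \<subseteq> sedge ` (al - {?e})" .
          qed
          show "\<forall>x\<le>s ''x1'' 0. x \<noteq> ((s ''y1'')(0 := ?z)) 0 \<longrightarrow>
             ((s ''deg'')(?y := 0, ?z := s ''deg'' ?z - 1)) x \<noteq> 1"
            using J unfolding J_def by simp
        qed (use J al em x1 L(4) in \<open>auto simp: J_def\<close>)
        moreover have "card (al - {?e}) < card al" using L(1) al(2) by (meson card_Diff1_less)
        ultimately have "\<phi> s' < \<phi> s" using \<phi>J J t(2) by simp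
        moreover have "agree ?X s' s0" using t(1) ag by (simp add: agree_def)
        ultimately show ?thesis using \<open>J (al - {?e}) s'\<close> unfolding I'_def I_def by blast
      qed
      show ?thesis
        unfolding I'_def[symmetric] peel_body_def
        using True em Wz L(5) bW Sm by (simp add: V) (auto intro!: fin agree_upd agree_refl le_trans[OF diff_le_self])
    next
      case False
      have fin: "I' s'" if t: "agree ?X s' s"
        "s' ''x1'' = (s ''x1'')(0 := Suc (s ''x1'' 0))" "s' ''y1'' = (s ''y1'')(0 := Suc (s ''x1'' 0))"
        "s' ''deg'' = s ''deg''" "s' ''S'' = s ''S''" "s' ''rem'' = s ''rem''" for s'
      proof -
        have "J al s'"
          using J x1 False unfolding J_def t(2-) by (auto simp: le_Suc_eq)
        moreover from this have "\<phi> s' < \<phi> s" using \<phi>J J t(2) x1 by simp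
        moreover have "agree ?X s' s0" using t(1) ag by (simp add: agree_def)
        ultimately show ?thesis unfolding I'_def I_def by blast
      qed
      have "Suc (s ''x1'' 0) \<le> W" using x1 W by linarith
      then show ?thesis
        unfolding I'_def[symmetric] peel_body_def
        using False by (simp add: V) (auto intro!: fin agree_upd agree_refl)
    qed
  qed
  then show ?thesis
  proof (rule runs_mono)
    show "1 + \<phi> s0 * (1 + cost peel_body) \<le> 1 + (3 * n + m) * (1 + cost peel_body)"
      using \<phi>J[OF J0] s0(2) by simp
    fix s assume s: "I s \<and> \<not> bval (Less (sc ''x1'') (sc ''N'')) s"
    then have ag: "agree ?X s s0" by (simp add: I_def)
    obtain al where J: "J al s" using s by (auto simp: I_def)
    have "s ''N'' 0 = 3 * n" using s0(1) by (auto simp: basic_ab_def basic_def agreeD[OF ag])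
    then have "s ''x1'' 0 = 3 * n" "s ''y1'' 0 = 3 * n" using s J by (auto simp: J_def)
    then have "\<forall>x < 3 * n. s ''deg'' x \<noteq> 1" using J by (simp add: J_def)
    then show "agree ?X s s0 \<and> (\<exists>al \<subseteq> {..<m}. counts al (s ''deg'') (s ''S'') \<and>
        (\<forall>i. s ''rem'' i = (if i < m \<and> i \<notin> al then 1 else 0)) \<and>
        (\<forall>C. is_cycle sgraph C \<longrightarrow> C \<subseteq> sedge ` al) \<and> (\<forall>x < 3 * n. s ''deg'' x \<noteq> 1))"
      using ag J unfolding J_def by blast
  qed
qed

end

section \<open>Traversing the cycles\<close>

context pseudo_graph
begin

lemma finite_incident: "al \<subseteq> {..<m} \<Longrightarrow> finite (incident al x)"
  by (rule finite_subset[of _ "{..<m}"]) (auto simp: incident_def)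

text \<open>The surviving edges form a pseudoforest without leaves, so
  \<open>pseudoforest_degree_two\<close> applies.\<close>

lemma degree_two:
  assumes cn: "counts al deg S" and al: "al \<subseteq> {..<m}" and x: "x < 3 * n" "deg x \<noteq> 0"
    and no1: "\<forall>x < 3 * n. deg x \<noteq> 1"
  shows "deg x = 2"
proof -
  let ?E = "sedge ` al"
  have fin: "finite al" using al finite_subset by auto
  have sub: "?E \<subseteq> sgraph" using al by (auto simp: sgraph_def)
  have inj: "inj_on sedge al" by (rule inj_onI) (use al sedge_inj in blast)
  have dg: "degree ?E y = deg y" for y
  proof -
    have "{e \<in> ?E. y \<in> e} = sedge ` incident al y" by (auto simp: incident_def)
    moreover have "inj_on sedge (incident al y)" using inj by (rule inj_on_subset) (auto simp: incident_def)
    ultimately show ?thesis using cn by (simp add: degree_def card_image counts_def)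
  qed
  have deg2: "2 \<le> degree ?E y" if "y \<in> \<Union>?E" for y
  proof -
    obtain i where i: "i \<in> al" "y \<in> sedge i" using \<open>y \<in> \<Union>?E\<close> by auto
    then have "y < 3 * n" using incident_less al by auto
    have "i \<in> incident al y" using i by (auto simp: incident_def)
    then have "card (incident al y) \<noteq> 0" using fin by (auto simp: incident_def)
    then have "deg y \<noteq> 0" "deg y \<noteq> 1" using cn no1 \<open>y < 3 * n\<close> by (auto simp: counts_def)
    then show ?thesis using dg by simp
  qed
  have "degree ?E x = 2"
  proof (rule pseudoforest_degree_two)
    show "finite ?E" using fin by simp
    show "card e = 2" if "e \<in> ?E" for e
      using that al a_neq_b by (auto simp: sedge_def)
    have "incident al x \<noteq> {}" using x(2) cn by (auto simp: counts_def)
    then show "x \<in> \<Union>?E" by (auto simp: incident_def)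
    show "C1 = C2" if "is_cycle ?E C1" "is_cycle ?E C2" "p \<in> \<Union>C1" "q \<in> \<Union>C2" "(p, q) \<in> (adj_rel ?E)\<^sup>*" for C1 C2 p q
      using cycles_connected[OF is_cycle_mono[OF that(1) sub] is_cycle_mono[OF that(2) sub] that(3,4)]
        that(5) adj_rel_mono[OF sub] by blast
  qed (rule deg2)
  then show ?thesis using dg by simp
qed

text \<open>\<open>B\<close> is the set of slots on the cycles traversed completely, and \<open>R\<close> consists of the first three slots
  of each of them.\<close>

definition cyc_cert where
  "cyc_cert al B su pr ei cy R rot \<longleftrightarrow> B \<subseteq> {..<3 * n} \<and>
    (\<forall>x\<in>B. su x \<in> B \<and> pr x \<in> B \<and> pr (su x) = x \<and> su (pr x) = x \<and> cy (su x) = cy x \<and> cy x \<in> B \<and>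
      ei x \<in> al \<and> sedge (ei x) = {x, su x} \<and> incident al x \<subseteq> ei ` B \<and>
      is_cycle sgraph (sedge ` ei ` {y \<in> B. cy y = cy x}) \<and> (\<exists>y\<in>R. cy y = cy x)) \<and>
    inj_on ei B \<and> R \<subseteq> B \<and>
    (\<forall>x\<in>R. rot x \<in> R \<and> cy (rot x) = cy x \<and> rot x \<noteq> x \<and> rot (rot x) \<noteq> x \<and> rot (rot (rot x)) = x \<and>
      (\<forall>y\<in>R. cy y = cy x \<longrightarrow> y = x \<or> y = rot x \<or> y = rot (rot x))) \<and> 3 dvd card R"

text \<open>The closed walk \<open>ys\<close> becomes a further cycle named by its head. Names of
  finished cycles lie in \<open>B\<close>, so this name is fresh. As degrees are at most 2, the two
  walk edges at a slot exhaust its edges, and no later walk returns to it.\<close>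

lemma cyc_cert_extend:
  fixes su pr ei cy rot su' pr' ei' rot' :: "nat \<Rightarrow> nat"
  assumes cert: "cyc_cert al B su pr ei cy R rot"
    and agr: "\<And>x. x \<in> B \<Longrightarrow> su' x = su x \<and> pr' x = pr x \<and> ei' x = ei x" "\<And>x. x \<in> R \<Longrightarrow> rot' x = rot x"
    and ys: "distinct ys" "3 \<le> length ys" "set ys \<inter> B = {}" "set ys \<subseteq> {..<3 * n}"
    and step: "\<And>j. j < length ys \<Longrightarrow> su' (ys ! j) = ys ! (Suc j mod length ys) \<and>
      pr' (ys ! (Suc j mod length ys)) = ys ! j \<and> ei' (ys ! j) \<in> al \<and>
      sedge (ei' (ys ! j)) = {ys ! j, ys ! (Suc j mod length ys)}"
    and inj: "inj_on ei' (B \<union> set ys)" and al: "al \<subseteq> {..<m}"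
    and deg: "\<And>x. card (incident al x) \<le> 2"
    and rot': "rot' (ys ! 0) = ys ! 1" "rot' (ys ! 1) = ys ! 2" "rot' (ys ! 2) = ys ! 0"
  shows "cyc_cert al (B \<union> set ys) su' pr' ei' (\<lambda>y. if y \<in> set ys then ys ! 0 else cy y)
    (R \<union> {ys ! 0, ys ! 1, ys ! 2}) rot'"
proof -
  let ?L = "length ys"
  let ?cy = "\<lambda>y. if y \<in> set ys then ys ! 0 else cy y"
  let ?R = "{ys ! 0, ys ! 1, ys ! 2}"
  have mem: "ys ! j \<in> set ys" if "j < ?L" for j using that by simp
  have nxt: "Suc j mod ?L < ?L" for j using ys(2) by (intro mod_less_divisor) linarith
  have BR: "R \<subseteq> B" and Bn: "B \<subseteq> {..<3 * n}"
    and CB: "\<And>x. x \<in> B \<Longrightarrow> su x \<in> B \<and> pr x \<in> B \<and> pr (su x) = x \<and> su (pr x) = x \<and> cy (su x) = cy x \<and> cy x \<in> B \<and>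
      ei x \<in> al \<and> sedge (ei x) = {x, su x} \<and> incident al x \<subseteq> ei ` B \<and>
      is_cycle sgraph (sedge ` ei ` {y \<in> B. cy y = cy x}) \<and> (\<exists>y\<in>R. cy y = cy x)"
    and CR: "\<And>x. x \<in> R \<Longrightarrow> rot x \<in> R \<and> cy (rot x) = cy x \<and> rot x \<noteq> x \<and> rot (rot x) \<noteq> x \<and> rot (rot (rot x)) = x \<and>
      (\<forall>y\<in>R. cy y = cy x \<longrightarrow> y = x \<or> y = rot x \<or> y = rot (rot x))" and dv: "3 dvd card R"
    using cert unfolding cyc_cert_def by blast+
  have dis: "x \<notin> set ys" if "x \<in> B" for x using that ys(3) by auto
  have y0: "ys ! 0 \<in> set ys" "ys ! 1 \<in> set ys" "ys ! 2 \<in> set ys" by (rule mem; use ys(2) in linarith)+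
  have eiB: "ei' ` B = ei ` B" using agr by (intro image_cong) auto
  have orbB: "{y \<in> B \<union> set ys. ?cy y = ?cy x} = {y \<in> B. cy y = cy x}" if "x \<in> B" for x
    using that dis CB y0(1) by auto
  have orbY: "{y \<in> B \<union> set ys. ?cy y = ?cy x} = set ys" if "x \<in> set ys" for x
  proof -
    have "cy y \<noteq> ys ! 0" if "y \<in> B" for y using CB[OF that] dis[of "cy y"] y0(1) by metis
    then show ?thesis using that dis by auto
  qed
  have prev: "\<exists>k<?L. Suc k mod ?L = j" if "j < ?L" for j
  proof (cases j)
    case 0
    have "Suc (?L - 1) = ?L" using ys(2) by linarith
    then show ?thesis using 0 by (intro exI[of _ "?L - 1"]) simp
  next
    case (Suc k) then show ?thesis using that by (intro exI[of _ k]) auto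
  qed
  have on_ys: "su' x \<in> set ys \<and> pr' x \<in> set ys \<and> pr' (su' x) = x \<and> su' (pr' x) = x \<and>
      ei' x \<in> al \<and> sedge (ei' x) = {x, su' x} \<and> incident al x \<subseteq> ei' ` set ys" if x: "x \<in> set ys" for x
  proof -
    obtain j where j: "j < ?L" "x = ys ! j" using x by (auto simp: in_set_conv_nth)
    obtain k where k: "k < ?L" "Suc k mod ?L = j" using prev[OF j(1)] by blast
    have sx: "su' x = ys ! (Suc j mod ?L)" "pr' (su' x) = x" "ei' x \<in> al" "sedge (ei' x) = {x, su' x}"
      using step[OF j(1)] j(2) by auto
    have px: "pr' x = ys ! k" "su' (pr' x) = x" "ei' (ys ! k) \<in> al" "sedge (ei' (ys ! k)) = {ys ! k, x}"
      using step[OF k(1)] j(2) k(2) by auto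
    have kj: "k \<noteq> j" using k ys(2) by (cases "Suc k = ?L") auto
    then have "ys ! k \<noteq> x" using j k ys(1) by (simp add: nth_eq_iff_index_eq)
    then have "ei' (ys ! k) \<noteq> ei' x" using inj_onD[OF inj, of "ys ! k" x] mem[OF k(1)] x by auto
    moreover have sub: "{ei' (ys ! k), ei' x} \<subseteq> incident al x" using sx px by (auto simp: incident_def)
    moreover have fin: "finite (incident al x)" using finite_incident[OF al] .
    ultimately have "incident al x = {ei' (ys ! k), ei' x}"
      using deg[of x] card_seteq[OF fin sub] by simp
    then have "incident al x \<subseteq> ei' ` set ys" using x mem[OF k(1)] by auto
    then show ?thesis using sx px mem[OF k(1)] mem[OF nxt] by simp
  qed
  have cyc: "sedge ` ei' ` set ys = cycle_edges ys"
  proof -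
    have "set ys = (!) ys ` {..<?L}" by (auto simp: set_conv_nth)
    then have "sedge ` ei' ` set ys = (\<lambda>j. sedge (ei' (ys ! j))) ` {..<?L}" by (simp add: image_image)
    also have "\<dots> = cycle_edges ys" unfolding cycle_edges_image by (rule image_cong) (use step in auto)
    finally show ?thesis .
  qed
  have "sedge ` ei' ` set ys \<subseteq> sgraph" using on_ys al unfolding sgraph_def by blast
  then have cycY: "is_cycle sgraph (sedge ` ei' ` set ys)" unfolding is_cycle_def using cyc ys by blast
  have dist3: "ys ! 0 \<noteq> ys ! 1" "ys ! 0 \<noteq> ys ! 2" "ys ! 1 \<noteq> ys ! 2"
  proof -
    have "0 < ?L" "1 < ?L" "2 < ?L" using ys(2) by linarith+
    then show "ys ! 0 \<noteq> ys ! 1" "ys ! 0 \<noteq> ys ! 2" "ys ! 1 \<noteq> ys ! 2"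
      using ys(1) nth_eq_iff_index_eq by fastforce+
  qed
  show ?thesis unfolding cyc_cert_def
  proof (intro conjI ballI)
    show "B \<union> set ys \<subseteq> {..<3 * n}" using Bn ys by auto
    show "inj_on ei' (B \<union> set ys)" by (rule inj)
    show "R \<union> ?R \<subseteq> B \<union> set ys" using BR y0 by auto
    have "finite B" using Bn finite_subset by auto
    then have "finite R" using BR finite_subset by auto
    moreover have "R \<inter> ?R = {}" using BR dis y0 by auto
    ultimately have "card (R \<union> ?R) = card R + card ?R" by (intro card_Un_disjoint) auto
    moreover have "card ?R = 3" using dist3 by simp
    ultimately show "3 dvd card (R \<union> ?R)" using dv by (metis dvd_add dvd_refl)
  next
    fix x assume x: "x \<in> B \<union> set ys"
    show "is_cycle sgraph (sedge ` ei' ` {y \<in> B \<union> set ys. ?cy y = ?cy x})"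
    proof (cases "x \<in> B")
      case True
      have "ei' ` {y \<in> B. cy y = cy x} = ei ` {y \<in> B. cy y = cy x}" using agr by (intro image_cong) auto
      then show ?thesis using orbB[OF True] CB[OF True] by simp
    next
      case False
      then have "x \<in> set ys" using x by simp
      then show ?thesis using orbY cycY by simp
    qed
    show "\<exists>y\<in>R \<union> ?R. ?cy y = ?cy x"
    proof (cases "x \<in> B")
      case True
      then obtain y where "y \<in> R" "cy y = cy x" using CB by blast
      then show ?thesis using dis BR True by (intro bexI[of _ y]) auto
    next
      case False
      then show ?thesis using x y0 by auto
    qed
    show "su' x \<in> B \<union> set ys" "pr' x \<in> B \<union> set ys" "pr' (su' x) = x" "su' (pr' x) = x"
      "ei' x \<in> al" "sedge (ei' x) = {x, su' x}"
      using x on_ys[of x] CB[of x] agr(1)[of x] agr(1)[of "su x"] agr(1)[of "pr x"] by auto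
    show "incident al x \<subseteq> ei' ` (B \<union> set ys)"
      using x on_ys[of x] CB[of x] eiB by (auto simp: image_Un)
    show "?cy (su' x) = ?cy x" using x on_ys[of x] CB[of x] agr(1)[of x] dis[of x] dis[of "su x"] by auto
    show "?cy x \<in> B \<union> set ys" using x y0 CB[of x] by auto
  next
    fix x assume x: "x \<in> R \<union> ?R"
    have A: "rot' x \<in> R \<union> ?R \<and> ?cy (rot' x) = ?cy x \<and> rot' x \<noteq> x \<and> rot' (rot' x) \<noteq> x \<and> rot' (rot' (rot' x)) = x \<and>
      (\<forall>y\<in>R \<union> ?R. ?cy y = ?cy x \<longrightarrow> y = x \<or> y = rot' x \<or> y = rot' (rot' x))"
    proof (cases "x \<in> R")
      case True
      have r: "rot x \<in> R" "rot (rot x) \<in> R" using CR True by blast+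
      have rr: "rot' x = rot x" "rot' (rot x) = rot (rot x)" "rot' (rot (rot x)) = rot (rot (rot x))"
        using agr(2) True r by auto
      have nys: "x \<notin> set ys" "rot x \<notin> set ys" using dis BR True r by auto
      have "y = x \<or> y = rot x \<or> y = rot (rot x)" if "y \<in> R \<union> ?R" "?cy y = ?cy x" for y
      proof -
        have "?cy x \<in> B" using nys CB BR True by auto
        then have "y \<notin> set ys" using that(2) dis y0(1) by auto
        then have "y \<in> R" "cy y = cy x" using that y0 nys by auto
        then show ?thesis using CR[OF True] by blast
      qed
      then show ?thesis using CR[OF True] nys r unfolding rr by auto
    next
      case False
      have "\<forall>y\<in>R \<union> ?R. ?cy y = ys ! 0 \<longrightarrow> y \<in> ?R"
      proof (intro ballI impI)
        fix y assume y: "y \<in> R \<union> ?R" "?cy y = ys ! 0"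
        have "y \<notin> R"
        proof
          assume "y \<in> R"
          then have "?cy y \<in> B" using CB BR dis by auto
          then show False using y(2) dis y0(1) by auto
        qed
        then show "y \<in> ?R" using y by simp
      qed
      moreover have "x = ys ! 0 \<or> x = ys ! 1 \<or> x = ys ! 2" using False x by simp
      ultimately show ?thesis using y0 dist3 rot' by (elim disjE) auto
    qed
    show "rot' x \<in> R \<union> ?R" "?cy (rot' x) = ?cy x" "rot' x \<noteq> x" "rot' (rot' x) \<noteq> x" "rot' (rot' (rot' x)) = x"
      using A by blast+
    show "?cy y = ?cy x \<longrightarrow> y = x \<or> y = rot' x \<or> y = rot' (rot' x)" if "y \<in> R \<union> ?R" for y
      using A that by blast
  qed
qed

text \<open>\<open>xs\<close> are the slots already left, \<open>cur\<close> is the current one, and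
  \<open>e\<close> is the fresh edge to be followed next.\<close>

definition path_cert where
  "path_cert al B su pr ei xs cur e \<longleftrightarrow> distinct (xs @ [cur]) \<and> set (xs @ [cur]) \<inter> B = {} \<and>
    set (xs @ [cur]) \<subseteq> {..<3 * n} \<and>
    (\<forall>j<length xs. su (xs ! j) = (xs @ [cur]) ! Suc j \<and> pr ((xs @ [cur]) ! Suc j) = xs ! j \<and>
      ei (xs ! j) \<in> al \<and> sedge (ei (xs ! j)) = {xs ! j, (xs @ [cur]) ! Suc j}) \<and>
    inj_on ei (B \<union> set xs) \<and> e \<in> al \<and> e \<notin> ei ` (B \<union> set xs) \<and> cur \<in> sedge e"

text \<open>Two edges sum to \<open>e + e'\<close>, so subtracting the known one modulo
  \<open>m\<close> yields the other.\<close>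

lemma next_edge:
  assumes cn: "counts al deg S" and al: "al \<subseteq> {..<m}" and e: "e \<in> incident al x" and d: "deg x = 2"
  obtains e' where "incident al x = {e, e'}" "e' \<noteq> e" "e' < m"
    "(if S x < e then S x + m - e else S x - e) = e'"
proof -
  have "card (incident al x) = 2" using cn d by (simp add: counts_def)
  then obtain e' where i: "incident al x = {e, e'}" "e' \<noteq> e" using e
    by (metis card_2_iff doubleton_eq_iff insertE singletonD)
  then have "e \<in> al" "e' \<in> al" by (auto simp: incident_def)
  then have lt: "e < m" "e' < m" using al by auto
  have "S x = (e + e') mod m" using cn i by (simp add: counts_def)
  then have "(if S x < e then S x + m - e else S x - e) = (e + e' - e) mod m"
    using mod_sum_diff[OF lt(1), of "e + e'"] by (simp only: le_add1)
  then show ?thesis using that i lt by simp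
qed

text \<open>\<open>e\<close> leads to \<open>z\<close>, and \<open>e'\<close> is the other edge at
  \<open>z\<close>. If \<open>e'\<close> is fresh, so is \<open>z\<close>. Otherwise
  \<open>z\<close> is the head of the path: any later slot of \<open>xs\<close> already has two
  traversed edges, and \<open>e\<close> would be a third.\<close>

lemma path_step:
  fixes su pr ei :: "nat \<Rightarrow> nat"
  assumes cert: "cyc_cert al B su pr ei cy RB rot" and path: "path_cert al B su pr ei xs cur e"
    and cn: "counts al deg S" and al: "al \<subseteq> {..<m}" and d2: "\<And>x. deg x = 0 \<or> deg x = 2"
    and z: "z = a e + b e - cur"
    and e': "e' = (if S z < e then S z + m - e else S z - e)"
  defines "su' \<equiv> su(cur := z)" and "pr' \<equiv> pr(z := cur)" and "ei' \<equiv> ei(cur := e)"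
  shows "z < 3 * n" "e' < m"
    and "e' \<in> al - ei' ` (B \<union> set (xs @ [cur])) \<Longrightarrow> path_cert al B su' pr' ei' (xs @ [cur]) z e'"
    and "e' \<notin> al - ei' ` (B \<union> set (xs @ [cur])) \<Longrightarrow> 2 \<le> length xs"
    and "e' \<notin> al - ei' ` (B \<union> set (xs @ [cur])) \<Longrightarrow>
      rot' ((xs @ [cur]) ! 0) = (xs @ [cur]) ! 1 \<Longrightarrow> rot' ((xs @ [cur]) ! 1) = (xs @ [cur]) ! 2 \<Longrightarrow>
      rot' ((xs @ [cur]) ! 2) = (xs @ [cur]) ! 0 \<Longrightarrow> (\<And>x. x \<in> RB \<Longrightarrow> rot' x = rot x) \<Longrightarrow>
      \<exists>cy'. cyc_cert al (B \<union> set (xs @ [cur])) su' pr' ei' cy' (RB \<union> {(xs @ [cur]) ! 0, (xs @ [cur]) ! 1, (xs @ [cur]) ! 2}) rot'"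
    and "cyc_cert al B su' pr' ei' cy RB rot" and "inj_on ei' (B \<union> set (xs @ [cur]))"
    and "ei' ` (B \<union> set (xs @ [cur])) = insert e (ei ` (B \<union> set xs))"
proof -
  have P: "distinct xs" "cur \<notin> set xs" "set xs \<inter> B = {}" "cur \<notin> B" "set xs \<subseteq> {..<3 * n}" "cur < 3 * n"
    "inj_on ei (B \<union> set xs)" "e \<in> al" "e \<notin> ei ` (B \<union> set xs)" "cur \<in> sedge e"
    and Pj: "\<And>j. j < length xs \<Longrightarrow> su (xs ! j) = (xs @ [cur]) ! Suc j \<and> pr ((xs @ [cur]) ! Suc j) = xs ! j \<and>
      ei (xs ! j) \<in> al \<and> sedge (ei (xs ! j)) = {xs ! j, (xs @ [cur]) ! Suc j}"
    using path unfolding path_cert_def by auto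
  have CB: "\<And>x. x \<in> B \<Longrightarrow> su x \<in> B \<and> pr x \<in> B \<and> incident al x \<subseteq> ei ` B \<and> sedge (ei x) = {x, su x}"
    and BR: "RB \<subseteq> B"
    using cert unfolding cyc_cert_def by blast+
  let ?ys = "xs @ [cur]"
  have em: "e < m" using P al by auto
  have se: "sedge e = {cur, z}" "z \<noteq> cur"
    using P(10) z a_neq_b[OF em] by (auto simp: sedge_def)
  then show zn: "z < 3 * n" using incident_less[of z e] em by simp
  have ez: "e \<in> incident al z" using P se by (auto simp: incident_def)
  have fin: "finite (incident al x)" for x using finite_incident[OF al] .
  have "card (incident al z) \<noteq> 0" using ez fin by auto
  then have dz: "deg z = 2" using d2[of z] cn by (auto simp: counts_def)
  obtain e'' where E: "incident al z = {e, e''}" "e'' \<noteq> e" "e'' < m" "e'' = e'"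
    using next_edge[OF cn al ez dz] e' by metis
  then show "e' < m" by simp
  have e'al: "e' \<in> al" "z \<in> sedge e'" using E by (auto simp: incident_def)
  have zB: "z \<notin> B" using CB[of z] ez P(9) by auto
  have ei'B: "ei' ` (B \<union> set xs) = ei ` (B \<union> set xs)" using P by (intro image_cong) (auto simp: ei'_def)
  show ins: "ei' ` (B \<union> set ?ys) = insert e (ei ` (B \<union> set xs))"
  proof -
    have "B \<union> set ?ys = insert cur (B \<union> set xs)" by auto
    moreover have "ei' cur = e" by (simp add: ei'_def)
    ultimately show ?thesis using ei'B by (metis image_insert)
  qed
  have su'x: "su' x = su x" "ei' x = ei x" if "x \<noteq> cur" for x using that by (auto simp: su'_def ei'_def)
  show inj': "inj_on ei' (B \<union> set ?ys)"
  proof -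
    have "inj_on ei' (B \<union> set xs) \<longleftrightarrow> inj_on ei (B \<union> set xs)"
    proof (rule inj_on_cong)
      fix x assume "x \<in> B \<union> set xs"
      then have "x \<noteq> cur" using P(2,4) by auto
      then show "ei' x = ei x" by (rule su'x(2))
    qed
    then have "inj_on ei' (B \<union> set xs)" using P(7) by simp
    moreover have "ei' cur \<notin> ei' ` (B \<union> set xs)" using ei'B P(9) by (simp add: ei'_def)
    ultimately show ?thesis using P(2,4) by (simp add: inj_on_insert)
  qed
  have agrB: "su' x = su x \<and> pr' x = pr x \<and> ei' x = ei x" if "x \<in> B" for x
    using that P(4) zB by (auto simp: su'_def pr'_def ei'_def)
  show "cyc_cert al B su' pr' ei' cy RB rot"
  proof -
    have "inj_on ei' B" using inj' by (rule inj_on_subset) auto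
    moreover have "ei' ` X = ei ` X" if "X \<subseteq> B" for X using that agrB by (intro image_cong) auto
    moreover have "{y \<in> B. cy y = k} \<subseteq> B" for k by auto
    ultimately show ?thesis using cert agrB CB unfolding cyc_cert_def by simp
  qed
  have zj: "j = 0" if "j < length xs" "z = xs ! j" for j
  proof (rule ccontr)
    assume "j \<noteq> 0"
    then obtain k where k: "j = Suc k" by (cases j) auto
    have "sedge (ei (xs ! k)) = {xs ! k, z}" "ei (xs ! k) \<in> al" using Pj[of k] that k by (auto simp: nth_append)
    then have 1: "ei (xs ! k) \<in> {e, e''}" unfolding E(1)[symmetric] by (auto simp: incident_def)
    have "z \<in> sedge (ei z)" "ei z \<in> al" using Pj[OF that(1)] that(2) by auto
    then have 2: "ei z \<in> {e, e''}" unfolding E(1)[symmetric] by (auto simp: incident_def)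
    have "ei z \<noteq> e" "ei (xs ! k) \<noteq> e" using P(9) that k by auto
    then have "ei z = ei (xs ! k)" using 1 2 by simp
    then have "z = xs ! k" using inj_onD[OF P(7)] that k by auto
    then show False using that k P(1) by (simp add: nth_eq_iff_index_eq)
  qed
  have steps: "su' (?ys ! j) = (?ys @ [z]) ! Suc j \<and> ei' (?ys ! j) \<in> al \<and>
      sedge (ei' (?ys ! j)) = {?ys ! j, (?ys @ [z]) ! Suc j}" if j: "j < length ?ys" for j
  proof (cases "j = length xs")
    case True
    then show ?thesis using P(8) se by (simp add: su'_def ei'_def nth_append)
  next
    case False
    then have jl: "j < length xs" using j by simp
    then have "xs ! j \<noteq> cur" using P(2) by (metis nth_mem)
    then show ?thesis using Pj[OF jl] jl su'x by (simp add: nth_append)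
  qed
  {
    assume A: "e' \<in> al - ei' ` (B \<union> set ?ys)"
    have zxs: "z \<notin> set xs"
    proof
      assume "z \<in> set xs"
      then obtain j where j: "j < length xs" "z = xs ! j" by (auto simp: in_set_conv_nth)
      then have "z \<in> sedge (ei z)" "ei z \<in> al" using Pj[OF j(1)] by auto
      then have "ei z \<in> {e, e''}" unfolding E(1)[symmetric] by (auto simp: incident_def)
      moreover have "ei z \<noteq> e" using P(9) j by auto
      ultimately have "e' = ei z" using E(4) by auto
      then show False using A ins j by auto
    qed
    have "pr' ((?ys @ [z]) ! Suc j) = ?ys ! j" if "j < length ?ys" for j
    proof (cases "j = length xs")
      case True
      then show ?thesis by (simp add: pr'_def nth_append)
    next
      case False
      then have jl: "j < length xs" using that by simp
      have "?ys ! Suc j \<in> set ?ys" using jl by (intro nth_mem) simp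
      then have "?ys ! Suc j \<noteq> z" using zxs se by auto
      then have "pr' (?ys ! Suc j) = pr (?ys ! Suc j)" unfolding pr'_def by (rule fun_upd_other)
      moreover have "(?ys @ [z]) ! Suc j = ?ys ! Suc j" "?ys ! j = xs ! j" using jl by (simp_all add: nth_append)
      ultimately show ?thesis using Pj[OF jl] by metis
    qed
    then show "path_cert al B su' pr' ei' ?ys z e'"
      unfolding path_cert_def using P zn zB zxs se(2) inj' e'al A steps by simp
  }
  {
    assume A: "e' \<notin> al - ei' ` (B \<union> set ?ys)"
    have "e' \<in> ei ` (B \<union> set xs)" using A e'al ins E by auto
    then obtain y where y: "y \<in> B \<union> set xs" "e' = ei y" by auto
    have "y \<notin> B" using CB[of y] zB e'al y by auto
    then have "y \<in> set xs" using y by simp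
    then obtain j where j: "j < length xs" "y = xs ! j" by (auto simp: in_set_conv_nth)
    have "z = xs ! j \<or> z = ?ys ! Suc j" using Pj[OF j(1)] e'al y j by auto
    moreover have "?ys ! Suc j = (if Suc j < length xs then xs ! Suc j else cur)"
      using j by (auto simp: nth_append)
    ultimately have z0: "z = xs ! 0 \<and> 0 < length xs" using zj[of j] zj[of "Suc j"] j se(2) by (auto split: if_splits)
    \<comment> \<open>Closing after only two slots would need two parallel edges.\<close>
    show len: "2 \<le> length xs"
    proof (rule ccontr)
      assume "\<not> 2 \<le> length xs"
      then have "length xs = 1" using conjunct2[OF z0] by linarith
      then have "sedge (ei (xs ! 0)) = {z, cur}" "ei (xs ! 0) \<in> al" using Pj[of 0] z0 by (auto simp: nth_append)
      then have "sedge (ei (xs ! 0)) = sedge e" using se by auto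
      then have "ei (xs ! 0) = e" using sedge_inj al em \<open>ei (xs ! 0) \<in> al\<close> by blast
      then show False using P(9) z0 by auto
    qed
    assume rot: "rot' (?ys ! 0) = ?ys ! 1" "rot' (?ys ! 1) = ?ys ! 2" "rot' (?ys ! 2) = ?ys ! 0"
      "\<And>x. x \<in> RB \<Longrightarrow> rot' x = rot x"
    have "cyc_cert al (B \<union> set ?ys) su' pr' ei' (\<lambda>y. if y \<in> set ?ys then ?ys ! 0 else cy y)
      (RB \<union> {?ys ! 0, ?ys ! 1, ?ys ! 2}) rot'"
    proof (rule cyc_cert_extend[OF cert])
      show "distinct ?ys" "3 \<le> length ?ys" "set ?ys \<inter> B = {}" "set ?ys \<subseteq> {..<3 * n}"
        using P len by auto
      fix j assume j: "j < length ?ys"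
      have nx: "(?ys @ [z]) ! Suc j = ?ys ! (Suc j mod length ?ys)"
      proof (cases "Suc j = length ?ys")
        case True
        then show ?thesis using z0 by (simp add: nth_append)
      next
        case False then show ?thesis using j by (simp add: nth_append)
      qed
      have "pr' (?ys ! (Suc j mod length ?ys)) = ?ys ! j"
      proof (cases "j = length xs")
        case True
        then show ?thesis using nx[symmetric] by (simp add: pr'_def nth_append)
      next
        case False
        then have jl: "j < length xs" using j by simp
        have ne: "?ys ! Suc j \<noteq> z"
        proof
          assume "?ys ! Suc j = z"
          moreover have "z = ?ys ! 0" using z0 by (simp add: nth_append)
          moreover have "distinct ?ys" using P by simp
          ultimately have "Suc j = 0" using jl nth_eq_iff_index_eq[of ?ys "Suc j" 0] by simp
          then show False by simp
        qed
        have "Suc j mod length ?ys = Suc j" "?ys ! j = xs ! j" using jl by (simp_all add: nth_append)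
        moreover have "pr' (?ys ! Suc j) = pr (?ys ! Suc j)" unfolding pr'_def using ne by (rule fun_upd_other)
        ultimately show ?thesis using Pj[OF jl] by simp
      qed
      then show "su' (?ys ! j) = ?ys ! (Suc j mod length ?ys) \<and> pr' (?ys ! (Suc j mod length ?ys)) = ?ys ! j \<and>
        ei' (?ys ! j) \<in> al \<and> sedge (ei' (?ys ! j)) = {?ys ! j, ?ys ! (Suc j mod length ?ys)}"
        using steps[OF j] nx by simp
    next
      fix x show "card (incident al x) \<le> 2" using d2[of x] cn by (auto simp: counts_def)
    qed (use agrB rot inj' al in auto)
    then show "\<exists>cy'. cyc_cert al (B \<union> set ?ys) su' pr' ei' cy' (RB \<union> {?ys ! 0, ?ys ! 1, ?ys ! 2}) rot'" by blast
  }
qed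

end

lemma wp_Seq_fun: "wp w (c1 ;; c2) Q = wp w c1 (wp w c2 Q)"
  by (rule ext) simp

context pseudo_graph
begin

lemma cyc_cert_rot_cong:
  "cyc_cert al B su pr ei cy R rot \<Longrightarrow> (\<And>x. x \<in> R \<Longrightarrow> rot' x = rot x) \<Longrightarrow> cyc_cert al B su pr ei cy R rot'"
  unfolding cyc_cert_def by simp

text \<open>Nothing is recorded before the third slot has been left, whence the empty set.\<close>

definition head_three :: "nat list \<Rightarrow> nat set" where
  "head_three xs = (if 3 \<le> length xs then {xs ! 0, xs ! 1, xs ! 2} else {})"

text \<open>The state inside a walk: in contrast to \<open>resting\<close>, the marks and the
  recorded triple already include the current path.\<close>

definition walking where
  "walking al s \<longleftrightarrow> (\<exists>B cy R xs.
    cyc_cert al B (s ''su'') (s ''pr'') (s ''ei'') cy R (s ''rot'') \<and>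
    path_cert al B (s ''su'') (s ''pr'') (s ''ei'') xs (s ''cur'' 0) (s ''e2'' 0) \<and>
    (\<forall>i. s ''rem'' i = (if i < m \<and> (i \<notin> al \<or> i \<in> s ''ei'' ` (B \<union> set xs)) then 1 else 0)) \<and>
    s ''k'' 0 = length xs \<and> (1 \<le> length xs \<longrightarrow> s ''f1'' 0 = xs ! 0) \<and> (2 \<le> length xs \<longrightarrow> s ''f2'' 0 = xs ! 1) \<and>
    (\<forall>x. s ''real'' x = (if x \<in> R \<union> head_three xs then 1 else 0)) \<and>
    (3 \<le> length xs \<longrightarrow> s ''rot'' (xs ! 0) = xs ! 1 \<and> s ''rot'' (xs ! 1) = xs ! 2 \<and> s ''rot'' (xs ! 2) = xs ! 0))"

definition resting where
  "resting al s \<longleftrightarrow> (\<exists>B cy R.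
    cyc_cert al B (s ''su'') (s ''pr'') (s ''ei'') cy R (s ''rot'') \<and>
    (\<forall>i. s ''rem'' i = (if i < m \<and> (i \<notin> al \<or> i \<in> s ''ei'' ` B) then 1 else 0)) \<and>
    (\<forall>x. s ''real'' x = (if x \<in> R then 1 else 0)))"

lemma resting_cong:
  assumes "resting al s" "s' ''su'' = s ''su''" "s' ''pr'' = s ''pr''" "s' ''ei'' = s ''ei''" "s' ''rot'' = s ''rot''"
    "s' ''rem'' = s ''rem''" "s' ''real'' = s ''real''"
  shows "resting al s'"
  using assms(1) unfolding resting_def assms(2-) .

lemma walking_start:
  assumes "resting al s" and i: "i < m" "s ''rem'' i \<noteq> 1"
    and eq: "s' ''su'' = s ''su''" "s' ''pr'' = s ''pr''" "s' ''ei'' = s ''ei''" "s' ''rot'' = s ''rot''"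
    "s' ''rem'' = s ''rem''" "s' ''real'' = s ''real''" "s' ''k'' 0 = 0" "s' ''e2'' 0 = i" "s' ''cur'' 0 = a i"
  shows "walking al s'"
proof -
  obtain B cy R where C: "cyc_cert al B (s ''su'') (s ''pr'') (s ''ei'') cy R (s ''rot'')"
    "\<forall>i. s ''rem'' i = (if i < m \<and> (i \<notin> al \<or> i \<in> s ''ei'' ` B) then 1 else 0)"
    "\<forall>x. s ''real'' x = (if x \<in> R then 1 else 0)"
    using assms(1) unfolding resting_def by blast
  have ia: "i \<in> al" "i \<notin> s ''ei'' ` B" using C(2)[rule_format, of i] i by (auto split: if_splits)
  have ai: "a i \<in> sedge i" by (simp add: sedge_def)
  have "a i \<notin> B"
  proof
    assume "a i \<in> B"
    then have "incident al (a i) \<subseteq> s ''ei'' ` B" using C(1) unfolding cyc_cert_def by blast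
    then show False using ia ai by (auto simp: incident_def)
  qed
  moreover have "inj_on (s ''ei'') B" using C(1) unfolding cyc_cert_def by blast
  ultimately have "path_cert al B (s ''su'') (s ''pr'') (s ''ei'') [] (a i) i"
    using ia ai a_less[OF i(1)] unfolding path_cert_def by simp
  then show ?thesis unfolding walking_def eq using C
    by (intro exI[of _ B] exI[of _ cy] exI[of _ R] exI[of _ "[]"]) (simp add: head_three_def)
qed

text \<open>An edge is marked in \<open>rem\<close> exactly when it was stripped or traversed, so
  the mark of \<open>e'\<close> decides between the two outcomes of
  \<open>path_step\<close>.\<close>

lemma walking_step:
  fixes s s' :: store
  assumes W: "walking al s" and cn: "counts al deg S" and al: "al \<subseteq> {..<m}" and d2: "\<And>x. deg x = 0 \<or> deg x = 2"
  defines "cur \<equiv> s ''cur'' 0" and "e \<equiv> s ''e2'' 0" and "k \<equiv> s ''k'' 0"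
  defines "z \<equiv> a e + b e - cur"
  defines "e' \<equiv> (if S z < e then S z + m - e else S z - e)"
  shows "e < m" "z < 3 * n" "k < 3 * n" "s ''rem'' e = 0"
    and "s' ''su'' = (s ''su'')(cur := z) \<Longrightarrow> s' ''pr'' = (s ''pr'')(z := cur) \<Longrightarrow> s' ''ei'' = (s ''ei'')(cur := e) \<Longrightarrow>
      s' ''rem'' = (s ''rem'')(e := 1) \<Longrightarrow> s' ''k'' 0 = Suc k \<Longrightarrow>
      s' ''f1'' 0 = (if k = 0 then cur else s ''f1'' 0) \<Longrightarrow> s' ''f2'' 0 = (if k = 1 then cur else s ''f2'' 0) \<Longrightarrow>
      s' ''rot'' = (if k = 2 then (s ''rot'')(s ''f1'' 0 := s ''f2'' 0, s ''f2'' 0 := cur, cur := s ''f1'' 0) else s ''rot'') \<Longrightarrow>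
      s' ''real'' = (if k = 2 then (s ''real'')(s ''f1'' 0 := 1, s ''f2'' 0 := 1, cur := 1) else s ''real'') \<Longrightarrow>
      s' ''cur'' 0 = z \<Longrightarrow> s' ''e2'' 0 = e' \<Longrightarrow>
      (if s' ''rem'' e' = 1 then resting al s' else walking al s')"
proof -
  obtain B cy R xs where C: "cyc_cert al B (s ''su'') (s ''pr'') (s ''ei'') cy R (s ''rot'')"
    "path_cert al B (s ''su'') (s ''pr'') (s ''ei'') xs cur e"
    and rem: "\<forall>i. s ''rem'' i = (if i < m \<and> (i \<notin> al \<or> i \<in> s ''ei'' ` (B \<union> set xs)) then 1 else 0)"
    and kx: "k = length xs" and f: "1 \<le> length xs \<longrightarrow> s ''f1'' 0 = xs ! 0" "2 \<le> length xs \<longrightarrow> s ''f2'' 0 = xs ! 1"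
    and real: "\<forall>x. s ''real'' x = (if x \<in> R \<union> head_three xs then 1 else 0)"
    and rot: "3 \<le> length xs \<longrightarrow> s ''rot'' (xs ! 0) = xs ! 1 \<and> s ''rot'' (xs ! 1) = xs ! 2 \<and> s ''rot'' (xs ! 2) = xs ! 0"
    using W unfolding walking_def cur_def e_def k_def by blast
  note PS = path_step[OF C cn al d2 z_def[THEN meta_eq_to_obj_eq] e'_def[THEN meta_eq_to_obj_eq]]
  have P: "distinct (xs @ [cur])" "set (xs @ [cur]) \<inter> B = {}" "set (xs @ [cur]) \<subseteq> {..<3 * n}" "e \<in> al"
    "e \<notin> s ''ei'' ` (B \<union> set xs)" using C(2) unfolding path_cert_def by auto
  show em: "e < m" using P(4) al by auto
  show "z < 3 * n" by (rule PS(1))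
  have "card (set (xs @ [cur])) \<le> card {..<3 * n}" by (rule card_mono) (use P in auto)
  then have "length (xs @ [cur]) \<le> 3 * n" using distinct_card[OF P(1)] by simp
  then show "k < 3 * n" using kx by simp
  show "s ''rem'' e = 0" using rem P by simp
  assume s': "s' ''su'' = (s ''su'')(cur := z)" "s' ''pr'' = (s ''pr'')(z := cur)" "s' ''ei'' = (s ''ei'')(cur := e)"
      "s' ''rem'' = (s ''rem'')(e := 1)" "s' ''k'' 0 = Suc k"
      "s' ''f1'' 0 = (if k = 0 then cur else s ''f1'' 0)" "s' ''f2'' 0 = (if k = 1 then cur else s ''f2'' 0)"
      "s' ''rot'' = (if k = 2 then (s ''rot'')(s ''f1'' 0 := s ''f2'' 0, s ''f2'' 0 := cur, cur := s ''f1'' 0) else s ''rot'')"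
      "s' ''real'' = (if k = 2 then (s ''real'')(s ''f1'' 0 := 1, s ''f2'' 0 := 1, cur := 1) else s ''real'')"
      "s' ''cur'' 0 = z" "s' ''e2'' 0 = e'"
  let ?ys = "xs @ [cur]"
  have RB: "R \<subseteq> B" using C(1) unfolding cyc_cert_def by blast
  have disR: "x \<notin> R" if "x \<in> set ?ys" for x using that P(2) RB by auto
  have im: "s' ''ei'' ` (B \<union> set ?ys) = insert e (s ''ei'' ` (B \<union> set xs))" unfolding s'(3) by (rule PS(8))
  have rem': "s' ''rem'' i = (if i < m \<and> (i \<notin> al \<or> i \<in> s' ''ei'' ` (B \<union> set ?ys)) then 1 else 0)" for i
    unfolding im using rem em by (simp add: s'(4))
  have ys0: "?ys ! 0 = (if k = 0 then cur else xs ! 0)" "1 \<le> k \<Longrightarrow> ?ys ! 1 = (if k = 1 then cur else xs ! 1)"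
    "2 \<le> k \<Longrightarrow> ?ys ! 2 = (if k = 2 then cur else xs ! 2)"
    using kx by (auto simp: nth_append)
  have f': "s' ''f1'' 0 = ?ys ! 0" using s'(6) ys0(1) f(1) kx by (cases "k = 0") simp_all
  have f2': "s' ''f2'' 0 = ?ys ! 1" if "1 \<le> k"
  proof (cases "k = 1")
    case True then show ?thesis using s'(7) ys0(2) by simp
  next
    case False
    then have "2 \<le> length xs" using that kx by linarith
    then show ?thesis using s'(7) ys0(2)[OF that] f(2) False by simp
  qed
  have k2: "k = 2 \<Longrightarrow> s ''f1'' 0 = ?ys ! 0 \<and> s ''f2'' 0 = ?ys ! 1 \<and> cur = ?ys ! 2"
    using ys0 f kx by (auto simp: nth_append)
  have dist: "?ys ! 0 \<noteq> ?ys ! 1" "?ys ! 0 \<noteq> ?ys ! 2" "?ys ! 1 \<noteq> ?ys ! 2" if "2 \<le> k"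
  proof -
    have "0 < length ?ys" "1 < length ?ys" "2 < length ?ys" using kx that by auto
    then show "?ys ! 0 \<noteq> ?ys ! 1" "?ys ! 0 \<noteq> ?ys ! 2" "?ys ! 1 \<noteq> ?ys ! 2"
      using nth_eq_iff_index_eq[OF P(1)] by fastforce+
  qed
  have mem: "?ys ! 0 \<in> set ?ys" "?ys ! 1 \<in> set ?ys" "?ys ! 2 \<in> set ?ys" if "2 \<le> k"
    using kx that by (auto intro!: nth_mem simp del: set_append)
  have rot': "s' ''rot'' (?ys ! 0) = ?ys ! 1 \<and> s' ''rot'' (?ys ! 1) = ?ys ! 2 \<and> s' ''rot'' (?ys ! 2) = ?ys ! 0"
    if "2 \<le> k"
  proof (cases "k = 2")
    case True
    then show ?thesis using k2[OF True] dist unfolding s'(8) by simp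
  next
    case False
    then have len: "3 \<le> length xs" using that kx by linarith
    then have "k \<noteq> 0" "k \<noteq> 1" "1 \<le> k" using kx by linarith+
    then show ?thesis using rot ys0 len that False unfolding s'(8) by simp
  qed
  have rotR: "s' ''rot'' x = s ''rot'' x" if "x \<in> R" for x
  proof (cases "k = 2")
    case True
    then have "x \<noteq> ?ys ! 0" "x \<noteq> ?ys ! 1" "x \<noteq> ?ys ! 2" using mem disR that by auto
    then show ?thesis using k2[OF True] unfolding s'(8) by simp
  qed (simp add: s'(8))
  have real': "s' ''real'' x = (if x \<in> R \<union> head_three ?ys then 1 else 0)" for x
  proof -
    consider "k < 2" | "k = 2" | "2 < k" by linarith
    then show ?thesis
    proof cases
      case 1
      then show ?thesis using real kx unfolding s'(9) by (simp add: head_three_def)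
    next
      case 2
      then show ?thesis using real kx k2[OF 2] unfolding s'(9) by (simp add: head_three_def)
    next
      case 3
      then have "k \<noteq> 0" "k \<noteq> 1" "1 \<le> k" "2 \<le> k" "3 \<le> length xs" "k \<noteq> 2" using kx by linarith+
      then show ?thesis using real ys0 unfolding s'(9) by (simp add: head_three_def)
    qed
  qed
  have cert': "cyc_cert al B (s' ''su'') (s' ''pr'') (s' ''ei'') cy R (s' ''rot'')"
    unfolding s'(1-3) by (rule cyc_cert_rot_cong[OF PS(6) rotR])
  show "if s' ''rem'' e' = 1 then resting al s' else walking al s'"
  proof (cases "s' ''rem'' e' = 1")
    case False
    have "e' \<in> al - s' ''ei'' ` (B \<union> set ?ys)"
    proof (rule ccontr)
      assume "e' \<notin> al - s' ''ei'' ` (B \<union> set ?ys)"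
      then have "e' < m \<and> (e' \<notin> al \<or> e' \<in> s' ''ei'' ` (B \<union> set ?ys))" using PS(2) by blast
      from rem'[of e', unfolded if_P[OF this]] False show False by contradiction
    qed
    then have "path_cert al B (s' ''su'') (s' ''pr'') (s' ''ei'') ?ys z e'" unfolding s'(1-3) by (rule PS(3))
    then have "walking al s'" unfolding walking_def
      using cert' rem' real' s'(5,10,11) f' f2' rot' kx
      by (intro exI[of _ B] exI[of _ cy] exI[of _ R] exI[of _ ?ys]) simp
    then show ?thesis using False by simp
  next
    case True
    have A: "e' \<notin> al - s' ''ei'' ` (B \<union> set ?ys)"
    proof
      assume "e' \<in> al - s' ''ei'' ` (B \<union> set ?ys)"
      then have "\<not> (e' < m \<and> (e' \<notin> al \<or> e' \<in> s' ''ei'' ` (B \<union> set ?ys)))" by blast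
      from rem'[of e', unfolded if_not_P[OF this]] True show False by simp
    qed
    then have len: "2 \<le> length xs" unfolding s'(3) by (rule PS(4))
    then have k: "2 \<le> k" using kx by simp
    obtain cy' where cy': "cyc_cert al (B \<union> set ?ys) (s' ''su'') (s' ''pr'') (s' ''ei'') cy'
        (R \<union> {?ys ! 0, ?ys ! 1, ?ys ! 2}) (s' ''rot'')"
      using PS(5)[OF A[unfolded s'(3)], of "s' ''rot''"] rot'[OF k] rotR unfolding s'(1-3) by blast
    moreover have "head_three ?ys = {?ys ! 0, ?ys ! 1, ?ys ! 2}" using len by (simp add: head_three_def)
    ultimately have "resting al s'" unfolding resting_def
      using rem' real' by (intro exI[of _ "B \<union> set ?ys"] exI[of _ cy'] exI[of _ "R \<union> {?ys ! 0, ?ys ! 1, ?ys ! 2}"]) simp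
    then show ?thesis using True by simp
  qed
qed

lemma wp_record_head:
  assumes "1 \<le> W" "bounded W s"
  shows "wp W record_head (\<lambda>s'. agree {''f1'', ''f2'', ''rot'', ''real''} s' s \<and>
    s' ''f1'' 0 = (if s ''k'' 0 = 0 then s ''cur'' 0 else s ''f1'' 0) \<and>
    s' ''f2'' 0 = (if s ''k'' 0 = 1 then s ''cur'' 0 else s ''f2'' 0) \<and>
    s' ''rot'' = (if s ''k'' 0 = 2 then (s ''rot'')(s ''f1'' 0 := s ''f2'' 0, s ''f2'' 0 := s ''cur'' 0, s ''cur'' 0 := s ''f1'' 0) else s ''rot'') \<and>
    s' ''real'' = (if s ''k'' 0 = 2 then (s ''real'')(s ''f1'' 0 := 1, s ''f2'' 0 := 1, s ''cur'' 0 := 1) else s ''real'')) s"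
  using assms unfolding record_head_def by (simp add: bounded_def agree_upd agree_refl)

lemma walk_correct:
  assumes ab: "basic_ab s0" and z0: "\<And>i. s0 ''i2'' i = 0" "\<And>i. s0 ''md2'' i = 0" "\<And>i. s0 ''real'' i = 0"
    and al: "al \<subseteq> {..<m}" and cn: "counts al (s0 ''deg'') (s0 ''S'')"
    and rem: "\<forall>i. s0 ''rem'' i = (if i < m \<and> i \<notin> al then 1 else 0)"
    and no1: "\<forall>x < 3 * n. s0 ''deg'' x \<noteq> 1"
    and W: "10 * n + 10 * m + 10 \<le> W" and bd: "bounded W s0"
  shows "runs W (While (Less (sc ''i2'') (sc ''m'')) walk_body) s0 (1 + (3 * m + 1) * (1 + cost walk_body))
    (\<lambda>s. agree {''i2'', ''md2'', ''cur'', ''e2'', ''k'', ''z2'', ''su'', ''pr'', ''ei'', ''rem'', ''f1'', ''f2'', ''rot'', ''real''} s s0 \<and>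
      (\<exists>cy R. cyc_cert al {x. s ''deg'' x = 2} (s ''su'') (s ''pr'') (s ''ei'') cy R (s ''rot'') \<and>
        (\<forall>x. s ''real'' x = (if x \<in> R then 1 else 0)) \<and> al \<subseteq> s ''ei'' ` {x. s ''deg'' x = 2}))"
proof -
  let ?X = "{''i2'', ''md2'', ''cur'', ''e2'', ''k'', ''z2'', ''su'', ''pr'', ''ei'', ''rem'', ''f1'', ''f2'', ''rot'', ''real''}"
  have d2: "s0 ''deg'' x = 0 \<or> s0 ''deg'' x = 2" for x
  proof (cases "x < 3 * n")
    case True then show ?thesis using degree_two[OF cn al True _ no1] by blast
  next
    case False
    then have "incident al x = {}" using incident_less al by (auto simp: incident_def)
    then show ?thesis using cn by (simp add: counts_def)
  qed
  define I where "I s \<longleftrightarrow> agree ?X s s0 \<and> s ''i2'' 0 \<le> m \<and> (\<forall>i<s ''i2'' 0. s ''rem'' i = 1) \<and>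
    (if s ''md2'' 0 = 0 then resting al s else s ''i2'' 0 < m \<and> walking al s)" for s
  \<comment> \<open>Each step of a walk marks an edge, worth 2, which pays for a return to mode 0,
    worth 1. The start value is at most \<open>3 * m + 1\<close>.\<close>
  define \<phi> where "\<phi> s = 2 * card {i. i < m \<and> s ''rem'' i = 0} + (m - s ''i2'' 0) + (if s ''md2'' 0 = 0 then 1 else 0)"
    for s :: store
  have "runs W (While (Less (sc ''i2'') (sc ''m'')) walk_body) s0 (1 + \<phi> s0 * (1 + cost walk_body))
     (\<lambda>s. I s \<and> \<not> bval (Less (sc ''i2'') (sc ''m'')) s)"
  proof (rule runs_While[OF _ bd])
    have "resting al s0" unfolding resting_def
      using rem z0 by (intro exI[of _ "{}"] exI[of _ id] exI[of _ "{}"]) (simp add: cyc_cert_def)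
    then show "I s0" using z0 by (simp add: I_def agree_refl)
    fix s assume s: "I s" "bval (Less (sc ''i2'') (sc ''m'')) s" "bounded W s"
    then have ag: "agree ?X s s0" by (simp add: I_def)
    have V: "s ''N'' 0 = 3 * n" "s ''m'' 0 = m" "\<And>i. i < m \<Longrightarrow> s ''a'' i = a i" "\<And>i. i < m \<Longrightarrow> s ''b'' i = b i"
      using ab by (auto simp: basic_ab_def basic_def agreeD[OF ag])
    have i2: "s ''i2'' 0 < m" using s(2) V by simp
    have cn': "counts al (s ''deg'') (s ''S'')" and d2': "\<And>x. s ''deg'' x = 0 \<or> s ''deg'' x = 2"
      using cn d2 by (simp_all add: agreeD[OF ag])
    have bW: "s x i \<le> W" for x i using s(3) by (simp add: bounded_def)
    have Sm: "s ''S'' x < m" for x using cn' i2 by (simp add: counts_def)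
    have S2: "s ''S'' x + m - e \<le> W" "s ''S'' x - e \<le> W" for x e using Sm[of x] W by linarith+
    define I' where "I' s' \<longleftrightarrow> I s' \<and> \<phi> s' < \<phi> s" for s'
    show "wp W walk_body (\<lambda>s'. I s' \<and> \<phi> s' < \<phi> s) s"
    proof (cases "s ''md2'' 0 = 0")
      case md: True
      then have rs: "resting al s" using s(1) by (simp add: I_def)
      show ?thesis
      proof (cases "s ''rem'' (s ''i2'' 0) = 1")
        case True
        have fin: "I' s'" if t: "agree ?X s' s" "s' ''i2'' = (s ''i2'')(0 := Suc (s ''i2'' 0))" "s' ''md2'' = s ''md2''"
          "s' ''su'' = s ''su''" "s' ''pr'' = s ''pr''" "s' ''ei'' = s ''ei''" "s' ''rot'' = s ''rot''"
          "s' ''rem'' = s ''rem''" "s' ''real'' = s ''real''" for s'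
        proof -
          have "resting al s'" using resting_cong[OF rs t(4-9)] .
          moreover have "\<phi> s' < \<phi> s" using i2 unfolding \<phi>_def t(2,3,8) by simp
          moreover have "agree ?X s' s0" using t(1) ag by (simp add: agree_def)
          ultimately show ?thesis using s(1) i2 True md unfolding I'_def I_def t(2,3,8) by (simp add: less_Suc_eq)
        qed
        have "Suc (s ''i2'' 0) \<le> W" using i2 W by linarith
        then show ?thesis unfolding I'_def[symmetric] walk_body_def
          using md True by simp (auto intro!: fin agree_upd agree_refl)
      next
        case False
        have fin: "I' s'" if t: "agree ?X s' s" "s' ''i2'' = s ''i2''" "s' ''md2'' = (s ''md2'')(0 := 1)"
          "s' ''su'' = s ''su''" "s' ''pr'' = s ''pr''" "s' ''ei'' = s ''ei''" "s' ''rot'' = s ''rot''"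
          "s' ''rem'' = s ''rem''" "s' ''real'' = s ''real''" "s' ''k'' 0 = 0" "s' ''e2'' 0 = s ''i2'' 0"
          "s' ''cur'' 0 = a (s ''i2'' 0)" for s'
        proof -
          have "walking al s'" using walking_start[OF rs i2 False t(4-12)] .
          moreover have "\<phi> s' < \<phi> s" using md unfolding \<phi>_def t(2,3,8) by simp
          moreover have "agree ?X s' s0" using t(1) ag by (simp add: agree_def)
          ultimately show ?thesis using s(1) i2 unfolding I'_def I_def t(2,3,8) by simp
        qed
        have "1 \<le> W" "a (s ''i2'' 0) \<le> W" using W a_less[OF i2] by linarith+
        then show ?thesis unfolding I'_def[symmetric] walk_body_def
          using md False bW i2 by (simp add: V) (auto intro!: fin agree_upd agree_refl)
      qed
    next
      case md: False
      then have wk: "walking al s" using s(1) by (simp add: I_def)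
      let ?cur = "s ''cur'' 0" and ?e = "s ''e2'' 0" and ?k = "s ''k'' 0"
      let ?z = "a ?e + b ?e - ?cur"
      let ?e' = "if s ''S'' ?z < ?e then s ''S'' ?z + m - ?e else s ''S'' ?z - ?e"
      note WS = walking_step[OF wk cn' al d2']
      have fin: "I' s'" if t: "agree ?X s' s" "s' ''i2'' = s ''i2''"
        "s' ''su'' = (s ''su'')(?cur := ?z)" "s' ''pr'' = (s ''pr'')(?z := ?cur)" "s' ''ei'' = (s ''ei'')(?cur := ?e)"
        "s' ''rem'' = (s ''rem'')(?e := 1)" "s' ''k'' 0 = Suc ?k"
        "s' ''f1'' 0 = (if ?k = 0 then ?cur else s ''f1'' 0)" "s' ''f2'' 0 = (if ?k = 1 then ?cur else s ''f2'' 0)"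
        "s' ''rot'' = (if ?k = 2 then (s ''rot'')(s ''f1'' 0 := s ''f2'' 0, s ''f2'' 0 := ?cur, ?cur := s ''f1'' 0) else s ''rot'')"
        "s' ''real'' = (if ?k = 2 then (s ''real'')(s ''f1'' 0 := 1, s ''f2'' 0 := 1, ?cur := 1) else s ''real'')"
        "s' ''cur'' 0 = ?z" "s' ''e2'' 0 = ?e'"
        "s' ''md2'' 0 = (if ((s ''rem'')(?e := 1)) ?e' = 1 then 0 else s ''md2'' 0)" for s'
      proof -
        have "if s' ''rem'' ?e' = 1 then resting al s' else walking al s'" using WS(5)[OF t(3-13)] .
        then have "if s' ''md2'' 0 = 0 then resting al s' else walking al s'"
          using t(14) md unfolding t(6) by (simp split: if_splits)
        moreover have "\<phi> s' < \<phi> s"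
        proof -
          have eq: "{i. i < m \<and> s' ''rem'' i = 0} = {i. i < m \<and> s ''rem'' i = 0} - {?e}" using t(6) by auto
          have "?e \<in> {i. i < m \<and> s ''rem'' i = 0}" using WS(1,4) by simp
          from card_Diff1_less[OF _ this]
          have "card {i. i < m \<and> s' ''rem'' i = 0} < card {i. i < m \<and> s ''rem'' i = 0}"
            unfolding eq by simp
          then show ?thesis unfolding \<phi>_def t(2) by simp
        qed
        moreover have "agree ?X s' s0" using t(1) ag by (simp add: agree_def)
        moreover have "\<forall>i<s' ''i2'' 0. s' ''rem'' i = 1" using s(1) unfolding I_def t(2,6) by simp
        ultimately show ?thesis using i2 unfolding I'_def I_def t(2) by simp
      qed
      have Wz: "?z \<le> W" "1 \<le> W" "Suc ?k \<le> W" using WS(2,3) W by linarith+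
      obtain z where z: "z = ?z" by simp
      obtain e' where e': "e' = (if s ''S'' z < ?e then s ''S'' z + m - ?e else s ''S'' z - ?e)" by simp
      note fin' = fin[folded z, folded e']
      note Wz' = Wz[folded z]
      define s1 where "s1 = s(''z2'' := (s ''z2'')(0 := z), ''su'' := (s ''su'')(?cur := z), ''pr'' := (s ''pr'')(z := ?cur),
        ''ei'' := (s ''ei'')(?cur := ?e), ''rem'' := (s ''rem'')(?e := 1))"
      have 1: "wp W walk_edge (\<lambda>t. t = s1) s"
        using WS(1) Wz' bW by (simp add: walk_edge_def V s1_def z[symmetric])
      have "bounded W s1" using bW Wz' by (simp add: s1_def bounded_def)
      note 2 = wp_record_head[OF Wz(2) this]
      have 3: "wp W (next_edge_com ;; walk_advance) I' t" if t: "agree {''f1'', ''f2'', ''rot'', ''real''} t s1 \<and>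
        t ''f1'' 0 = (if s1 ''k'' 0 = 0 then s1 ''cur'' 0 else s1 ''f1'' 0) \<and>
        t ''f2'' 0 = (if s1 ''k'' 0 = 1 then s1 ''cur'' 0 else s1 ''f2'' 0) \<and>
        t ''rot'' = (if s1 ''k'' 0 = 2 then (s1 ''rot'')(s1 ''f1'' 0 := s1 ''f2'' 0, s1 ''f2'' 0 := s1 ''cur'' 0, s1 ''cur'' 0 := s1 ''f1'' 0) else s1 ''rot'') \<and>
        t ''real'' = (if s1 ''k'' 0 = 2 then (s1 ''real'')(s1 ''f1'' 0 := 1, s1 ''f2'' 0 := 1, s1 ''cur'' 0 := 1) else s1 ''real'')" for t
      proof -
        have agt: "agree {''f1'', ''f2'', ''rot'', ''real''} t s1" using t by blast
        have E: "t ''k'' = s ''k''" "t ''S'' = s ''S''" "t ''z2'' 0 = z" "t ''e2'' = s ''e2''" "t ''m'' = s ''m''"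
          "t ''rem'' = (s ''rem'')(?e := 1)" "t ''md2'' = s ''md2''" "t ''cur'' = s ''cur''" "t ''i2'' = s ''i2''"
          "t ''su'' = (s ''su'')(?cur := z)" "t ''pr'' = (s ''pr'')(z := ?cur)" "t ''ei'' = (s ''ei'')(?cur := ?e)"
          by (simp_all add: agreeD[OF agt] s1_def)
        have F: "t ''f1'' 0 = (if ?k = 0 then ?cur else s ''f1'' 0)" "t ''f2'' 0 = (if ?k = 1 then ?cur else s ''f2'' 0)"
          "t ''rot'' = (if ?k = 2 then (s ''rot'')(s ''f1'' 0 := s ''f2'' 0, s ''f2'' 0 := ?cur, ?cur := s ''f1'' 0) else s ''rot'')"
          "t ''real'' = (if ?k = 2 then (s ''real'')(s ''f1'' 0 := 1, s ''f2'' 0 := 1, ?cur := 1) else s ''real'')"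
          using t by (simp_all add: s1_def)
        have G: "agree ?X t s" using agt by (simp add: agree_def s1_def)
        have fin2: "I' t'" if T: "agree {''k'', ''e2'', ''cur'', ''md2''} t' t" "t' ''k'' 0 = Suc ?k" "t' ''cur'' 0 = z"
          "t' ''e2'' 0 = e'" "t' ''md2'' 0 = (if ((s ''rem'')(?e := 1)) e' = 1 then 0 else s ''md2'' 0)" for t'
        proof (rule fin')
          show "agree ?X t' s" using T(1) G by (simp add: agree_def)
          show "t' ''k'' 0 = Suc ?k" "t' ''cur'' 0 = z" "t' ''e2'' 0 = e'"
            "t' ''md2'' 0 = (if ((s ''rem'')(?e := 1)) e' = 1 then 0 else s ''md2'' 0)" by (fact T)+
          have A: "t' ''f1'' = t ''f1''" "t' ''f2'' = t ''f2''" "t' ''rot'' = t ''rot''" "t' ''real'' = t ''real''"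
            by (simp_all add: agreeD[OF T(1)])
          show "t' ''f1'' 0 = (if ?k = 0 then ?cur else s ''f1'' 0)" "t' ''f2'' 0 = (if ?k = 1 then ?cur else s ''f2'' 0)"
            "t' ''rot'' = (if ?k = 2 then (s ''rot'')(s ''f1'' 0 := s ''f2'' 0, s ''f2'' 0 := ?cur, ?cur := s ''f1'' 0) else s ''rot'')"
            "t' ''real'' = (if ?k = 2 then (s ''real'')(s ''f1'' 0 := 1, s ''f2'' 0 := 1, ?cur := 1) else s ''real'')"
            unfolding A by (fact F)+
        qed (simp_all add: agreeD[OF T(1)] E)
        have 4: "wp W next_edge_com (\<lambda>t'. t' = t(''e2'' := (t ''e2'')(0 := e'))) t"
          unfolding next_edge_com_def using S2[of z ?e] by (simp add: E V e')
        have "wp W walk_advance I' (t(''e2'' := (t ''e2'')(0 := e')))"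
          unfolding walk_advance_def using Wz' by (simp add: E) (intro conjI impI fin2; simp add: E agree_upd agree_refl)
        then have "wp W next_edge_com (wp W walk_advance I') t"
          by (intro wp_mono[OF 4]) simp
        then show ?thesis by simp
      qed
      have "wp W record_head (wp W (next_edge_com ;; walk_advance) I') s1" using 2 3 by (rule wp_mono)
      then have "wp W walk_edge (wp W record_head (wp W (next_edge_com ;; walk_advance) I')) s"
        by (intro wp_mono[OF 1]) simp
      then show ?thesis unfolding I'_def[symmetric] walk_body_def using md by (simp add: wp_Seq_fun)
    qed
  qed
  then show ?thesis
  proof (rule runs_mono)
    have "card {i. i < m \<and> s0 ''rem'' i = 0} \<le> card {..<m}" by (rule card_mono) auto
    then have "\<phi> s0 \<le> 3 * m + 1" unfolding \<phi>_def using z0 by simp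
    then show "1 + \<phi> s0 * (1 + cost walk_body) \<le> 1 + (3 * m + 1) * (1 + cost walk_body)"
      by (meson add_left_mono mult_right_mono le0)
    fix s assume s: "I s \<and> \<not> bval (Less (sc ''i2'') (sc ''m'')) s"
    then have ag: "agree ?X s s0" by (simp add: I_def)
    have "s ''m'' 0 = m" using ab by (auto simp: basic_ab_def basic_def agreeD[OF ag])
    then have i2: "s ''i2'' 0 = m" using s by (simp add: I_def)
    then have "resting al s" using s by (auto simp: I_def split: if_splits)
    then obtain B cy R where C: "cyc_cert al B (s ''su'') (s ''pr'') (s ''ei'') cy R (s ''rot'')"
      "\<forall>i. s ''rem'' i = (if i < m \<and> (i \<notin> al \<or> i \<in> s ''ei'' ` B) then 1 else 0)"
      "\<forall>x. s ''real'' x = (if x \<in> R then 1 else 0)"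
      unfolding resting_def by blast
    have alB: "al \<subseteq> s ''ei'' ` B"
    proof
      fix i assume "i \<in> al"
      then have "i < m" "s ''rem'' i = 1" using al s i2 by (auto simp: I_def)
      then show "i \<in> s ''ei'' ` B" using C(2) \<open>i \<in> al\<close> by (auto split: if_splits)
    qed
    have CB: "\<And>x. x \<in> B \<Longrightarrow> s ''su'' x \<in> B \<and> s ''ei'' x \<in> al \<and> sedge (s ''ei'' x) = {x, s ''su'' x}"
      using C(1) unfolding cyc_cert_def by blast
    have cn': "counts al (s ''deg'') (s ''S'')" and d2': "\<And>x. s ''deg'' x = 0 \<or> s ''deg'' x = 2"
      using cn d2 by (simp_all add: agreeD[OF ag])
    \<comment> \<open>A slot of degree 2 has a surviving edge, and every surviving edge has been
      traversed. So \<open>deg\<close> tells the later phases which slots lie on cycles.\<close>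
    have "B = {x. s ''deg'' x = 2}"
    proof (intro set_eqI iffI)
      fix x assume "x \<in> B"
      then have "s ''ei'' x \<in> incident al x" using CB[of x] by (auto simp: incident_def)
      then have "s ''deg'' x \<noteq> 0" using cn' finite_incident[OF al, of x] by (auto simp: counts_def)
      then show "x \<in> {x. s ''deg'' x = 2}" using d2'[of x] by simp
    next
      fix x assume "x \<in> {x. s ''deg'' x = 2}"
      then have "incident al x \<noteq> {}" using cn' by (auto simp: counts_def)
      then obtain i where "i \<in> al" "x \<in> sedge i" by (auto simp: incident_def)
      then obtain y where "y \<in> B" "i = s ''ei'' y" using alB by auto
      then show "x \<in> B" using CB[of y] \<open>x \<in> sedge i\<close> by auto
    qed
    then show "agree ?X s s0 \<and> (\<exists>cy R. cyc_cert al {x. s ''deg'' x = 2} (s ''su'') (s ''pr'') (s ''ei'') cy R (s ''rot'') \<and>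
        (\<forall>x. s ''real'' x = (if x \<in> R then 1 else 0)) \<and> al \<subseteq> s ''ei'' ` {x. s ''deg'' x = 2})"
      using ag C alB by blast
  qed
qed

end

section \<open>Matching cycles to vertices\<close>

text \<open>\<open>D\<close> consists of the completed triples; \<open>g\<close> counts the slots
  \<open>d1\<close>, \<open>d2\<close> that still wait for company.\<close>

definition grouped where
  "grouped rot U g d1 d2 \<longleftrightarrow> (\<exists>D. 3 dvd card D \<and>
    (g = 0 \<and> U = D \<or> g = 1 \<and> U = insert d1 D \<and> d1 \<notin> D \<or>
     g = (2::nat) \<and> U = insert d1 (insert d2 D) \<and> d1 \<notin> D \<and> d2 \<notin> D \<and> d1 \<noteq> d2) \<and>
    (\<forall>x\<in>D. rot x \<in> D \<and> rot x \<noteq> x \<and> rot (rot x) \<noteq> x \<and> rot (rot (rot x)) = (x::nat)))"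

lemma grouped_step:
  assumes "grouped rot U g d1 d2" "x \<notin> U" "finite U"
  shows "grouped (if g = 0 \<or> g = 1 then rot else rot(d1 := d2, d2 := x, x := d1)) (insert x U)
    (if g = 0 then 1 else if g = 1 then 2 else 0) (if g = 0 then x else d1) (if g = 1 then x else d2)"
proof -
  obtain D where D: "3 dvd card D"
    "g = 0 \<and> U = D \<or> g = 1 \<and> U = insert d1 D \<and> d1 \<notin> D \<or>
     g = (2::nat) \<and> U = insert d1 (insert d2 D) \<and> d1 \<notin> D \<and> d2 \<notin> D \<and> d1 \<noteq> d2"
    "\<forall>x\<in>D. rot x \<in> D \<and> rot x \<noteq> x \<and> rot (rot x) \<noteq> x \<and> rot (rot (rot x)) = (x::nat)"
    using assms(1) unfolding grouped_def by blast
  from D(2) consider "g = 0" "U = D" | "g = 1" "U = insert d1 D" "d1 \<notin> D"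
    | "g = 2" "U = insert d1 (insert d2 D)" "d1 \<notin> D" "d2 \<notin> D" "d1 \<noteq> d2" by blast
  then show ?thesis
  proof cases
    case 1
    then show ?thesis unfolding grouped_def using D(1,3) assms(2) by (intro exI[of _ D]) simp
  next
    case 2
    then show ?thesis unfolding grouped_def using D(1,3) assms(2) by (intro exI[of _ D]) auto
  next
    case 3
    let ?rot = "rot(d1 := d2, d2 := x, x := d1)"
    have x: "x \<notin> D" "x \<noteq> d1" "x \<noteq> d2" using assms(2) 3 by auto
    have "finite D" using assms(3) 3(2) by simp
    then have "card (insert x U) = card D + 3" using 3 x by simp
    then have "3 dvd card (insert x U)" using D(1) by simp
    moreover have "\<forall>y\<in>insert x U. ?rot y \<in> insert x U \<and> ?rot y \<noteq> y \<and> ?rot (?rot y) \<noteq> y \<and> ?rot (?rot (?rot y)) = y"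
    proof
      fix y assume "y \<in> insert x U"
      then consider "y \<in> D" | "y = d1" | "y = d2" | "y = x" using 3(2) by auto
      then show "?rot y \<in> insert x U \<and> ?rot y \<noteq> y \<and> ?rot (?rot y) \<noteq> y \<and> ?rot (?rot (?rot y)) = y"
      proof cases
        case 1
        have "rot y \<in> D" "rot (rot y) \<in> D" using D(3) 1 by auto
        then have "?rot y = rot y" "?rot (rot y) = rot (rot y)" "?rot (rot (rot y)) = rot (rot (rot y))"
          using 1 3(3,4) x by auto
        then show ?thesis using D(3) 1 3(2) by auto
      qed (use x 3(2,5) in auto)
    qed
    ultimately have "grouped ?rot (insert x U) 0 d1 d2"
      unfolding grouped_def by (intro exI[of _ "insert x U"] conjI disjI1 refl)
    then show ?thesis using 3(1) by simp
  qed
qed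

context pseudo_graph
begin

text \<open>Both \<open>3 * n\<close> and \<open>card R\<close> are multiples of 3, so no slot is
  left waiting at the end.\<close>

lemma group_correct:
  assumes bs: "basic s0" and z0: "\<And>i. s0 ''x3'' i = 0" "\<And>i. s0 ''g'' i = 0" "\<And>i. s0 ''par'' i = 0"
    and real: "\<forall>x. s0 ''real'' x = (if x \<in> R then 1 else 0)" and R: "R \<subseteq> {..<3 * n}" "3 dvd card R"
    and W: "10 * n + 10 * m + 10 \<le> W" and bd: "bounded W s0"
  shows "runs W (While (Less (sc ''x3'') (sc ''N'')) group_body) s0 (1 + 3 * n * (1 + cost group_body))
    (\<lambda>s. agree {''x3'', ''g'', ''d1'', ''d2'', ''rot'', ''w'', ''vr'', ''par''} s s0 \<and>
      (\<forall>x\<in>R. s ''rot'' x = s0 ''rot'' x) \<and>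
      (\<forall>x\<in>{..<3 * n} - R. s ''rot'' x \<in> {..<3 * n} - R \<and> s ''rot'' x \<noteq> x \<and> s ''rot'' (s ''rot'' x) \<noteq> x \<and>
        s ''rot'' (s ''rot'' (s ''rot'' x)) = x) \<and>
      (\<forall>x < 3 * n. s ''w'' x = 1 \<and> s ''vr'' x = vr x) \<and> (\<forall>j \<le> 3 * n. s ''par'' j = j mod 2))"
proof -
  let ?X = "{''x3'', ''g'', ''d1'', ''d2'', ''rot'', ''w'', ''vr'', ''par''}"
  let ?U = "\<lambda>k. {..<k} - R"
  define I where "I s \<longleftrightarrow> agree ?X s s0 \<and> s ''x3'' 0 \<le> 3 * n \<and>
    grouped (s ''rot'') (?U (s ''x3'' 0)) (s ''g'' 0) (s ''d1'' 0) (s ''d2'' 0) \<and> s ''g'' 0 < 3 \<and>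
    (\<forall>x\<in>R. s ''rot'' x = s0 ''rot'' x) \<and>
    (\<forall>x<s ''x3'' 0. s ''w'' x = 1 \<and> s ''vr'' x = vr x) \<and> (\<forall>j\<le>s ''x3'' 0. s ''par'' j = j mod 2)" for s
  let ?\<phi> = "\<lambda>s::store. 3 * n - s ''x3'' 0"
  have "runs W (While (Less (sc ''x3'') (sc ''N'')) group_body) s0 (1 + ?\<phi> s0 * (1 + cost group_body))
     (\<lambda>s. I s \<and> \<not> bval (Less (sc ''x3'') (sc ''N'')) s)"
  proof (rule runs_While[OF _ bd])
    show "I s0" using z0 by (simp add: I_def agree_refl grouped_def)
    fix s assume s: "I s" "bval (Less (sc ''x3'') (sc ''N'')) s" "bounded W s"
    then have ag: "agree ?X s s0" by (simp add: I_def)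
    have V: "s ''N'' 0 = 3 * n" "s ''n'' 0 = n" using bs by (auto simp: basic_def agreeD[OF ag])
    have rl: "s ''real'' x = (if x \<in> R then 1 else 0)" for x using real by (simp add: agreeD[OF ag])
    let ?x = "s ''x3'' 0" and ?g = "s ''g'' 0" and ?d1 = "s ''d1'' 0" and ?d2 = "s ''d2'' 0"
    have x: "?x < 3 * n" using s(2) V by simp
    have bW: "s x i \<le> W" for x i using s(3) by (simp add: bounded_def)
    define I' where "I' s' \<longleftrightarrow> I s' \<and> ?\<phi> s' < ?\<phi> s" for s'
    have gr: "grouped (s ''rot'') (?U ?x) ?g ?d1 ?d2" using s(1) by (simp add: I_def)
    have fin: "I' s'" if t: "agree ?X s' s" "s' ''x3'' 0 = Suc ?x" "s' ''w'' = (s ''w'')(?x := 1)"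
      "s' ''vr'' = (s ''vr'')(?x := vr ?x)" "s' ''par'' = (s ''par'')(Suc ?x := 1 - s ''par'' ?x)"
      "s' ''rot'' = (if ?x \<notin> R \<and> ?g \<noteq> 0 \<and> ?g \<noteq> 1 then (s ''rot'')(?d1 := ?d2, ?d2 := ?x, ?x := ?d1) else s ''rot'')"
      "s' ''g'' 0 = (if ?x \<in> R then ?g else if ?g = 0 then 1 else if ?g = 1 then 2 else 0)"
      "s' ''d1'' 0 = (if ?x \<notin> R \<and> ?g = 0 then ?x else ?d1)" "s' ''d2'' 0 = (if ?x \<notin> R \<and> ?g = 1 then ?x else ?d2)" for s'
    proof -
      have g3: "?g < 3" using s(1) by (simp add: I_def)
      have "grouped (s' ''rot'') (?U (Suc ?x)) (s' ''g'' 0) (s' ''d1'' 0) (s' ''d2'' 0)"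
      proof (cases "?x \<in> R")
        case True
        then have "?U (Suc ?x) = ?U ?x" by (auto simp: less_Suc_eq)
        then show ?thesis using gr True unfolding t(6-9) by simp
      next
        case False
        then have "?U (Suc ?x) = insert ?x (?U ?x)" by (auto simp: less_Suc_eq)
        then show ?thesis using grouped_step[OF gr, of ?x] False unfolding t(6-9) by (simp split: if_splits)
      qed
      moreover have "s' ''rot'' y = s0 ''rot'' y" if y: "y \<in> R" for y
      proof -
        have "y \<noteq> ?d1" "y \<noteq> ?d2" "y \<noteq> ?x" if "?x \<notin> R" "?g \<noteq> 0" "?g \<noteq> 1"
          using gr y that g3 unfolding grouped_def by auto
        then show ?thesis using s(1) y unfolding t(6) I_def by auto
      qed
      moreover have "(1 - s ''par'' ?x) = Suc ?x mod 2" using s(1) unfolding I_def by (simp add: mod_Suc)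
      moreover have "agree ?X s' s0" using t(1) ag by (simp add: agree_def)
      moreover have "3 * n - Suc ?x < 3 * n - ?x" using x by simp
      ultimately show ?thesis using s(1) x unfolding I'_def I_def t(2-5,7)
        by (simp add: less_Suc_eq le_Suc_eq)
    qed
    have Wx: "Suc ?x \<le> W" "?x + n \<le> W" "?x + n - 3 * n \<le> W" "2 \<le> W" "1 \<le> W" "Suc 0 - k \<le> W" for k using x W by linarith+
    have vW: "vr ?x \<le> W" using vr_less[OF x] W by linarith
    have vrx: "?x + n < 3 * n \<Longrightarrow> ?x + n = vr ?x" "\<not> ?x + n < 3 * n \<Longrightarrow> ?x + n - 3 * n = vr ?x"
      by (simp_all add: vr_def)
    show "wp W group_body (\<lambda>s'. I s' \<and> ?\<phi> s' < ?\<phi> s) s"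
      unfolding I'_def[symmetric] group_body_def
      using Wx vW bW vrx by (simp add: V rl) (intro conjI impI fin; simp add: agree_upd agree_refl)
  qed
  then show ?thesis
  proof (rule runs_mono)
    show "1 + ?\<phi> s0 * (1 + cost group_body) \<le> 1 + 3 * n * (1 + cost group_body)" using z0 by simp
    fix s assume s: "I s \<and> \<not> bval (Less (sc ''x3'') (sc ''N'')) s"
    then have ag: "agree ?X s s0" by (simp add: I_def)
    have "s ''N'' 0 = 3 * n" using bs by (auto simp: basic_def agreeD[OF ag])
    then have x: "s ''x3'' 0 = 3 * n" using s by (simp add: I_def)
    then obtain D where D: "3 dvd card D"
      "s ''g'' 0 = 0 \<and> ?U (3 * n) = D \<or> s ''g'' 0 = 1 \<and> ?U (3 * n) = insert (s ''d1'' 0) D \<and> s ''d1'' 0 \<notin> D \<or>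
       s ''g'' 0 = (2::nat) \<and> ?U (3 * n) = insert (s ''d1'' 0) (insert (s ''d2'' 0) D) \<and> s ''d1'' 0 \<notin> D \<and> s ''d2'' 0 \<notin> D \<and> s ''d1'' 0 \<noteq> s ''d2'' 0"
      "\<forall>x\<in>D. s ''rot'' x \<in> D \<and> s ''rot'' x \<noteq> x \<and> s ''rot'' (s ''rot'' x) \<noteq> x \<and> s ''rot'' (s ''rot'' (s ''rot'' x)) = x"
      using s unfolding I_def grouped_def by auto
    have "card (?U (3 * n)) = 3 * n - card R" using R(1) finite_subset by (subst card_Diff_subset) auto
    then have d3: "3 dvd card (?U (3 * n))" using R(2) by simp
    have "finite D" using D(2) by (metis finite_Diff finite_insert finite_lessThan)
    then have "?U (3 * n) = D \<or> card (?U (3 * n)) = card D + 1 \<or> card (?U (3 * n)) = card D + 2"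
      using D(2) by (elim disjE conjE) (simp_all only: card_insert_disjoint finite_insert insert_iff, simp_all)
    moreover have "\<not> 3 dvd card D + 1" "\<not> 3 dvd card D + 2" using D(1) by presburger+
    ultimately have "?U (3 * n) = D" using d3 by metis
    then show "agree ?X s s0 \<and> (\<forall>x\<in>R. s ''rot'' x = s0 ''rot'' x) \<and>
      (\<forall>x\<in>{..<3 * n} - R. s ''rot'' x \<in> {..<3 * n} - R \<and> s ''rot'' x \<noteq> x \<and> s ''rot'' (s ''rot'' x) \<noteq> x \<and>
        s ''rot'' (s ''rot'' (s ''rot'' x)) = x) \<and>
      (\<forall>x < 3 * n. s ''w'' x = 1 \<and> s ''vr'' x = vr x) \<and> (\<forall>j \<le> 3 * n. s ''par'' j = j mod 2)"
      using s D(3) x unfolding I_def by simp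
  qed
qed

end

section \<open>The stack that holds the alternating walk\<close>

definition parity_sum :: "nat \<Rightarrow> (nat \<Rightarrow> nat) \<Rightarrow> (nat \<Rightarrow> nat) \<Rightarrow> nat \<Rightarrow> nat" where
  "parity_sum r w st j = (\<Sum>k\<in>{k. k < j \<and> k mod 2 = r}. w (st k))"

lemma parity_sum_0: "parity_sum r w st 0 = 0" by (simp add: parity_sum_def)

lemma parity_sum_Suc: "parity_sum r w st (Suc j) = parity_sum r w st j + (if j mod 2 = r then w (st j) else 0)"
proof -
  have "{k. k < Suc j \<and> k mod 2 = r} = (if j mod 2 = r then insert j {k. k < j \<and> k mod 2 = r} else {k. k < j \<and> k mod 2 = r})"
    by (auto simp: less_Suc_eq)
  then show ?thesis by (simp add: parity_sum_def)
qed

lemma parity_sum_cong: "(\<And>k. k < j \<Longrightarrow> w (st k) = w' (st' k)) \<Longrightarrow> parity_sum r w st j = parity_sum r w' st' j"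
  unfolding parity_sum_def by (rule sum.cong) auto

text \<open>Fractional weights are at most 2; this keeps the prefix sums within the word
  bound.\<close>

lemma parity_sum_bound: "(\<And>k. k < j \<Longrightarrow> w (st k) \<le> 2) \<Longrightarrow> parity_sum r w st j \<le> 2 * j"
  by (induction j) (auto simp: parity_sum_0 parity_sum_Suc intro: add_le_mono le_trans)

text \<open>Two prefix sums give the weight of a segment in constant time, so choosing the direction
  of a shift costs no extra pass.\<close>

lemma parity_sum_diff:
  assumes "j \<le> p"
  shows "parity_sum r w st p - parity_sum r w st j = (\<Sum>k\<in>{k\<in>{j..<p}. k mod 2 = r}. w (st k))"
proof -
  have eq: "{k. k < p \<and> k mod 2 = r} = {k. k < j \<and> k mod 2 = r} \<union> {k\<in>{j..<p}. k mod 2 = r}" using assms by auto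
  have "(\<Sum>k\<in>{k. k < j \<and> k mod 2 = r} \<union> {k\<in>{j..<p}. k mod 2 = r}. w (st k)) =
      (\<Sum>k\<in>{k. k < j \<and> k mod 2 = r}. w (st k)) + (\<Sum>k\<in>{k\<in>{j..<p}. k mod 2 = r}. w (st k))"
    by (rule sum.union_disjoint) auto
  then have "parity_sum r w st p = parity_sum r w st j + (\<Sum>k\<in>{k\<in>{j..<p}. k mod 2 = r}. w (st k))"
    unfolding parity_sum_def eq .
  then show ?thesis by simp
qed

definition match_stack where
  "match_stack N f g w st p pos pe po \<longleftrightarrow> alternating N f g st p \<and> stacked N st p pos \<and>
    (\<forall>x\<ge>N. pos x = 0) \<and> (\<forall>j<p. frac w (st j)) \<and>
    (\<forall>j\<le>p. pe j = parity_sum 0 w st j \<and> po j = parity_sum 1 w st j)"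

lemma match_stack_push:
  assumes ms: "match_stack N f g w st p pos pe po" and z: "z < N" "frac w z" "pos z = 0"
    and adj: "0 < p \<Longrightarrow> z = ring_of f g (p - 1) (st (p - 1)) \<or> z = ring_of f g (p - 1) (ring_of f g (p - 1) (st (p - 1)))"
  shows "match_stack N f g w (st(p := z)) (Suc p) (pos(z := Suc p))
    (pe(Suc p := if p mod 2 = 0 then pe p + w z else pe p)) (po(Suc p := if p mod 2 = 0 then po p else po p + w z))"
proof -
  have A: "\<And>j. j < p \<Longrightarrow> st j < N" "inj_on st {..<p}"
    "\<And>j. Suc j < p \<Longrightarrow> st (Suc j) = ring_of f g j (st j) \<or> st (Suc j) = ring_of f g j (ring_of f g j (st j))"
    and S: "\<And>j. j < p \<Longrightarrow> pos (st j) = Suc j" "\<And>x. x < N \<Longrightarrow> pos x \<noteq> 0 \<Longrightarrow> pos x \<le> p \<and> st (pos x - 1) = x"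
    and P: "\<And>x. N \<le> x \<Longrightarrow> pos x = 0" "\<And>j. j < p \<Longrightarrow> frac w (st j)"
    "\<And>j. j \<le> p \<Longrightarrow> pe j = parity_sum 0 w st j \<and> po j = parity_sum 1 w st j"
    using ms unfolding match_stack_def alternating_def stacked_def by blast+
  have new: "st j \<noteq> z" if "j < p" for j using S(1)[OF that] z(3) by auto
  have ps: "parity_sum r w (st(p := z)) j = parity_sum r w st j" if "j \<le> p" for j r
    by (rule parity_sum_cong) (use that in auto)
  show ?thesis unfolding match_stack_def
  proof (intro conjI)
    show "alternating N f g (st(p := z)) (Suc p)"
      unfolding alternating_def
    proof (intro conjI allI impI)
      fix j assume "j < Suc p" then show "(st(p := z)) j < N" using A(1) z by (cases "j = p") auto
    next
      show "inj_on (st(p := z)) {..<Suc p}"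
      proof (rule inj_onI)
        fix a b assume "a \<in> {..<Suc p}" "b \<in> {..<Suc p}" "(st(p := z)) a = (st(p := z)) b"
        then show "a = b" using A(2) new[of a] new[of b] by (cases "a = p"; cases "b = p") (auto simp: inj_on_def)
      qed
    next
      fix j assume "Suc j < Suc p"
      then show "(st(p := z)) (Suc j) = ring_of f g j ((st(p := z)) j) \<or>
        (st(p := z)) (Suc j) = ring_of f g j (ring_of f g j ((st(p := z)) j))"
        using A(3)[of j] adj by (cases "Suc j = p") auto
    qed
    show "stacked N (st(p := z)) (Suc p) (pos(z := Suc p))"
      unfolding stacked_def
    proof (intro conjI allI impI)
      fix j assume "j < Suc p"
      then show "(pos(z := Suc p)) ((st(p := z)) j) = Suc j" using S(1) new by (cases "j = p") auto
    next
      fix x assume x: "x < N" "(pos(z := Suc p)) x \<noteq> 0"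
      show "(pos(z := Suc p)) x \<le> Suc p" using S(2)[of x] x by (auto split: if_splits)
      show "(st(p := z)) ((pos(z := Suc p)) x - 1) = x" using S(2)[of x] x by (auto split: if_splits)
    qed
    show "\<forall>x\<ge>N. (pos(z := Suc p)) x = 0" using P(1) z(1) by auto
    show "\<forall>j<Suc p. frac w ((st(p := z)) j)" using P(2) z by (auto simp: less_Suc_eq)
    show "\<forall>j\<le>Suc p. (pe(Suc p := if p mod 2 = 0 then pe p + w z else pe p)) j = parity_sum 0 w (st(p := z)) j \<and>
      (po(Suc p := if p mod 2 = 0 then po p else po p + w z)) j = parity_sum 1 w (st(p := z)) j"
    proof (intro allI impI)
      fix j assume j: "j \<le> Suc p"
      show "(pe(Suc p := if p mod 2 = 0 then pe p + w z else pe p)) j = parity_sum 0 w (st(p := z)) j \<and>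
        (po(Suc p := if p mod 2 = 0 then po p else po p + w z)) j = parity_sum 1 w (st(p := z)) j"
      proof (cases "j = Suc p")
        case True
        then show ?thesis using P(3)[of p] ps[of p] by (simp add: parity_sum_Suc)
      next
        case False
        then show ?thesis using P(3)[of j] ps[of j] j by simp
      qed
    qed
  qed
qed

text \<open>Popping a slot applies its share of the shift, so the weights expected at the end of the
  pops, given by \<open>shifted\<close>, stay the same throughout.\<close>

lemma match_stack_pop:
  assumes ms: "match_stack N f g w st (Suc p) pos pe po" and jj: "jj \<le> p"
    and w': "w' = w(st p := (if p mod 2 = fl then w (st p) + 1 else w (st p) - 1))" and pos': "pos' = pos(st p := 0)"
  shows "match_stack N f g w' st p pos' pe po" "shifted w' pos' jj fl = shifted w pos jj fl"
proof -
  have A: "\<And>j. j < Suc p \<Longrightarrow> st j < N" "inj_on st {..<Suc p}"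
    "\<And>j. Suc j < Suc p \<Longrightarrow> st (Suc j) = ring_of f g j (st j) \<or> st (Suc j) = ring_of f g j (ring_of f g j (st j))"
    and S: "\<And>j. j < Suc p \<Longrightarrow> pos (st j) = Suc j" "\<And>x. x < N \<Longrightarrow> pos x \<noteq> 0 \<Longrightarrow> pos x \<le> Suc p \<and> st (pos x - 1) = x"
    and P: "\<And>x. N \<le> x \<Longrightarrow> pos x = 0" "\<And>j. j < Suc p \<Longrightarrow> frac w (st j)"
    "\<And>j. j \<le> Suc p \<Longrightarrow> pe j = parity_sum 0 w st j \<and> po j = parity_sum 1 w st j"
    using ms unfolding match_stack_def alternating_def stacked_def by blast+
  have ne: "st j \<noteq> st p" if "j < p" for j using A(2) that unfolding inj_on_def by auto
  have ps: "parity_sum r w' st j = parity_sum r w st j" if "j \<le> p" for j r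
    by (rule parity_sum_cong) (use that ne w' in auto)
  show "match_stack N f g w' st p pos' pe po" unfolding match_stack_def
  proof (intro conjI)
    show "alternating N f g st p" unfolding alternating_def using A by (auto intro: inj_on_subset)
    show "stacked N st p pos'"
      unfolding stacked_def
    proof (intro conjI allI impI)
      fix j assume "j < p" then show "pos' (st j) = Suc j" using S(1) ne pos' by auto
    next
      fix x assume x: "x < N" "pos' x \<noteq> 0"
      then have "x \<noteq> st p" "pos x \<noteq> 0" "pos' x = pos x" unfolding pos' by (auto split: if_splits)
      moreover have "pos x \<noteq> Suc p" using S(2)[of x] x calculation by auto
      ultimately show "pos' x \<le> p" "st (pos' x - 1) = x" using S(2)[of x] x by auto
    qed
    show "\<forall>x\<ge>N. pos' x = 0" using P(1) pos' by auto
    show "\<forall>j<p. frac w' (st j)" using P(2) ne w' by (simp add: frac_def)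
    show "\<forall>j\<le>p. pe j = parity_sum 0 w' st j \<and> po j = parity_sum 1 w' st j" using P(3) ps by simp
  qed
  show "shifted w' pos' jj fl = shifted w pos jj fl"
  proof
    fix x show "shifted w' pos' jj fl x = shifted w pos jj fl x"
    proof (cases "x = st p")
      case True
      then show ?thesis using S(1)[of p] jj by (simp add: shifted_def w' pos')
    next
      case False then show ?thesis by (simp add: shifted_def w' pos')
    qed
  qed
qed

lemma shifted_done:
  assumes "match_stack N f g w st p pos pe po"
  shows "shifted w pos p fl = w"
proof
  fix x
  have "pos x \<le> p" using assms unfolding match_stack_def stacked_def by (cases "x < N"; cases "pos x = 0") auto
  then show "shifted w pos p fl x = w x" by (simp add: shifted_def)
qed

definition square_sum :: "nat \<Rightarrow> (nat \<Rightarrow> nat) \<Rightarrow> nat" where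
  "square_sum N w = (\<Sum>x<N. (w x)\<^sup>2)"

lemma square_sum_le: "balanced N f w \<Longrightarrow> square_sum N w \<le> 9 * N"
proof -
  assume b: "balanced N f w"
  have "(\<Sum>x<N. (w x)\<^sup>2) \<le> (\<Sum>x<N. 9)"
  proof (rule sum_mono)
    fix x assume "x \<in> {..<N}"
    then have "w x \<le> 3" using b unfolding balanced_def by (metis le_add1 lessThan_iff add.assoc)
    then have "(w x)\<^sup>2 \<le> 3\<^sup>2" by (rule power_mono) simp
    then show "(w x)\<^sup>2 \<le> 9" by simp
  qed
  then show ?thesis by (simp add: square_sum_def)
qed

text \<open>Instantiates \<open>closing\<close> with the stack of the program; the prefix sums yield
  the direction that \<open>sum_squares_shifted\<close> asks for.\<close>

lemma match_close:
  assumes rings: "ring3 N f" "ring3 N g" and bal: "balanced N f w" "balanced N g w"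
    and ms: "match_stack N f g w st p pos pe po" and p: "0 < p"
    and z: "z < N" "pos z \<noteq> 0" "z = ring_of f g (p - 1) (st (p - 1)) \<or> z = ring_of f g (p - 1) (ring_of f g (p - 1) (st (p - 1)))"
    and jj: "jj = (if (pos z - 1) mod 2 = (p - 1) mod 2 then Suc (pos z - 1) else pos z - 1)"
    and fl: "fl = (if pe p - pe jj < po p - po jj then 1 else 0)"
  shows "jj + 2 \<le> p" "balanced N f (shifted w pos jj fl)" "balanced N g (shifted w pos jj fl)"
    "square_sum N w + (p - jj) \<le> square_sum N (shifted w pos jj fl)"
proof -
  have st: "stacked N st p pos" "alternating N f g st p" "\<And>j. j < p \<Longrightarrow> frac w (st j)"
    "\<And>j. j \<le> p \<Longrightarrow> pe j = parity_sum 0 w st j \<and> po j = parity_sum 1 w st j"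
    using ms unfolding match_stack_def by blast+
  have "pos z \<le> p" "st (pos z - 1) = z" using st(1) z unfolding stacked_def by blast+
  then interpret closing N f g w st pos p "pos z - 1" z
    using rings bal st p z by unfold_locales auto
  have j: "j = jj" unfolding j_def jj by simp
  show jp: "jj + 2 \<le> p" using j_bounds j by simp
  have f2: "fl < 2" using fl by auto
  show "balanced N f (shifted w pos jj fl)" using balanced_shifted[of 0 fl] f2 j by (simp add: ring_of_def)
  show "balanced N g (shifted w pos jj fl)" using balanced_shifted[of 1 fl] f2 j by (simp add: ring_of_def)
  have "fl = (if (\<Sum>k\<in>{k\<in>{jj..<p}. k mod 2 = 0}. w (st k)) < (\<Sum>k\<in>{k\<in>{jj..<p}. k mod 2 = 1}. w (st k)) then 1 else 0)"
    unfolding fl using st(4)[of p] st(4)[of jj] jp parity_sum_diff[of jj p] by simp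
  then show "square_sum N w + (p - jj) \<le> square_sum N (shifted w pos jj fl)"
    using sum_squares_shifted[of fl] j by (simp add: square_sum_def)
qed

lemma wp_push_z:
  assumes "Suc (s ''p'' 0) \<le> W" "bounded W s" "s ''pe'' (s ''p'' 0) + s ''w'' (s ''z5'' 0) \<le> W"
    "s ''po'' (s ''p'' 0) + s ''w'' (s ''z5'' 0) \<le> W"
  shows "wp W push_z (\<lambda>s'. agree {''st'', ''pos'', ''pe'', ''po'', ''p''} s' s \<and>
    s' ''st'' = (s ''st'')(s ''p'' 0 := s ''z5'' 0) \<and> s' ''pos'' = (s ''pos'')(s ''z5'' 0 := Suc (s ''p'' 0)) \<and>
    s' ''pe'' = (s ''pe'')(Suc (s ''p'' 0) := if s ''par'' (s ''p'' 0) = 0 then s ''pe'' (s ''p'' 0) + s ''w'' (s ''z5'' 0) else s ''pe'' (s ''p'' 0)) \<and>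
    s' ''po'' = (s ''po'')(Suc (s ''p'' 0) := if s ''par'' (s ''p'' 0) = 0 then s ''po'' (s ''p'' 0) else s ''po'' (s ''p'' 0) + s ''w'' (s ''z5'' 0)) \<and>
    s' ''p'' 0 = Suc (s ''p'' 0)) s"
  using assms unfolding push_z_def by (simp add: bounded_def agree_upd agree_refl)

lemma wp_candidate:
  assumes bd: "bounded W s" and F: "F = (if s ''par'' (s ''p'' 0 - 1) = 0 then s ''vr'' else s ''rot'')"
    and y: "y = s ''st'' (s ''p'' 0 - 1)"
  shows "wp W candidate (\<lambda>s'. bounded W s' \<and> agree {''y5'', ''z5''} s' s \<and>
    s' ''z5'' 0 = (if frac (s ''w'') (F y) then F y else F (F y))) s"
proof -
  have bW: "s x i \<le> W" for x i using bd by (simp add: bounded_def)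
  obtain q where q: "q = s ''p'' 0 - Suc 0" by simp
  show ?thesis
    using bW F y unfolding candidate_def is_frac_def
    by (cases "s ''par'' q = 0") (simp_all add: q[symmetric] bounded_def agree_upd agree_refl frac_def)
qed

lemma wp_close_cycle:
  assumes "bounded W s" "s ''pos'' (s ''z5'' 0) \<noteq> 0" "1 \<le> W"
  shows "wp W close_cycle (\<lambda>s'. agree {''jj'', ''fl'', ''md5''} s' s \<and>
    (let j0 = s ''pos'' (s ''z5'' 0) - 1; jj = (if s ''par'' j0 = s ''par'' (s ''p'' 0 - 1) then Suc j0 else j0) in
      s' ''jj'' 0 = jj \<and> s' ''fl'' 0 = (if s ''pe'' (s ''p'' 0) - s ''pe'' jj < s ''po'' (s ''p'' 0) - s ''po'' jj then 1 else 0)) \<and>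
    s' ''md5'' 0 = 1) s"
proof -
  have "s ''pos'' (s ''z5'' 0) \<le> W" using assms(1) by (simp add: bounded_def)
  then obtain j0 where j0: "s ''pos'' (s ''z5'' 0) = Suc j0" "Suc j0 \<le> W" using assms(2) by (cases "s ''pos'' (s ''z5'' 0)") auto
  show ?thesis unfolding close_cycle_def Let_def using assms(3) j0 by (simp add: agree_upd agree_refl)
qed

lemma wp_pop_step:
  assumes "bounded W s" "s ''w'' (s ''st'' (s ''p'' 0 - 1)) + 1 \<le> W"
  shows "wp W pop_step (\<lambda>s'. agree {''p'', ''y5'', ''pos'', ''w''} s' s \<and> s' ''p'' 0 = s ''p'' 0 - 1 \<and>
    s' ''pos'' = (s ''pos'')(s ''st'' (s ''p'' 0 - 1) := 0) \<and>
    s' ''w'' = (s ''w'')(s ''st'' (s ''p'' 0 - 1) := (if s ''par'' (s ''p'' 0 - 1) = s ''fl'' 0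
      then s ''w'' (s ''st'' (s ''p'' 0 - 1)) + 1 else s ''w'' (s ''st'' (s ''p'' 0 - 1)) - 1))) s"
proof -
  have "k - c \<le> W" if "k \<le> W" for k c :: nat using that by simp
  then show ?thesis using assms unfolding pop_step_def by (simp add: bounded_def agree_upd agree_refl)
qed

context pseudo_graph
begin

text \<open>During a shift the current weights are not balanced, so mode 1 keeps balance for the
  weights after the shift, \<open>?W'\<close>. The start value of the potential is at most
  \<open>3 * (27 * n) + 3 * n + 3 * n\<close>, which is the factor 87.\<close>

lemma match_correct:
  assumes N: "s0 ''N'' 0 = 3 * n" and z0: "\<And>i. s0 ''i5'' i = 0" "\<And>i. s0 ''md5'' i = 0" "\<And>i. s0 ''p'' i = 0"
      "\<And>i. s0 ''pos'' i = 0" "\<And>i. s0 ''pe'' i = 0" "\<And>i. s0 ''po'' i = 0"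
    and w0: "\<forall>x < 3 * n. s0 ''w'' x = 1" and vr0: "\<forall>x < 3 * n. s0 ''vr'' x = vr x"
    and par: "\<forall>j \<le> 3 * n. s0 ''par'' j = j mod 2" and rot: "ring3 (3 * n) (s0 ''rot'')"
    and W: "10 * n + 10 * m + 10 \<le> W" and bd: "bounded W s0"
  shows "runs W (While (Less (sc ''i5'') (sc ''N'')) match_body) s0 (1 + 87 * n * (1 + cost match_body))
    (\<lambda>s. agree {''i5'', ''md5'', ''p'', ''pos'', ''pe'', ''po'', ''st'', ''y5'', ''z5'', ''jj'', ''fl'', ''w''} s s0 \<and>
      balanced (3 * n) (s0 ''vr'') (s ''w'') \<and> balanced (3 * n) (s0 ''rot'') (s ''w'') \<and>
      (\<forall>x < 3 * n. \<not> frac (s ''w'') x))"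
proof -
  let ?X = "{''i5'', ''md5'', ''p'', ''pos'', ''pe'', ''po'', ''st'', ''y5'', ''z5'', ''jj'', ''fl'', ''w''}"
  let ?N = "3 * n"
  define f where "f = s0 ''vr''"
  define g where "g = s0 ''rot''"
  have rf: "ring3 ?N f" using vr0 vr_less vr_neq vr_vr_vr unfolding ring3_def f_def by simp
  have rg: "ring3 ?N g" using rot by (simp add: g_def)
  let ?ms = "\<lambda>s. match_stack ?N f g (s ''w'') (s ''st'') (s ''p'' 0) (s ''pos'') (s ''pe'') (s ''po'')"
  let ?W' = "\<lambda>s. shifted (s ''w'') (s ''pos'') (s ''jj'' 0) (s ''fl'' 0)"
  define I where "I s \<longleftrightarrow> agree ?X s s0 \<and> ?ms s \<and> s ''i5'' 0 \<le> ?N \<and> (\<forall>x<s ''i5'' 0. \<not> frac (s ''w'') x) \<and>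
    (if s ''md5'' 0 = 0 then balanced ?N f (s ''w'') \<and> balanced ?N g (s ''w'') \<and> (0 < s ''p'' 0 \<longrightarrow> s ''i5'' 0 < ?N)
     else s ''jj'' 0 \<le> s ''p'' 0 \<and> balanced ?N f (?W' s) \<and> balanced ?N g (?W' s) \<and> s ''i5'' 0 < ?N)" for s :: store
  \<comment> \<open>Popping a closed walk of length \<open>L \<ge> 2\<close> takes \<open>L + 2\<close> steps and raises the sum of squares by at least \<open>L\<close>.\<close>
  define \<phi> where "\<phi> s = (if s ''md5'' 0 = 0 then 3 * (9 * ?N - square_sum ?N (s ''w'')) + (?N - s ''p'' 0) + (?N - s ''i5'' 0)
    else 3 * (9 * ?N - square_sum ?N (?W' s)) + (?N - s ''jj'' 0) + (?N - s ''i5'' 0) + (s ''p'' 0 - s ''jj'' 0) + 1)" for s :: store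
  have "runs W (While (Less (sc ''i5'') (sc ''N'')) match_body) s0 (1 + \<phi> s0 * (1 + cost match_body))
     (\<lambda>s. I s \<and> \<not> bval (Less (sc ''i5'') (sc ''N'')) s)"
  proof (rule runs_While[OF _ bd])
    have "balanced ?N f (s0 ''w'')" "balanced ?N g (s0 ''w'')"
      using w0 ring3D[OF rf] ring3D[OF rg] by (simp_all add: balanced_def)
    moreover have "?ms s0" using z0 by (simp add: match_stack_def alternating_def stacked_def parity_sum_0)
    ultimately show "I s0" using z0 by (simp add: I_def agree_refl)
    fix s assume s: "I s" "bval (Less (sc ''i5'') (sc ''N'')) s" "bounded W s"
    then have ag: "agree ?X s s0" by (simp add: I_def)
    have V: "s ''N'' 0 = ?N" "s ''vr'' = f" "s ''rot'' = g" "\<And>j. j \<le> ?N \<Longrightarrow> s ''par'' j = j mod 2"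
      using N par by (auto simp: agreeD[OF ag] f_def g_def)
    let ?p = "s ''p'' 0" and ?i = "s ''i5'' 0"
    have i5: "?i < ?N" using s(2) V by simp
    have bW: "s x i \<le> W" for x i using s(3) by (simp add: bounded_def)
    have ms: "?ms s" using s(1) by (simp add: I_def)
    then have pN: "?p \<le> ?N" using alternating_le unfolding match_stack_def by blast
    have stl: "s ''st'' j < ?N \<and> frac (s ''w'') (s ''st'' j)" if "j < ?p" for j
      using ms that unfolding match_stack_def alternating_def by blast
    define I' where "I' s' \<longleftrightarrow> I s' \<and> \<phi> s' < \<phi> s" for s'
    have push: "wp W push_z I' t" if t: "agree {''y5'', ''z5''} t s" "t ''z5'' 0 = z" "bounded W t" and md: "s ''md5'' 0 = 0"
      and z: "z < ?N" "frac (s ''w'') z" "s ''pos'' z = 0"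
      "0 < ?p \<Longrightarrow> z = ring_of f g (?p - 1) (s ''st'' (?p - 1)) \<or> z = ring_of f g (?p - 1) (ring_of f g (?p - 1) (s ''st'' (?p - 1)))" for t z
    proof -
      have T: "t ''p'' = s ''p''" "t ''pe'' = s ''pe''" "t ''po'' = s ''po''" "t ''w'' = s ''w''" "t ''st'' = s ''st''"
        "t ''pos'' = s ''pos''" "t ''par'' = s ''par''" "t ''i5'' = s ''i5''" "t ''md5'' = s ''md5''"
        by (simp_all add: agreeD[OF t(1)])
      note ms' = match_stack_push[OF ms z]
      have p1: "Suc ?p \<le> ?N" using ms' alternating_le unfolding match_stack_def by blast
      have w2: "s ''w'' (s ''st'' k) \<le> 2" if "k < ?p" for k using stl[OF that] by (simp add: frac_def)
      have "s ''pe'' ?p \<le> 2 * ?p" "s ''po'' ?p \<le> 2 * ?p"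
        using ms parity_sum_bound[of ?p "s ''w''" "s ''st''", OF w2] unfolding match_stack_def by auto
      moreover have "s ''w'' z \<le> 2" using z(2) by (simp add: frac_def)
      ultimately have "s ''pe'' ?p + s ''w'' z \<le> W" "s ''po'' ?p + s ''w'' z \<le> W" "Suc ?p \<le> W"
        using p1 W by linarith+
      then have H: "Suc (t ''p'' 0) \<le> W" "t ''pe'' (t ''p'' 0) + t ''w'' (t ''z5'' 0) \<le> W"
        "t ''po'' (t ''p'' 0) + t ''w'' (t ''z5'' 0) \<le> W" using T t(2) by simp_all
      have par': "s ''par'' ?p = ?p mod 2" using V(4) pN by simp
      show ?thesis
      proof (rule wp_mono[OF wp_push_z[OF H(1) t(3) H(2,3)]])
        fix s' assume A: "agree {''st'', ''pos'', ''pe'', ''po'', ''p''} s' t \<and>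
          s' ''st'' = (t ''st'')(t ''p'' 0 := t ''z5'' 0) \<and> s' ''pos'' = (t ''pos'')(t ''z5'' 0 := Suc (t ''p'' 0)) \<and>
          s' ''pe'' = (t ''pe'')(Suc (t ''p'' 0) := if t ''par'' (t ''p'' 0) = 0 then t ''pe'' (t ''p'' 0) + t ''w'' (t ''z5'' 0) else t ''pe'' (t ''p'' 0)) \<and>
          s' ''po'' = (t ''po'')(Suc (t ''p'' 0) := if t ''par'' (t ''p'' 0) = 0 then t ''po'' (t ''p'' 0) else t ''po'' (t ''p'' 0) + t ''w'' (t ''z5'' 0)) \<and>
          s' ''p'' 0 = Suc (t ''p'' 0)"
        have ags: "agree {''st'', ''pos'', ''pe'', ''po'', ''p''} s' t" using A by blast
        have E: "s' ''w'' = s ''w''" "s' ''i5'' = s ''i5''" "s' ''md5'' = s ''md5''" by (simp_all add: agreeD[OF ags] T)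
        have B: "s' ''st'' = (s ''st'')(?p := z)" "s' ''pos'' = (s ''pos'')(z := Suc ?p)"
          "s' ''pe'' = (s ''pe'')(Suc ?p := if ?p mod 2 = 0 then s ''pe'' ?p + s ''w'' z else s ''pe'' ?p)"
          "s' ''po'' = (s ''po'')(Suc ?p := if ?p mod 2 = 0 then s ''po'' ?p else s ''po'' ?p + s ''w'' z)"
          "s' ''p'' 0 = Suc ?p"
          using A unfolding T t(2) par' by blast+
        have ms2: "?ms s'" unfolding E B by (rule ms')
        have "agree ?X s' s0" using ags t(1) ag by (simp add: agree_def)
        moreover have "\<phi> s' < \<phi> s" using md p1 A unfolding \<phi>_def E by (simp add: T)
        ultimately show "I' s'" using s(1) ms2 md i5 unfolding I'_def I_def E by simp
      qed
    qed
    show "wp W match_body (\<lambda>s'. I s' \<and> \<phi> s' < \<phi> s) s"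
    proof (cases "s ''md5'' 0 = 0")
      case md: True
      then have bal: "balanced ?N f (s ''w'')" "balanced ?N g (s ''w'')" using s(1) by (simp_all add: I_def)
      show ?thesis
      proof (cases "?p = 0")
        case p0: True
        show ?thesis
        proof (cases "frac (s ''w'') ?i")
          case True
          have "s ''pos'' ?i = 0" using ms i5 p0 unfolding match_stack_def stacked_def by auto
          then have "wp W push_z I' (s(''z5'' := (s ''z5'')(0 := ?i)))"
            using i5 True md p0 bW by (intro push) (auto simp: agree_upd agree_refl bounded_def)
          then show ?thesis unfolding I'_def[symmetric] match_body_def is_frac_def
            using md p0 True bW by (simp add: frac_def)
        next
          case False
          have fin: "I' s'" if t: "agree {''i5''} s' s" "s' ''i5'' 0 = Suc ?i" for s'
          proof -
            have E: "s' x = s x" if "x \<noteq> ''i5''" for x using agreeD[OF t(1)] that by simp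
            have "agree ?X s' s0" using t(1) ag by (simp add: agree_def)
            then show ?thesis using s(1) md p0 i5 False t(2) unfolding I'_def I_def \<phi>_def by (simp add: E less_Suc_eq)
          qed
          have "Suc ?i \<le> W" using i5 W by linarith
          then show ?thesis unfolding I'_def[symmetric] match_body_def is_frac_def
            using md p0 False by (auto simp: frac_def intro!: fin agree_upd agree_refl)
        qed
      next
        case p0: False
        let ?y = "s ''st'' (?p - 1)" and ?F = "ring_of f g (?p - 1)"
        have y: "?y < ?N" "frac (s ''w'') ?y" using stl[of "?p - 1"] p0 by auto
        have F: "(if s ''par'' (?p - 1) = 0 then s ''vr'' else s ''rot'') = ?F"
          using V pN by (simp add: ring_of_def)
        have rF: "ring3 ?N ?F" "balanced ?N ?F (s ''w'')" using rf rg bal by (simp_all add: ring_of_def)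
        note 1 = wp_candidate[OF s(3) F[symmetric] refl]
        have 2: "wp W (If (Equal (Cell ''pos'' (sc ''z5'')) (Const 0)) push_z close_cycle) I' t"
          if t: "bounded W t \<and> agree {''y5'', ''z5''} t s \<and>
            t ''z5'' 0 = (if frac (s ''w'') (?F ?y) then ?F ?y else ?F (?F ?y))" for t
        proof -
          have agt: "agree {''y5'', ''z5''} t s" and bt: "bounded W t" using t by blast+
          have T: "t ''p'' = s ''p''" "t ''pe'' = s ''pe''" "t ''po'' = s ''po''" "t ''w'' = s ''w''" "t ''st'' = s ''st''"
            "t ''pos'' = s ''pos''" "t ''par'' = s ''par''" "t ''i5'' = s ''i5''" "t ''md5'' = s ''md5''"
            by (simp_all add: agreeD[OF agt])
          obtain z where z: "t ''z5'' 0 = z" by simp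
          have zF: "z = ?F ?y \<or> z = ?F (?F ?y)" using t z by (auto split: if_splits)
          have zN: "z < ?N" using zF ring3D[OF rF(1) y(1)] by auto
          have zf: "frac (s ''w'') z" using t z frac_candidate[OF rF(2) y] by (auto split: if_splits)
          show ?thesis
          proof (cases "s ''pos'' z = 0")
            case True
            then show ?thesis using push[OF agt z bt md zN zf True zF] by (simp add: z T)
          next
            case False
            have c: "t ''pos'' (t ''z5'' 0) \<noteq> 0" "1 \<le> W" using False z T W by simp_all
            have posz: "s ''pos'' z \<le> ?p" using ms zN False unfolding match_stack_def stacked_def by blast
            have pm: "s ''par'' (s ''pos'' z - 1) = (s ''pos'' z - 1) mod 2" "s ''par'' (?p - 1) = (?p - 1) mod 2"
              using V(4) posz pN by simp_all
            have "wp W close_cycle I' t"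
            proof (rule wp_mono[OF wp_close_cycle[OF bt c]])
              fix s' assume A: "agree {''jj'', ''fl'', ''md5''} s' t \<and>
                (let j0 = t ''pos'' (t ''z5'' 0) - 1; jj = (if t ''par'' j0 = t ''par'' (t ''p'' 0 - 1) then Suc j0 else j0) in
                  s' ''jj'' 0 = jj \<and> s' ''fl'' 0 = (if t ''pe'' (t ''p'' 0) - t ''pe'' jj < t ''po'' (t ''p'' 0) - t ''po'' jj then 1 else 0)) \<and>
                s' ''md5'' 0 = 1"
              have ags: "agree {''jj'', ''fl'', ''md5''} s' t" using A by blast
              obtain jj fl where jf: "s' ''jj'' 0 = jj" "s' ''fl'' 0 = fl" by simp
              have jj: "jj = (if (s ''pos'' z - 1) mod 2 = (?p - 1) mod 2 then Suc (s ''pos'' z - 1) else s ''pos'' z - 1)"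
                using A jf unfolding Let_def T z pm by simp
              have fl: "fl = (if s ''pe'' ?p - s ''pe'' jj < s ''po'' ?p - s ''po'' jj then 1 else 0)"
                using A jf unfolding Let_def T z pm jj by simp
              have "0 < ?p" using p0 by simp
              note MC = match_close[OF rf rg bal ms this zN False zF jj fl]
              have E: "s' ''w'' = s ''w''" "s' ''pos'' = s ''pos''" "s' ''p'' = s ''p''" "s' ''i5'' = s ''i5''"
                "s' ''st'' = s ''st''" "s' ''pe'' = s ''pe''" "s' ''po'' = s ''po''"
                by (simp_all add: agreeD[OF ags] T)
              have sq: "square_sum ?N (shifted (s ''w'') (s ''pos'') jj fl) \<le> 9 * ?N" using square_sum_le[OF MC(2)] .
              have "\<phi> s' < \<phi> s"
                using MC(1,4) sq pN md A unfolding \<phi>_def E jf by simp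
              moreover have "agree ?X s' s0" using ags agt ag by (simp add: agree_def)
              ultimately show "I' s'" using s(1) MC i5 A unfolding I'_def I_def E jf by simp
            qed
            then show ?thesis using False by (simp add: z T)
          qed
        qed
        have "wp W candidate (wp W (If (Equal (Cell ''pos'' (sc ''z5'')) (Const 0)) push_z close_cycle) I') s"
          using 1 2 by (rule wp_mono)
        then show ?thesis unfolding I'_def[symmetric] match_body_def using md p0 by (simp add: wp_Seq_fun)
      qed
    next
      case md: False
      let ?j = "s ''jj'' 0" and ?fl = "s ''fl'' 0"
      have J: "?j \<le> ?p" "balanced ?N f (?W' s)" "balanced ?N g (?W' s)" using s(1) md by (simp_all add: I_def)
      show ?thesis
      proof (cases "?j < ?p")
        case True
        then obtain q where q: "?p = Suc q" by (cases ?p) auto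
        have jq: "?j \<le> q" using True q by simp
        have fq: "frac (s ''w'') (s ''st'' q)" using stl[of q] q by simp
        then have "s ''w'' (s ''st'' (?p - 1)) + 1 \<le> W" using q W by (simp add: frac_def)
        note WP = wp_pop_step[OF s(3) this]
        have parq: "s ''par'' q = q mod 2" using V(4) pN q by simp
        have "wp W pop_step I' s"
        proof (rule wp_mono[OF WP])
          fix s' assume A: "agree {''p'', ''y5'', ''pos'', ''w''} s' s \<and> s' ''p'' 0 = ?p - 1 \<and>
            s' ''pos'' = (s ''pos'')(s ''st'' (?p - 1) := 0) \<and>
            s' ''w'' = (s ''w'')(s ''st'' (?p - 1) := (if s ''par'' (?p - 1) = ?fl
              then s ''w'' (s ''st'' (?p - 1)) + 1 else s ''w'' (s ''st'' (?p - 1)) - 1))"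
          have ags: "agree {''p'', ''y5'', ''pos'', ''w''} s' s" using A by blast
          have E: "s' ''i5'' = s ''i5''" "s' ''jj'' = s ''jj''" "s' ''fl'' = s ''fl''" "s' ''md5'' = s ''md5''"
            "s' ''st'' = s ''st''" "s' ''pe'' = s ''pe''" "s' ''po'' = s ''po''"
            by (simp_all add: agreeD[OF ags])
          have w': "s' ''w'' = (s ''w'')(s ''st'' q := (if q mod 2 = ?fl then s ''w'' (s ''st'' q) + 1 else s ''w'' (s ''st'' q) - 1))"
            and pos': "s' ''pos'' = (s ''pos'')(s ''st'' q := 0)" and p': "s' ''p'' 0 = q"
            using A q parq by simp_all
          note MP = match_stack_pop[OF ms[unfolded q] jq w' pos']
          have "agree ?X s' s0" using ags ag by (simp add: agree_def)
          moreover have "\<phi> s' < \<phi> s" using md jq unfolding \<phi>_def E MP(2) p' q by simp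
          moreover have "\<not> frac (s' ''w'') x" if "x < ?i" for x
          proof -
            have "\<not> frac (s ''w'') x" using s(1) that by (simp add: I_def)
            moreover from this have "x \<noteq> s ''st'' q" using fq by auto
            ultimately show ?thesis unfolding w' by (simp add: frac_def)
          qed
          ultimately show "I' s'" using s(1) md MP jq unfolding I'_def I_def E MP(2) p' by simp
        qed
        then show ?thesis unfolding I'_def[symmetric] match_body_def using md True by simp
      next
        case False
        then have jp: "?j = ?p" using J by simp
        have sh: "?W' s = s ''w''" unfolding jp using shifted_done[OF ms] .
        have fin: "I' s'" if t: "agree {''md5''} s' s" "s' ''md5'' 0 = 0" for s'
        proof -
          have E: "s' x = s x" if "x \<noteq> ''md5''" for x using agreeD[OF t(1)] that by simp
          have "agree ?X s' s0" using t(1) ag by (simp add: agree_def)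
          moreover have "\<phi> s' < \<phi> s" using md t(2) unfolding \<phi>_def sh by (simp add: E jp)
          ultimately show ?thesis using s(1) md i5 J t(2) unfolding I'_def I_def sh by (simp add: E)
        qed
        then show ?thesis unfolding I'_def[symmetric] match_body_def
          using md False by (auto intro!: fin agree_upd agree_refl)
      qed
    qed
  qed
  then show ?thesis
  proof (rule runs_mono)
    have "\<phi> s0 \<le> 87 * n" using z0 unfolding \<phi>_def by simp
    then show "1 + \<phi> s0 * (1 + cost match_body) \<le> 1 + 87 * n * (1 + cost match_body)"
      by (meson add_left_mono mult_right_mono le0)
    fix s assume s: "I s \<and> \<not> bval (Less (sc ''i5'') (sc ''N'')) s"
    then have ag: "agree ?X s s0" by (simp add: I_def)
    have "s ''N'' 0 = ?N" using N by (simp add: agreeD[OF ag])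
    then have i5: "s ''i5'' 0 = ?N" using s by (simp add: I_def)
    then have "s ''md5'' 0 = 0" using s by (auto simp: I_def split: if_splits)
    then show "agree ?X s s0 \<and> balanced ?N (s0 ''vr'') (s ''w'') \<and> balanced ?N (s0 ''rot'') (s ''w'') \<and>
      (\<forall>x < ?N. \<not> frac (s ''w'') x)"
      using s i5 ag unfolding I_def f_def g_def by simp
  qed
qed

end

section \<open>Labelling the edges\<close>

context growth
begin

text \<open>\<open>T\<close> consists of vertices, whereas the program marks and queues slots.
  Injectivity of \<open>q\<close> bounds the queue by \<open>3 * n\<close>.\<close>

definition queue_inv where
  "queue_inv T tm q qt \<longleftrightarrow> T \<subseteq> {..<n} \<and> (\<forall>x < 3 * n. tm x = (if x mod n \<in> T then 1 else 0)) \<and>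
    inj_on q {..<qt} \<and> q ` {..<qt} = {x. x < 3 * n \<and> x mod n \<in> T}"

lemma queue_inv_bound:
  assumes "queue_inv T tm q qt" shows "qt \<le> 3 * n"
proof -
  have "inj_on q {..<qt}" using assms by (simp add: queue_inv_def)
  then have "card (q ` {..<qt}) = qt" by (simp add: card_image)
  moreover have "card (q ` {..<qt}) \<le> card {..<3 * n}" using assms by (intro card_mono) (auto simp: queue_inv_def)
  ultimately show ?thesis by simp
qed

lemma queue_inv_add:
  assumes Q: "queue_inv T tm q qt" and y: "y < 3 * n" "y mod n \<notin> T"
  shows "queue_inv (insert (y mod n) T) (tm(y := 1, vr y := 1, vr (vr y) := 1))
    (q(qt := y, Suc qt := vr y, Suc (Suc qt) := vr (vr y))) (qt + 3)"
proof -
  let ?q = "q(qt := y, Suc qt := vr y, Suc (Suc qt) := vr (vr y))"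
  have n: "0 < n" using y by auto
  have Y: "vr y < 3 * n" "vr (vr y) < 3 * n" "vr y \<noteq> y" "vr (vr y) \<noteq> y" "vr (vr y) \<noteq> vr y"
    using vr_less vr_neq y by auto
  have old: "q j \<noteq> y" "q j \<noteq> vr y" "q j \<noteq> vr (vr y)" if "j < qt" for j
  proof -
    have "q j mod n \<in> T" using Q that by (auto simp: queue_inv_def)
    then show "q j \<noteq> y" "q j \<noteq> vr y" "q j \<noteq> vr (vr y)" using y vr_mod by auto
  qed
  have eq: "{..<qt + 3} = insert qt (insert (Suc qt) (insert (Suc (Suc qt)) {..<qt}))" by auto
  have img: "?q ` {..<qt} = q ` {..<qt}" by (rule image_cong) auto
  show ?thesis unfolding queue_inv_def
  proof (intro conjI allI impI)
    show "insert (y mod n) T \<subseteq> {..<n}" using Q n by (simp add: queue_inv_def)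
    fix x assume x: "x < 3 * n"
    have "x mod n = y mod n \<longleftrightarrow> x = y \<or> x = vr y \<or> x = vr (vr y)" using same_vertex_iff[OF y(1) x] by auto
    then show "(tm(y := 1, vr y := 1, vr (vr y) := 1)) x = (if x mod n \<in> insert (y mod n) T then 1 else 0)"
      using Q x by (auto simp: queue_inv_def)
  next
    show "inj_on ?q {..<qt + 3}"
    proof -
      have "inj_on ?q {..<qt} = inj_on q {..<qt}" by (rule inj_on_cong) auto
      then have "inj_on ?q {..<qt}" using Q by (simp add: queue_inv_def)
      moreover have "y \<notin> q ` {..<qt}" "vr y \<notin> q ` {..<qt}" "vr (vr y) \<notin> q ` {..<qt}"
        using old by (metis imageE lessThan_iff)+
      ultimately show ?thesis unfolding eq using Y(3-5) Y(3-5)[symmetric] by (simp add: img) blast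
    qed
    show "?q ` {..<qt + 3} = {x. x < 3 * n \<and> x mod n \<in> insert (y mod n) T}"
    proof -
      have "?q ` {..<qt + 3} = insert y (insert (vr y) (insert (vr (vr y)) (q ` {..<qt})))"
        unfolding eq image_insert img by simp
      also have "\<dots> = {x. x < 3 * n \<and> x mod n \<in> insert (y mod n) T}"
      proof (intro set_eqI iffI)
        fix x assume "x \<in> insert y (insert (vr y) (insert (vr (vr y)) (q ` {..<qt})))"
        then show "x \<in> {x. x < 3 * n \<and> x mod n \<in> insert (y mod n) T}"
          using Q y Y vr_mod by (auto simp: queue_inv_def)
      next
        fix x assume x: "x \<in> {x. x < 3 * n \<and> x mod n \<in> insert (y mod n) T}"
        then have "x mod n \<in> T \<Longrightarrow> x \<in> q ` {..<qt}" using Q by (simp add: queue_inv_def)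
        moreover have "x mod n = y mod n \<Longrightarrow> x = y \<or> x = vr y \<or> x = vr (vr y)"
          using same_vertex_iff[OF y(1), of x] x by auto
        ultimately show "x \<in> insert y (insert (vr y) (insert (vr (vr y)) (q ` {..<qt})))" using x by auto
      qed
      finally show ?thesis .
    qed
  qed
qed

definition core where
  "core s T D \<longleftrightarrow> queue_inv T (s ''T'') (s ''q'') (s ''qt'' 0) \<and> label_inv (s ''out'') T D \<and> tree_inv (s ''out'') T"

text \<open>What the labelling takes over from the earlier phases; it writes none of these
  arrays.\<close>

definition setup_ok :: "store \<Rightarrow> bool" where
  "setup_ok s \<longleftrightarrow> s ''N'' 0 = 3 * n \<and> (\<forall>i<m. s ''part'' i = c i) \<and> s ''su'' = su \<and> s ''pr'' = pr \<and> s ''ei'' = ei \<and>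
    (\<forall>x < 3 * n. (s ''deg'' x = 2) = (x \<in> K) \<and> (s ''w'' x = 3) = mt x \<and> s ''real'' x = (if rl x then 1 else 0) \<and> s ''vr'' x = vr x)"

abbreviation grow_vars :: "string set" where
  "grow_vars \<equiv> {''T'', ''q'', ''qt'', ''qh'', ''out'', ''ph'', ''x6'', ''z6'', ''e6'', ''t6''}"

lemma setup_ok_agree: "setup_ok s \<Longrightarrow> agree grow_vars s' s \<Longrightarrow> setup_ok s'"
  unfolding setup_ok_def by (simp add: agreeD)

lemma wp_add_z:
  assumes ok: "setup_ok s" and y: "s ''z6'' 0 = y" "y < 3 * n" and qt: "s ''qt'' 0 \<le> 3 * n" and W: "10 * n + 10 * m + 10 \<le> W"
  shows "wp W add_z (\<lambda>s'. agree {''T'', ''q'', ''qt''} s' s \<and>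
    s' ''T'' = (s ''T'')(y := 1, vr y := 1, vr (vr y) := 1) \<and>
    s' ''q'' = (s ''q'')(s ''qt'' 0 := y, Suc (s ''qt'' 0) := vr y, Suc (Suc (s ''qt'' 0)) := vr (vr y)) \<and>
    s' ''qt'' 0 = s ''qt'' 0 + 3) s"
proof -
  have V: "s ''vr'' y = vr y" "s ''vr'' (vr y) = vr (vr y)" using ok y vr_less by (auto simp: setup_ok_def)
  have "vr y < 3 * n" "vr (vr y) < 3 * n" using y vr_less by auto
  then have "y \<le> W" "vr y \<le> W" "vr (vr y) \<le> W" "Suc (Suc (Suc (s ''qt'' 0))) \<le> W" "1 \<le> W" using y qt W by linarith+
  then show ?thesis unfolding add_z_def by (simp add: V y(1) agree_upd agree_refl numeral_3_eq_3)
qed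

lemma core_add:
  assumes ok: "setup_ok s" and cr: "core s0 T D" and lab: "label_inv (s ''out'') (insert (y mod n) T) D'"
    and tree: "tree_inv (s ''out'') (insert (y mod n) T)"
    and eq: "s ''T'' = s0 ''T''" "s ''q'' = s0 ''q''" "s ''qt'' = s0 ''qt''"
    and y: "s ''z6'' 0 = y" "y < 3 * n" "y mod n \<notin> T" and W: "10 * n + 10 * m + 10 \<le> W"
  shows "wp W add_z (\<lambda>s'. agree {''T'', ''q'', ''qt''} s' s \<and> core s' (insert (y mod n) T) D' \<and>
    (\<forall>j < s ''qt'' 0. s' ''q'' j = s ''q'' j) \<and> s ''qt'' 0 \<le> s' ''qt'' 0) s"
proof -
  have Q: "queue_inv T (s ''T'') (s ''q'') (s ''qt'' 0)" using cr by (simp add: core_def eq)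
  note A = queue_inv_add[OF Q y(2,3)]
  show ?thesis
  proof (rule wp_mono[OF wp_add_z[OF ok y(1,2) queue_inv_bound[OF Q] W]])
    fix s' assume S: "agree {''T'', ''q'', ''qt''} s' s \<and>
      s' ''T'' = (s ''T'')(y := 1, vr y := 1, vr (vr y) := 1) \<and>
      s' ''q'' = (s ''q'')(s ''qt'' 0 := y, Suc (s ''qt'' 0) := vr y, Suc (Suc (s ''qt'' 0)) := vr (vr y)) \<and>
      s' ''qt'' 0 = s ''qt'' 0 + 3"
    then have ags: "agree {''T'', ''q'', ''qt''} s' s" by blast
    have o: "s' ''out'' = s ''out''" by (simp add: agreeD[OF ags])
    have E: "s' ''T'' = (s ''T'')(y := 1, vr y := 1, vr (vr y) := 1)"
      "s' ''q'' = (s ''q'')(s ''qt'' 0 := y, Suc (s ''qt'' 0) := vr y, Suc (Suc (s ''qt'' 0)) := vr (vr y))"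
      "s' ''qt'' 0 = s ''qt'' 0 + 3" using S by blast+
    have "core s' (insert (y mod n) T) D'" unfolding core_def o E using A lab tree by blast
    then show "agree {''T'', ''q'', ''qt''} s' s \<and> core s' (insert (y mod n) T) D' \<and>
      (\<forall>j < s ''qt'' 0. s' ''q'' j = s ''q'' j) \<and> s ''qt'' 0 \<le> s' ''qt'' 0"
      using S by simp
  qed
qed

text \<open>Whether or not \<open>y\<close> gets added, a representative \<open>y\<close> ends up in
  \<open>T\<close>; over the whole queue this amounts to \<open>closed\<close>.\<close>

lemma wp_check_z:
  assumes ok: "setup_ok s" and cr: "core s T D" and y: "s ''z6'' 0 = y" "y \<in> K" and i: "s ''e6'' 0 = i"
    and x: "x \<in> K" "x mod n \<in> T" and adj: "y = su x \<and> i = ei x \<or> y = pr x \<and> i = ei y"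
    and W: "10 * n + 10 * m + 10 \<le> W"
  shows "wp W check_z (\<lambda>s'. agree {''T'', ''q'', ''qt'', ''out''} s' s \<and> (\<exists>T'. T \<subseteq> T' \<and> core s' T' D \<and>
    (rp y \<longrightarrow> y mod n \<in> T')) \<and> (\<forall>j < s ''qt'' 0. s' ''q'' j = s ''q'' j) \<and> s ''qt'' 0 \<le> s' ''qt'' 0) s"
proof -
  have y3: "y < 3 * n" using K_less y by simp
  have V: "(s ''w'' y = 3) = mt y" "s ''real'' y = (if rl y then 1 else 0)" using ok y3 by (auto simp: setup_ok_def)
  have Ty: "s ''T'' y = (if y mod n \<in> T then 1 else 0)" using cr y3 by (simp add: core_def queue_inv_def)
  show ?thesis
  proof (cases "rp y \<and> y mod n \<notin> T")
    case True
    obtain r where r: "r \<in> K" "cy r = cy y" "i = ei r" using adj x y(2) cy_su by metis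
    have lab: "label_inv ((s ''out'')(i := 3)) (insert (y mod n) T) D"
      unfolding r(3) by (rule label_inv_three[OF _ _ _ r(1,2)]) (use cr True in \<open>auto simp: core_def\<close>)
    have tree: "tree_inv ((s ''out'')(i := 3)) (insert (y mod n) T)"
      by (rule tree_inv_grow[OF _ x _ _ adj]) (use cr True in \<open>auto simp: core_def\<close>)
    let ?s = "s(''out'' := (s ''out'')(i := 3))"
    have "setup_ok ?s" using ok by (rule setup_ok_agree) (simp add: agree_upd agree_refl)
    then have "wp W add_z (\<lambda>s'. agree {''T'', ''q'', ''qt''} s' ?s \<and> core s' (insert (y mod n) T) D \<and>
      (\<forall>j < ?s ''qt'' 0. s' ''q'' j = ?s ''q'' j) \<and> ?s ''qt'' 0 \<le> s' ''qt'' 0) ?s"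
      by (rule core_add[OF _ cr]) (use lab tree y y3 True W in simp_all)
    then have "wp W add_z (\<lambda>s'. agree {''T'', ''q'', ''qt'', ''out''} s' s \<and> (\<exists>T'. T \<subseteq> T' \<and> core s' T' D \<and>
      (rp y \<longrightarrow> y mod n \<in> T')) \<and> (\<forall>j < s ''qt'' 0. s' ''q'' j = s ''q'' j) \<and> s ''qt'' 0 \<le> s' ''qt'' 0) ?s"
    proof (rule wp_mono)
      fix s' assume S: "agree {''T'', ''q'', ''qt''} s' ?s \<and> core s' (insert (y mod n) T) D \<and>
        (\<forall>j < ?s ''qt'' 0. s' ''q'' j = ?s ''q'' j) \<and> ?s ''qt'' 0 \<le> s' ''qt'' 0"
      then have "agree {''T'', ''q'', ''qt'', ''out''} s' s" by (simp add: agree_def)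
      moreover have "T \<subseteq> insert (y mod n) T" by auto
      ultimately show "agree {''T'', ''q'', ''qt'', ''out''} s' s \<and> (\<exists>T'. T \<subseteq> T' \<and> core s' T' D \<and>
        (rp y \<longrightarrow> y mod n \<in> T')) \<and> (\<forall>j < s ''qt'' 0. s' ''q'' j = s ''q'' j) \<and> s ''qt'' 0 \<le> s' ''qt'' 0"
        using S by auto
    qed
    moreover have "3 \<le> W" using W by simp
    ultimately show ?thesis unfolding check_z_def using True V Ty y(1) i by (simp add: rp_def)
  next
    case False
    then have "\<not> (s ''real'' y = 1 \<and> s ''w'' y = 3 \<and> s ''T'' y = 0)" using V Ty y3 by (auto simp: rp_def)
    moreover have "rp y \<longrightarrow> y mod n \<in> T" using False by blast
    then have "\<exists>T'. T \<subseteq> T' \<and> core s T' D \<and> (rp y \<longrightarrow> y mod n \<in> T')" using cr by blast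
    ultimately show ?thesis unfolding check_z_def using y(1) by (auto simp: agree_refl)
  qed
qed

text \<open>One conjunct per phase: its slots are all settled once the phase is over, and those
  below \<open>k\<close> while it runs.\<close>

definition scanned :: "nat \<Rightarrow> nat \<Rightarrow> nat set \<Rightarrow> bool" where
  "scanned ph k T \<longleftrightarrow> (\<forall>x < 3 * n. mt x \<and> \<not> rl x \<and> (1 \<le> ph \<or> x < k) \<longrightarrow> x mod n \<in> T) \<and>
    (\<forall>x. rp x \<and> su (su (su x)) \<noteq> x \<and> (2 \<le> ph \<or> ph = 1 \<and> x < k) \<longrightarrow> x mod n \<in> T) \<and>
    (\<forall>x. rp x \<and> (3 \<le> ph \<or> ph = 2 \<and> x < k) \<longrightarrow> x mod n \<in> T)"

lemma scanned_mono: "scanned ph k T \<Longrightarrow> T \<subseteq> T' \<Longrightarrow> scanned ph k T'"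
  unfolding scanned_def by blast

lemma scanned_next: "scanned ph (3 * n) T \<Longrightarrow> scanned (Suc ph) 0 T"
  unfolding scanned_def rp_def by (auto simp: le_Suc_eq numeral_2_eq_2 numeral_3_eq_3)

text \<open>A restart is justified by \<open>tree_inv_source\<close> at a vertex representing
  nothing, by \<open>tree_inv_long\<close> on a long cycle and by \<open>label_inv_kill\<close> on a
  triangle; \<open>scanned\<close> provides their premises about the earlier phases.\<close>

lemma wp_scan_step:
  assumes ok: "setup_ok s" and cr: "core s T D" and cl: "closed T" and x: "s ''x6'' 0 = x" "x < 3 * n"
    and ph: "s ''ph'' 0 = ph" "ph < 3" and sc: "scanned ph x T"
    and W: "10 * n + 10 * m + 10 \<le> W" and bd: "bounded W s"
  shows "wp W scan_step (\<lambda>s'. agree {''T'', ''q'', ''qt'', ''out'', ''z6'', ''x6''} s' s \<and> s' ''x6'' 0 = Suc x \<and>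
    (\<exists>T' D'. T \<subseteq> T' \<and> core s' T' D' \<and> scanned ph (Suc x) T') \<and>
    (\<forall>j < s ''qt'' 0. s' ''q'' j = s ''q'' j) \<and> s ''qt'' 0 \<le> s' ''qt'' 0) s"
proof -
  let ?R = "\<lambda>s'. agree {''T'', ''q'', ''qt'', ''out'', ''z6'', ''x6''} s' s \<and> s' ''x6'' 0 = Suc x \<and>
    (\<exists>T' D'. T \<subseteq> T' \<and> core s' T' D' \<and> scanned ph (Suc x) T') \<and>
    (\<forall>j < s ''qt'' 0. s' ''q'' j = s ''q'' j) \<and> s ''qt'' 0 \<le> s' ''qt'' 0"
  let ?Q = "\<lambda>s'. agree {''T'', ''q'', ''qt'', ''out'', ''z6''} s' s \<and>
    (\<exists>T' D'. T \<subseteq> T' \<and> core s' T' D' \<and> scanned ph (Suc x) T') \<and>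
    (\<forall>j < s ''qt'' 0. s' ''q'' j = s ''q'' j) \<and> s ''qt'' 0 \<le> s' ''qt'' 0"
  have fin: "wp W (inc_var ''x6'') ?R s'" if Q: "?Q s'" for s'
  proof -
    have ags: "agree {''T'', ''q'', ''qt'', ''out'', ''z6''} s' s" using Q by blast
    have "s' ''x6'' 0 = x" using x by (simp add: agreeD[OF ags])
    moreover have "Suc x \<le> W" using x W by linarith
    moreover obtain T' D' where "T \<subseteq> T'" "core s' T' D'" "scanned ph (Suc x) T'" using Q by blast
    moreover have "core (s'(''x6'' := (s' ''x6'')(0 := Suc x))) T' D'" using calculation(4) by (simp add: core_def)
    moreover have "agree {''T'', ''q'', ''qt'', ''out'', ''z6'', ''x6''} (s'(''x6'' := (s' ''x6'')(0 := Suc x))) s"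
      using Q by (auto simp: agree_def)
    ultimately show ?thesis using Q by auto
  qed
  have V: "(s ''w'' x = 3) = mt x" "s ''real'' x = (if rl x then 1 else 0)" "s ''su'' = su" "s ''ei'' = ei"
    "\<And>i. i < m \<Longrightarrow> s ''part'' i = c i" using ok x by (auto simp: setup_ok_def)
  have Tx: "s ''T'' x = (if x mod n \<in> T then 1 else 0)" using cr x by (simp add: core_def queue_inv_def)
  have lab: "label_inv (s ''out'') T D" and tree: "tree_inv (s ''out'') T" using cr by (simp_all add: core_def)
  have skip: "?Q s" if "scanned ph (Suc x) T" using that cr by (auto simp: agree_refl)
  have skipz: "?Q (s(''z6'' := (s ''z6'')(0 := x)))" if "scanned ph (Suc x) T"
  proof -
    have "core (s(''z6'' := (s ''z6'')(0 := x))) T D" using cr by (simp add: core_def)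
    then show ?thesis using that by (auto simp: agree_upd agree_refl)
  qed
  have xW: "x \<le> W" using x W by linarith
  have add: "wp W add_z ?Q t" if t: "agree {''z6'', ''out''} t s" "t ''z6'' 0 = x" and "x mod n \<notin> T"
    and l: "label_inv (t ''out'') (insert (x mod n) T) D'" "tree_inv (t ''out'') (insert (x mod n) T)" for t D'
  proof (rule wp_mono[OF core_add[OF _ cr l _ _ _ t(2) x(2) that(3) W]])
    show "setup_ok t" using ok by (rule setup_ok_agree) (use t in \<open>auto simp: agree_def\<close>)
    show E: "t ''T'' = s ''T''" "t ''q'' = s ''q''" "t ''qt'' = s ''qt''" by (simp_all add: agreeD[OF t(1)])
    fix s' assume S: "agree {''T'', ''q'', ''qt''} s' t \<and> core s' (insert (x mod n) T) D' \<and>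
      (\<forall>j < t ''qt'' 0. s' ''q'' j = t ''q'' j) \<and> t ''qt'' 0 \<le> s' ''qt'' 0"
    have "scanned ph (Suc x) (insert (x mod n) T)"
      using sc unfolding scanned_def by (auto simp: less_Suc_eq)
    moreover have "T \<subseteq> insert (x mod n) T" by auto
    moreover have "agree {''T'', ''q'', ''qt'', ''out'', ''z6''} s' s" using S t(1) by (simp add: agree_def)
    ultimately show "?Q s'" using S unfolding E by blast
  qed
  have "wp W (If (And (Equal (Cell ''w'' (sc ''x6'')) (Const 3)) (Equal (Cell ''T'' (sc ''x6'')) (Const 0)))
      (setv ''z6'' (sc ''x6'') ;;
       If (Equal (Cell ''real'' (sc ''z6'')) (Const 0)) add_z
        (If (Equal (sc ''ph'') (Const 0)) Skip
          (If (Equal (sc ''ph'') (Const 1))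
            (If (Equal (Cell ''su'' (Cell ''su'' (Cell ''su'' (sc ''z6'')))) (sc ''z6'')) Skip
              (Assign ''out'' (Cell ''ei'' (Cell ''su'' (sc ''z6''))) (Const 3) ;; add_z))
            (If (Less (Cell ''part'' (Cell ''ei'' (sc ''z6''))) (Const 2))
               (Assign ''out'' (Cell ''ei'' (sc ''z6'')) (Plus (Cell ''part'' (Cell ''ei'' (sc ''z6''))) (Const 1)))
               (Assign ''out'' (Cell ''ei'' (sc ''z6'')) (Const 0)) ;;
             add_z))))
      Skip) ?Q s"
  proof (cases "mt x \<and> x mod n \<notin> T")
    case False
    have "scanned ph (Suc x) T" using sc False unfolding scanned_def rp_def by (auto simp: less_Suc_eq)
    then have "?Q s" by (rule skip)
    then show ?thesis using False V(1) Tx x(1) by auto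
  next
    case A: True
    let ?s1 = "s(''z6'' := (s ''z6'')(0 := x))"
    show ?thesis
    proof (cases "rl x")
      case False
      have "\<And>y. rp y \<Longrightarrow> y mod n \<noteq> x mod n"
      proof
        fix y assume "rp y" "y mod n = x mod n"
        then have "y = x" using mt_vertex[OF x(2)] A x(2) by (auto simp: rp_def)
        then show False using \<open>rp y\<close> False by (simp add: rp_def)
      qed
      from label_inv_exposed[OF lab this] have l: "label_inv (s ''out'') (insert (x mod n) T) D" .
      have t: "tree_inv (s ''out'') (insert (x mod n) T)" by (rule tree_inv_source[OF tree cl]) simp
      have "wp W add_z ?Q ?s1"
        by (rule add) (use A l t in \<open>simp_all add: agree_upd agree_refl\<close>)
      then show ?thesis using A V Tx x(1) False xW by simp
    next
      case R: True
      then have rx: "rp x" using A x(2) by (simp add: rp_def)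
      have xK: "x \<in> K" using rp_K rx by simp
      have em: "ei x < m" using ei_less xK by simp
      have Z: "s ''T'' x = 0" "s ''w'' x = 3" "s ''real'' x = 1" using A R V Tx by simp_all
      consider "ph = 0" | "ph = 1" "su (su (su x)) = x" | "ph = 1" "su (su (su x)) \<noteq> x" | "ph = 2" using ph(2) by linarith
      then show ?thesis
      proof cases
        case 1
        then have "scanned ph (Suc x) T" using sc R unfolding scanned_def by (auto simp: less_Suc_eq)
        from skipz[OF this] show ?thesis using Z x(1) xW 1 ph(1) by simp
      next
        case 2
        then have "scanned ph (Suc x) T" using sc R unfolding scanned_def by (auto simp: less_Suc_eq)
        from skipz[OF this] show ?thesis using Z x(1) xW 2 ph(1) V(3) by simp
      next
        case 3
        have ex: "\<forall>x < 3 * n. mt x \<and> \<not> rl x \<longrightarrow> x mod n \<in> T" using sc 3(1) unfolding scanned_def by auto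
        have l: "label_inv ((s ''out'')(ei (su x) := 3)) (insert (x mod n) T) D"
          using label_inv_three[OF lab rx _ su_K[OF xK] cy_su[OF xK]] A by simp
        have t: "tree_inv ((s ''out'')(ei (su x) := 3)) (insert (x mod n) T)"
          using tree_inv_long[OF tree cl rx _ 3(2) ex] A by simp
        have "wp W add_z ?Q (?s1(''out'' := (s ''out'')(ei (su x) := 3)))"
          by (rule add) (use A l t in \<open>simp_all add: agree_upd agree_refl\<close>)
        moreover have "3 \<le> W" using W by simp
        ultimately show ?thesis using Z x(1) xW 3 ph(1) V(3,4) by simp
      next
        case 4
        have ex: "\<forall>x < 3 * n. mt x \<and> \<not> rl x \<longrightarrow> x mod n \<in> T" using sc 4 unfolding scanned_def by auto
        have lg: "\<forall>x. rp x \<and> su (su (su x)) \<noteq> x \<longrightarrow> x mod n \<in> T" using sc 4 unfolding scanned_def by auto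
        let ?o = "(s ''out'')(ei x := next_color (c (ei x)))"
        have l: "label_inv ?o (insert (x mod n) T) (insert x D)"
          using label_inv_kill[OF lab cl ex lg rx] A by simp
        have "next_color (c (ei x)) \<noteq> 3" using next_color_neq(2)[OF c_less[OF em]] by simp
        then have t: "tree_inv ?o (insert (x mod n) T)" by (intro tree_inv_source[OF tree cl]) auto
        have "wp W add_z ?Q (?s1(''out'' := ?o))"
          by (rule add) (use A l t in \<open>simp_all add: agree_upd agree_refl\<close>)
        moreover have "Suc (c (ei x)) \<le> W" using c_less[OF em] W by simp
        ultimately show ?thesis using Z x(1) xW 4 ph(1) V(4) V(5)[OF em]
          by (cases "c (ei x) < 2") (simp_all add: next_color_def)
      qed
    qed
  qed
  then have "wp W scan_step ?R s" unfolding scan_step_def wp_Seq_fun by (rule wp_mono) (rule fin)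
  then show ?thesis .
qed

lemma grow_correct:
  assumes ok0: "setup_ok s0" and out0: "\<forall>i<m. s0 ''out'' i = c i"
    and z0: "\<And>i. s0 ''T'' i = 0" "\<And>i. s0 ''qh'' i = 0" "\<And>i. s0 ''qt'' i = 0" "\<And>i. s0 ''ph'' i = 0" "\<And>i. s0 ''x6'' i = 0"
    and W: "10 * n + 10 * m + 10 \<le> W" and bd: "bounded W s0"
  shows "runs W (While (Less (sc ''ph'') (Const 3)) grow_body) s0 (1 + (12 * n + 3) * (1 + cost grow_body))
    (\<lambda>s. (\<forall>i<m. s ''out'' i < 4) \<and> (\<forall>k<3. forest {vedge i | i. i < m \<and> s ''out'' i = k}) \<and>
      forest {vedge i | i. i < m \<and> s ''out'' i = 3} \<and>
      (\<forall>p. card {i. i < m \<and> s ''out'' i = 3 \<and> p \<in> vedge i} \<le> 3))"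
proof -
  let ?N = "3 * n"
  define J where "J s T D \<longleftrightarrow> core s T D \<and> s ''qh'' 0 \<le> s ''qt'' 0 \<and>
    (\<forall>j < s ''qh'' 0. s ''q'' j \<in> K \<longrightarrow> (\<forall>y\<in>{su (s ''q'' j), pr (s ''q'' j)}. rp y \<longrightarrow> y mod n \<in> T)) \<and>
    s ''ph'' 0 \<le> 3 \<and> s ''x6'' 0 \<le> ?N \<and> scanned (s ''ph'' 0) (s ''x6'' 0) T" for s :: store and T D
  define I where "I s \<longleftrightarrow> agree grow_vars s s0 \<and> (\<exists>T D. J s T D)" for s
  \<comment> \<open>A phase takes \<open>3 * n\<close> scan steps and one step to begin the next;
    three phases and a queue of at most \<open>3 * n\<close> slots make
    \<open>12 * n + 3\<close>.\<close>
  define \<phi> where "\<phi> s = (?N - s ''qh'' 0) + (3 * (?N + 1) - (s ''ph'' 0 * (?N + 1) + s ''x6'' 0))" for s :: store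
  have "runs W (While (Less (sc ''ph'') (Const 3)) grow_body) s0 (1 + \<phi> s0 * (1 + cost grow_body))
     (\<lambda>s. I s \<and> \<not> bval (Less (sc ''ph'') (Const 3)) s)"
  proof (rule runs_While[OF _ bd])
    have l: "label_inv (s0 ''out'') {} {}" unfolding label_inv_def
    proof (intro conjI)
      have "\<forall>x. rp x \<longrightarrow> id x \<in> K \<and> cy (id x) = cy x" using rp_K by simp
      moreover have "{i. i < m \<and> s0 ''out'' i \<noteq> c i} = {}" using out0 by auto
      ultimately show "\<exists>rm. (\<forall>x. rp x \<longrightarrow> rm x \<in> K \<and> cy (rm x) = cy x) \<and>
        {i. i < m \<and> s0 ''out'' i \<noteq> c i} = ei ` rm ` {x. rp x \<and> x mod n \<in> {}}"
        by (intro exI[of _ id]) simp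
      show "{i. i < m \<and> s0 ''out'' i \<noteq> c i \<and> s0 ''out'' i \<noteq> 3} = ei ` {}" using out0 by auto
    qed auto
    have "{vedge i | i. i < m \<and> s0 ''out'' i = 3} = {}" using out0 c_less by fastforce
    moreover have "forest {}" using cycle_edges_nonempty by (fastforce simp: forest_def is_cycle_def)
    moreover have "closed {}" by (simp add: closed_def)
    ultimately have t: "tree_inv (s0 ''out'') {}" unfolding tree_inv_def tree_parts_def
      by (intro exI[of _ "{}"]) simp
    have "core s0 {} {}" unfolding core_def using l t z0 by (simp add: queue_inv_def)
    moreover have "scanned 0 0 {}" by (simp add: scanned_def)
    ultimately have "J s0 {} {}" unfolding J_def using z0 by simp
    then show "I s0" by (auto simp: I_def agree_refl)
    fix s assume s: "I s" "bval (Less (sc ''ph'') (Const 3)) s" "bounded W s"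
    then have ag: "agree grow_vars s s0" by (simp add: I_def)
    have ok: "setup_ok s" using setup_ok_agree[OF ok0 ag] .
    obtain T D where J: "J s T D" using s by (auto simp: I_def)
    then have cr: "core s T D" and sc': "scanned (s ''ph'' 0) (s ''x6'' 0) T" by (simp_all add: J_def)
    have PR: "y mod n \<in> T" if "j < s ''qh'' 0" "s ''q'' j \<in> K" "y \<in> {su (s ''q'' j), pr (s ''q'' j)}" "rp y" for j y
    proof -
      have "\<forall>j < s ''qh'' 0. s ''q'' j \<in> K \<longrightarrow> (\<forall>y\<in>{su (s ''q'' j), pr (s ''q'' j)}. rp y \<longrightarrow> y mod n \<in> T)"
        using J unfolding J_def by (elim conjE)
      then show ?thesis using that by blast
    qed
    have Q: "queue_inv T (s ''T'') (s ''q'') (s ''qt'' 0)" using cr by (simp add: core_def)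
    have bW: "s x i \<le> W" for x i using s(3) by (simp add: bounded_def)
    have ph: "s ''ph'' 0 < 3" using s(2) by simp
    let ?h = "s ''qh'' 0"
    define I' where "I' s' \<longleftrightarrow> I s' \<and> \<phi> s' < \<phi> s" for s'
    show "wp W grow_body (\<lambda>s'. I s' \<and> \<phi> s' < \<phi> s) s"
    proof (cases "?h < s ''qt'' 0")
      case True
      let ?x = "s ''q'' ?h"
      have x: "?x < ?N" "?x mod n \<in> T" using Q True unfolding queue_inv_def by blast+
      have hN: "?h < ?N" using True queue_inv_bound[OF Q] by simp
      have V: "(s ''deg'' ?x = 2) = (?x \<in> K)" "s ''su'' = su" "s ''pr'' = pr" "s ''ei'' = ei"
        using ok x by (auto simp: setup_ok_def)
      have fin: "I' s'" if t: "agree {''t6'', ''qh'', ''z6'', ''e6'', ''T'', ''q'', ''qt'', ''out''} s' s" "s' ''qh'' 0 = Suc ?h"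
        and T': "T \<subseteq> T'" "core s' T' D" "?x \<in> K \<longrightarrow> (\<forall>y\<in>{su ?x, pr ?x}. rp y \<longrightarrow> y mod n \<in> T')"
        and q': "\<forall>j < s ''qt'' 0. s' ''q'' j = s ''q'' j" "s ''qt'' 0 \<le> s' ''qt'' 0" for s' T'
      proof -
        have E: "s' ''ph'' = s ''ph''" "s' ''x6'' = s ''x6''" by (simp_all add: agreeD[OF t(1)])
        have "J s' T' D" unfolding J_def E t(2)
        proof (intro conjI allI impI)
          fix j assume j: "j < Suc ?h" "s' ''q'' j \<in> K"
          then have eq: "s' ''q'' j = s ''q'' j" using q' True by simp
          show "\<forall>y\<in>{su (s' ''q'' j), pr (s' ''q'' j)}. rp y \<longrightarrow> y mod n \<in> T'"
          proof (cases "j = ?h")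
            case True
            then show ?thesis using T'(3) j(2) unfolding eq by simp
          next
            case False
            then have "j < ?h" using j(1) by simp
            then show ?thesis using PR[of j] T'(1) j(2) unfolding eq by blast
          qed
        next
          show "Suc ?h \<le> s' ''qt'' 0" using q'(2) True by simp
          show "scanned (s ''ph'' 0) (s ''x6'' 0) T'" using scanned_mono[OF sc' T'(1)] .
        qed (use J T' in \<open>simp_all add: J_def\<close>)
        moreover have "\<phi> s' < \<phi> s" using hN unfolding \<phi>_def E t(2) by simp
        moreover have "agree grow_vars s' s0" using t(1) ag by (simp add: agree_def)
        ultimately show ?thesis unfolding I'_def I_def by blast
      qed
      have hW: "Suc ?h \<le> W" using hN W by linarith
      let ?s1 = "s(''t6'' := (s ''t6'')(0 := ?x), ''qh'' := (s ''qh'')(0 := Suc ?h))"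
      show ?thesis
      proof (cases "?x \<in> K")
        case False
        have "core ?s1 T D" using cr by (simp add: core_def)
        then have "I' ?s1" using False by (intro fin[of _ T]) (simp_all add: agree_upd agree_refl)
        then show ?thesis unfolding I'_def[symmetric] grow_body_def
          using True False V hW bW by simp
      next
        case xK: True
        let ?s2 = "?s1(''z6'' := (s ''z6'')(0 := su ?x), ''e6'' := (s ''e6'')(0 := ei ?x))"
        have "agree grow_vars ?s2 s" by (simp add: agree_upd agree_refl)
        then have ok2: "setup_ok ?s2" using setup_ok_agree[OF ok] by blast
        have cr2: "core ?s2 T D" using cr by (simp add: core_def)
        have "wp W check_z (\<lambda>s'. agree {''T'', ''q'', ''qt'', ''out''} s' ?s2 \<and> (\<exists>T'. T \<subseteq> T' \<and> core s' T' D \<and>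
          (rp (su ?x) \<longrightarrow> su ?x mod n \<in> T')) \<and> (\<forall>j < ?s2 ''qt'' 0. s' ''q'' j = ?s2 ''q'' j) \<and> ?s2 ''qt'' 0 \<le> s' ''qt'' 0) ?s2"
          by (rule wp_check_z[OF ok2 cr2 _ su_K[OF xK] _ xK x(2) _ W, where i = "ei ?x"]) simp_all
        then have "wp W check_z (wp W (setv ''z6'' (Cell ''pr'' (sc ''t6'')) ;; setv ''e6'' (Cell ''ei'' (sc ''z6'')) ;; check_z) I') ?s2"
        proof (rule wp_mono)
          fix t assume t: "agree {''T'', ''q'', ''qt'', ''out''} t ?s2 \<and> (\<exists>T'. T \<subseteq> T' \<and> core t T' D \<and>
            (rp (su ?x) \<longrightarrow> su ?x mod n \<in> T')) \<and> (\<forall>j < ?s2 ''qt'' 0. t ''q'' j = ?s2 ''q'' j) \<and> ?s2 ''qt'' 0 \<le> t ''qt'' 0"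
          then obtain T1 where T1: "T \<subseteq> T1" "core t T1 D" "rp (su ?x) \<longrightarrow> su ?x mod n \<in> T1" by blast
          have agt: "agree {''T'', ''q'', ''qt'', ''out''} t ?s2" using t by blast
          have Et: "t ''pr'' = pr" "t ''ei'' = ei" "t ''t6'' 0 = ?x" "t ''qh'' 0 = Suc ?h"
            by (simp_all add: agreeD[OF agt] V)
          let ?t2 = "t(''z6'' := (t ''z6'')(0 := pr ?x), ''e6'' := (t ''e6'')(0 := ei (pr ?x)))"
          have agt2: "agree {''t6'', ''qh'', ''z6'', ''e6'', ''T'', ''q'', ''qt'', ''out''} ?t2 s"
            using agt by (simp add: agree_def)
          then have "agree grow_vars ?t2 s" by (simp add: agree_def)
          then have okt: "setup_ok ?t2" using setup_ok_agree[OF ok] by blast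
          have crt: "core ?t2 T1 D" using T1 by (simp add: core_def)
          have xT1: "?x mod n \<in> T1" using x T1 by blast
          have "wp W check_z (\<lambda>s'. agree {''T'', ''q'', ''qt'', ''out''} s' ?t2 \<and> (\<exists>T'. T1 \<subseteq> T' \<and> core s' T' D \<and>
            (rp (pr ?x) \<longrightarrow> pr ?x mod n \<in> T')) \<and> (\<forall>j < ?t2 ''qt'' 0. s' ''q'' j = ?t2 ''q'' j) \<and> ?t2 ''qt'' 0 \<le> s' ''qt'' 0) ?t2"
            by (rule wp_check_z[OF okt crt _ pr_K[OF xK] _ xK xT1 _ W, where i = "ei (pr ?x)"]) simp_all
          then have "wp W check_z I' ?t2"
          proof (rule wp_mono)
            fix s' assume S: "agree {''T'', ''q'', ''qt'', ''out''} s' ?t2 \<and> (\<exists>T'. T1 \<subseteq> T' \<and> core s' T' D \<and>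
              (rp (pr ?x) \<longrightarrow> pr ?x mod n \<in> T')) \<and> (\<forall>j < ?t2 ''qt'' 0. s' ''q'' j = ?t2 ''q'' j) \<and> ?t2 ''qt'' 0 \<le> s' ''qt'' 0"
            then obtain T2 where T2: "T1 \<subseteq> T2" "core s' T2 D" "rp (pr ?x) \<longrightarrow> pr ?x mod n \<in> T2" by blast
            have ags: "agree {''T'', ''q'', ''qt'', ''out''} s' ?t2" using S by blast
            show "I' s'"
            proof (rule fin)
              show "agree {''t6'', ''qh'', ''z6'', ''e6'', ''T'', ''q'', ''qt'', ''out''} s' s"
                using ags agt2 by (simp add: agree_def)
              show "s' ''qh'' 0 = Suc ?h" using Et by (simp add: agreeD[OF ags])
              show "T \<subseteq> T2" using T1 T2 by blast
              show "?x \<in> K \<longrightarrow> (\<forall>y\<in>{su ?x, pr ?x}. rp y \<longrightarrow> y mod n \<in> T2)" using T1 T2 by blast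
              show "\<forall>j < s ''qt'' 0. s' ''q'' j = s ''q'' j" "s ''qt'' 0 \<le> s' ''qt'' 0" using S t by simp_all
            qed (rule T2(2))
          qed
          moreover have "pr ?x \<le> W" "ei (pr ?x) \<le> W" using bW V by metis+
          ultimately show "wp W (setv ''z6'' (Cell ''pr'' (sc ''t6'')) ;; setv ''e6'' (Cell ''ei'' (sc ''z6'')) ;; check_z) I' t"
            by (simp add: Et)
        qed
        moreover have "su ?x \<le> W" "ei ?x \<le> W" using bW V by metis+
        ultimately show ?thesis unfolding I'_def[symmetric] grow_body_def
          using True xK V hW bW by (simp add: wp_Seq_fun)
      qed
    next
      case False
      then have hq: "?h = s ''qt'' 0" using J by (simp add: J_def)
      \<comment> \<open>The queue is exhausted, so both neighbours of every slot over
        \<open>T\<close> have been inspected, and a representative outside \<open>T\<close> among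
        them would have been added.\<close>
      have cl: "closed T" unfolding closed_def
      proof (intro allI impI)
        fix y assume y: "rp y \<and> y mod n \<notin> T"
        have yK: "y \<in> K" using y rp_K by blast
        have "z mod n \<notin> T" if z: "z \<in> K" "y \<in> {su z, pr z}" for z
        proof
          assume "z mod n \<in> T"
          then have "z \<in> s ''q'' ` {..<?h}" using Q hq K_less[OF z(1)] by (simp add: queue_inv_def)
          then obtain j where "j < ?h" "z = s ''q'' j" by auto
          then show False using PR[of j y] z y by blast
        qed
        then show "su y mod n \<notin> T \<and> pr y mod n \<notin> T"
          using su_K[OF yK] pr_K[OF yK] pr_su[OF yK] su_pr[OF yK] by (metis insertCI)
      qed
      show ?thesis
      proof (cases "s ''x6'' 0 < ?N")
        case True
        have "wp W scan_step I' s"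
        proof (rule wp_mono[OF wp_scan_step[OF ok cr cl refl True refl ph sc' W s(3)]])
          fix s' assume S: "agree {''T'', ''q'', ''qt'', ''out'', ''z6'', ''x6''} s' s \<and> s' ''x6'' 0 = Suc (s ''x6'' 0) \<and>
            (\<exists>T' D'. T \<subseteq> T' \<and> core s' T' D' \<and> scanned (s ''ph'' 0) (Suc (s ''x6'' 0)) T') \<and>
            (\<forall>j < s ''qt'' 0. s' ''q'' j = s ''q'' j) \<and> s ''qt'' 0 \<le> s' ''qt'' 0"
          then obtain T' D' where T': "T \<subseteq> T'" "core s' T' D'" "scanned (s ''ph'' 0) (Suc (s ''x6'' 0)) T'" by blast
          have ags: "agree {''T'', ''q'', ''qt'', ''out'', ''z6'', ''x6''} s' s" using S by blast
          have E: "s' ''ph'' = s ''ph''" "s' ''qh'' = s ''qh''" by (simp_all add: agreeD[OF ags])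
          have x6: "s' ''x6'' 0 = Suc (s ''x6'' 0)" using S by blast
          have "J s' T' D'" unfolding J_def E x6
          proof (intro conjI allI impI)
            fix j assume j: "j < ?h" "s' ''q'' j \<in> K"
            then have eq: "s' ''q'' j = s ''q'' j" using S hq by simp
            show "\<forall>y\<in>{su (s' ''q'' j), pr (s' ''q'' j)}. rp y \<longrightarrow> y mod n \<in> T'"
              using PR[OF j(1)] T'(1) j(2) unfolding eq by blast
          next
            show "?h \<le> s' ''qt'' 0" using S hq by simp
          qed (use J T' True in \<open>simp_all add: J_def\<close>)
          moreover have "\<phi> s' < \<phi> s"
          proof -
            have "s ''ph'' 0 = 0 \<or> s ''ph'' 0 = 1 \<or> s ''ph'' 0 = 2" using ph by linarith
            then show ?thesis using True unfolding \<phi>_def E x6 by (elim disjE) simp_all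
          qed
          moreover have "agree grow_vars s' s0" using ags ag by (simp add: agree_def)
          ultimately show "I' s'" unfolding I'_def I_def by blast
        qed
        moreover have "s ''N'' 0 = ?N" using ok by (simp add: setup_ok_def)
        ultimately show ?thesis unfolding I'_def[symmetric] grow_body_def using False True by simp
      next
        case x6: False
        then have x6N: "s ''x6'' 0 = ?N" using J by (simp add: J_def)
        let ?s1 = "s(''x6'' := (s ''x6'')(0 := 0), ''ph'' := (s ''ph'')(0 := Suc (s ''ph'' 0)))"
        have "core ?s1 T D" using cr by (simp add: core_def)
        moreover have "scanned (Suc (s ''ph'' 0)) 0 T" using scanned_next sc' x6N by simp
        ultimately have "J ?s1 T D" using J ph by (simp add: J_def)
        moreover have "\<phi> ?s1 < \<phi> s"
        proof -
          have "s ''ph'' 0 = 0 \<or> s ''ph'' 0 = 1 \<or> s ''ph'' 0 = 2" using ph by linarith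
          then show ?thesis using x6N unfolding \<phi>_def by (elim disjE) simp_all
        qed
        moreover have "agree grow_vars ?s1 s0" using ag by (simp add: agree_def)
        ultimately have "I' ?s1" unfolding I'_def I_def by blast
        moreover have "s ''N'' 0 = ?N" "Suc (s ''ph'' 0) \<le> W" using ok ph W by (simp_all add: setup_ok_def)
        ultimately show ?thesis unfolding I'_def[symmetric] grow_body_def using False x6 by simp
      qed
    qed
  qed
  then show ?thesis
  proof (rule runs_mono)
    have "\<phi> s0 \<le> 12 * n + 3" using z0 unfolding \<phi>_def by simp
    then show "1 + \<phi> s0 * (1 + cost grow_body) \<le> 1 + (12 * n + 3) * (1 + cost grow_body)"
      by (meson add_left_mono mult_right_mono le0)
    fix s assume s: "I s \<and> \<not> bval (Less (sc ''ph'') (Const 3)) s"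
    then obtain T D where J: "J s T D" by (auto simp: I_def)
    then have cr: "core s T D" and "scanned 3 (s ''x6'' 0) T" using s by (auto simp: J_def)
    then have all: "x mod n \<in> T" if "x < 3 * n" "mt x" for x
      using that unfolding scanned_def rp_def by (cases "rl x") auto
    have Tn: "T \<subseteq> {..<n}" using cr by (simp add: core_def queue_inv_def)
    have T: "T = {..<n}"
    proof
      show "{..<n} \<subseteq> T"
      proof
        fix p assume p: "p \<in> {..<n}"
        then have "p < 3 * n" by simp
        then obtain y where "y < 3 * n" "y mod n = p mod n" "mt y" using mt_vertex by blast
        then show "p \<in> T" using all[of y] p by simp
      qed
    qed (rule Tn)
    have lab: "label_inv (s ''out'') {..<n} D" and tree: "tree_inv (s ''out'') {..<n}"
      using cr T by (simp_all add: core_def)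
    \<comment> \<open>\<open>T\<close> is now the whole vertex set, which is closed vacuously;
      \<open>tree_inv_closed\<close> absorbs the last pending link.\<close>
    have "closed {..<n}" unfolding closed_def by (auto simp: rp_def)
    then have "forest {vedge i | i. i < m \<and> s ''out'' i = 3}" using tree_inv_closed[OF tree] by blast
    then show "(\<forall>i<m. s ''out'' i < 4) \<and> (\<forall>k<3. forest {vedge i | i. i < m \<and> s ''out'' i = k}) \<and>
      forest {vedge i | i. i < m \<and> s ''out'' i = 3} \<and>
      (\<forall>p. card {i. i < m \<and> s ''out'' i = 3 \<and> p \<in> vedge i} \<le> 3)"
      using final_labels[OF lab] final_color_forest[OF lab] final_degree[OF lab] by blast
  qed
qed

end

section \<open>The complete program\<close>

definition zeroed :: "string set \<Rightarrow> store \<Rightarrow> bool" where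
  "zeroed X s \<longleftrightarrow> (\<forall>x\<in>X. \<forall>i. s x i = 0)"

lemma zeroed_agree: "zeroed X s \<Longrightarrow> agree Y s' s \<Longrightarrow> Z \<subseteq> X \<Longrightarrow> Z \<inter> Y = {} \<Longrightarrow> zeroed Z s'"
  unfolding zeroed_def agree_def by (metis disjoint_iff subsetD)

abbreviation "init_loop \<equiv> While (Less (sc ''i0'') (sc ''m'')) init_body"
abbreviation "peel_loop \<equiv> While (Less (sc ''x1'') (sc ''N'')) peel_body"
abbreviation "walk_loop \<equiv> While (Less (sc ''i2'') (sc ''m'')) walk_body"
abbreviation "group_loop \<equiv> While (Less (sc ''x3'') (sc ''N'')) group_body"
abbreviation "match_loop \<equiv> While (Less (sc ''i5'') (sc ''N'')) match_body"
abbreviation "grow_loop \<equiv> While (Less (sc ''ph'') (Const 3)) grow_body"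
abbreviation "set_N \<equiv> setv ''N'' (Plus (sc ''n'') (Plus (sc ''n'') (sc ''n'')))"

text \<open>These sets collect the arrays that the rest of the program expects to be zero. They are
  nested because the phases are composed from the last to the first.\<close>

definition grow_vars0 :: "string set" where
  "grow_vars0 = {''T'', ''qh'', ''qt'', ''ph'', ''x6''}"
definition match_vars0 :: "string set" where
  "match_vars0 = grow_vars0 \<union> {''i5'', ''md5'', ''p'', ''pos'', ''pe'', ''po''}"
definition group_vars0 :: "string set" where
  "group_vars0 = match_vars0 \<union> {''x3'', ''g'', ''par''}"
definition walk_vars0 :: "string set" where
  "walk_vars0 = group_vars0 \<union> {''i2'', ''md2'', ''real''}"
definition peel_vars0 :: "string set" where
  "peel_vars0 = walk_vars0 \<union> {''x1'', ''y1'', ''rem''}"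
definition init_vars0 :: "string set" where
  "init_vars0 = peel_vars0 \<union> {''i0'', ''deg'', ''S''}"

lemmas vars0_defs = grow_vars0_def match_vars0_def group_vars0_def walk_vars0_def peel_vars0_def init_vars0_def

text \<open>The summand 10 covers the initial assignment and one unit for each of the six
  loops.\<close>

definition total_cost :: nat where
  "total_cost = cost init_body + cost peel_body + cost walk_body + cost group_body + cost match_body + cost grow_body + 10"

context pseudo_graph
begin

definition good_output :: "(nat \<Rightarrow> nat) \<Rightarrow> bool" where
  "good_output out \<longleftrightarrow> (\<forall>i<m. out i < 4) \<and> (\<forall>k<4. forest {vedge i | i. i < m \<and> out i = k}) \<and>
    (\<forall>p. card {i. i < m \<and> out i = 3 \<and> p \<in> vedge i} \<le> 3)"

definition cycles_found :: "nat set \<Rightarrow> (nat \<Rightarrow> nat) \<Rightarrow> nat set \<Rightarrow> store \<Rightarrow> bool" where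
  "cycles_found al cy R s \<longleftrightarrow> al \<subseteq> {..<m} \<and> (\<forall>C. is_cycle sgraph C \<longrightarrow> C \<subseteq> sedge ` al) \<and>
    cyc_cert al {x. s ''deg'' x = 2} (s ''su'') (s ''pr'') (s ''ei'') cy R (s ''rot'') \<and>
    (\<forall>x. s ''real'' x = (if x \<in> R then 1 else 0)) \<and> al \<subseteq> s ''ei'' ` {x. s ''deg'' x = 2}"

text \<open>A cycle survives in \<open>al\<close>, so it contains the edge \<open>ei x\<close> of
  some slot; it then shares \<open>x\<close> with the orbit of \<open>x\<close>, and cycles with a
  common slot coincide.\<close>

lemma cycles_found_structure:
  assumes "cycles_found al cy R s"
  shows "cycle_structure n m u v c {x. s ''deg'' x = 2} (s ''su'') (s ''pr'') (s ''ei'') cy"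
proof -
  let ?K = "{x. s ''deg'' x = 2}" and ?ei = "s ''ei''"
  have al: "al \<subseteq> {..<m}" "\<And>C. is_cycle sgraph C \<Longrightarrow> C \<subseteq> sedge ` al" "al \<subseteq> ?ei ` ?K"
    and cert: "cyc_cert al ?K (s ''su'') (s ''pr'') ?ei cy R (s ''rot'')"
    using assms unfolding cycles_found_def by blast+
  have Kn: "?K \<subseteq> {..<3 * n}" and inj: "inj_on ?ei ?K" and B: "\<And>x. x \<in> ?K \<Longrightarrow> s ''su'' x \<in> ?K \<and> s ''pr'' x \<in> ?K \<and>
      s ''pr'' (s ''su'' x) = x \<and> s ''su'' (s ''pr'' x) = x \<and> cy (s ''su'' x) = cy x \<and>
      ?ei x \<in> al \<and> sedge (?ei x) = {x, s ''su'' x} \<and> is_cycle sgraph (sedge ` ?ei ` {y \<in> ?K. cy y = cy x})"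
    using cert unfolding cyc_cert_def by blast+
  show ?thesis
  proof unfold_locales
    fix C assume C: "is_cycle sgraph C"
    obtain e where "e \<in> C" using cycle_edges_nonempty[OF C] by auto
    then obtain x where x: "x \<in> ?K" "e = sedge (?ei x)" using al(2)[OF C] al(3) by blast
    then have "x \<in> \<Union>C" using \<open>e \<in> C\<close> B[OF x(1)] by auto
    moreover have "x \<in> \<Union>(sedge ` ?ei ` {y \<in> ?K. cy y = cy x})" using x(1) B[OF x(1)] by auto
    ultimately have "C = sedge ` ?ei ` {y \<in> ?K. cy y = cy x}"
      using cycles_connected[OF C _ _ _ rtrancl_refl, of "sedge ` ?ei ` {y \<in> ?K. cy y = cy x}" x] B[OF x(1)] by blast
    then show "\<exists>x\<in>?K. C = sedge ` ?ei ` {y \<in> ?K. cy y = cy x}" using x(1) by blast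
  next
    fix x assume x: "x \<in> ?K"
    show "s ''su'' x \<in> ?K" "s ''pr'' x \<in> ?K" "s ''pr'' (s ''su'' x) = x" "s ''su'' (s ''pr'' x) = x"
      "cy (s ''su'' x) = cy x" "sedge (?ei x) = {x, s ''su'' x}" "is_cycle sgraph (sedge ` ?ei ` {y \<in> ?K. cy y = cy x})"
      using B[OF x] by blast+
    show "x < 3 * n" using Kn x by blast
    show "?ei x < m" using B[OF x] al(1) by blast
  qed (rule inj)
qed

text \<open>Integral balanced weights put exactly one 3 into each block: in a block of
  \<open>vr\<close> the matched slot of a vertex, in a block of \<open>rot\<close> inside
  \<open>R\<close> the representative of a cycle.\<close>

lemma matched_growth:
  assumes cf: "cycles_found al cy R s" and rot: "ring3 (3 * n) (s ''rot'')"
    and vr0: "\<forall>x < 3 * n. s ''vr'' x = vr x"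
    and bal: "balanced (3 * n) (s ''vr'') w" "balanced (3 * n) (s ''rot'') w" and fr: "\<forall>x < 3 * n. \<not> frac w x"
  shows "growth n m u v c {x. s ''deg'' x = 2} (s ''su'') (s ''pr'') (s ''ei'') cy (\<lambda>x. w x = 3) (\<lambda>x. x \<in> R)"
proof -
  let ?K = "{x. s ''deg'' x = 2}" and ?rot = "s ''rot''"
  interpret cycle_structure n m u v c ?K "s ''su''" "s ''pr''" "s ''ei''" cy
    by (rule cycles_found_structure[OF cf])
  have R: "R \<subseteq> ?K" and RB: "\<And>x. x \<in> R \<Longrightarrow> ?rot x \<in> R \<and> cy (?rot x) = cy x \<and> (\<forall>y\<in>R. cy y = cy x \<longrightarrow> y = x \<or> y = ?rot x \<or> y = ?rot (?rot x))"
    and RK: "\<And>x. x \<in> ?K \<Longrightarrow> \<exists>y\<in>R. cy y = cy x"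
    using cf unfolding cycles_found_def cyc_cert_def by blast+
  have ringv: "ring3 (3 * n) (s ''vr'')" using vr0 vr_less vr_neq vr_vr_vr unfolding ring3_def by simp
  show ?thesis
  proof unfold_locales
    fix x assume x: "x < 3 * n"
    obtain y where y: "y \<in> {x, s ''vr'' x, s ''vr'' (s ''vr'' x)}" "w y = 3"
      "\<forall>z\<in>{x, s ''vr'' x, s ''vr'' (s ''vr'' x)}. w z = 3 \<longrightarrow> z = y"
      using balanced_integral[OF ringv bal(1) _ x] fr by blast
    have eq: "{x, s ''vr'' x, s ''vr'' (s ''vr'' x)} = {z. z < 3 * n \<and> z mod n = x mod n}"
      using same_vertex_iff[OF x] vr0 vr_less x vr_mod by (auto; metis)
    show "\<exists>!y. y < 3 * n \<and> y mod n = x mod n \<and> w y = 3"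
    proof (rule ex1I[of _ y])
      have "y \<in> {z. z < 3 * n \<and> z mod n = x mod n}" using y(1) unfolding eq .
      then show "y < 3 * n \<and> y mod n = x mod n \<and> w y = 3" using y(2) by simp
      fix z assume z: "z < 3 * n \<and> z mod n = x mod n \<and> w z = 3"
      then have "z \<in> {x, s ''vr'' x, s ''vr'' (s ''vr'' x)}" unfolding eq by simp
      then show "z = y" using y(3) z by blast
    qed
  next
    fix x assume "x < 3 * n" "x \<in> R" then show "x \<in> ?K" using R by blast
  next
    fix x assume x: "x \<in> ?K"
    obtain r where r: "r \<in> R" "cy r = cy x" using RK[OF x] by blast
    have "r < 3 * n" using r R K_less by blast
    then obtain y where y: "y \<in> {r, ?rot r, ?rot (?rot r)}" "w y = 3"
      "\<forall>z\<in>{r, ?rot r, ?rot (?rot r)}. w z = 3 \<longrightarrow> z = y"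
      using balanced_integral[OF rot bal(2)] fr by blast
    have r2: "?rot r \<in> R" "?rot (?rot r) \<in> R" "cy (?rot r) = cy x" "cy (?rot (?rot r)) = cy x"
      using RB r by metis+
    show "\<exists>!y. y \<in> ?K \<and> cy y = cy x \<and> w y = 3 \<and> y \<in> R"
    proof (rule ex1I[of _ y])
      show "y \<in> ?K \<and> cy y = cy x \<and> w y = 3 \<and> y \<in> R" using y(1,2) r r2 R by auto
      fix z assume z: "z \<in> ?K \<and> cy z = cy x \<and> w z = 3 \<and> z \<in> R"
      then have "z \<in> {r, ?rot r, ?rot (?rot r)}" using RB[OF r(1)] r(2) by auto
      then show "z = y" using y(3) z by blast
    qed
  qed
qed

lemma cycles_found_cong:
  assumes "cycles_found al cy R s" "s' ''deg'' = s ''deg''" "s' ''su'' = s ''su''" "s' ''pr'' = s ''pr''" "s' ''ei'' = s ''ei''"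
    "s' ''real'' = s ''real''" "\<And>x. x \<in> R \<Longrightarrow> s' ''rot'' x = s ''rot'' x"
  shows "cycles_found al cy R s'"
proof -
  note F = assms(1)[unfolded cycles_found_def]
  then have cert: "cyc_cert al {x. s ''deg'' x = 2} (s ''su'') (s ''pr'') (s ''ei'') cy R (s ''rot'')"
    by (elim conjE)
  have "cyc_cert al {x. s ''deg'' x = 2} (s ''su'') (s ''pr'') (s ''ei'') cy R (s' ''rot'')"
    by (rule cyc_cert_rot_cong[OF cert assms(7)])
  then show ?thesis unfolding cycles_found_def assms(2-6) using F by (elim conjE) (intro conjI)
qed
lemma match_grow_correct:
  assumes bs: "basic s0" and cf: "cycles_found al cy R s0" and out: "\<forall>i<m. s0 ''out'' i = c i"
    and w0: "\<forall>x < 3 * n. s0 ''w'' x = 1 \<and> s0 ''vr'' x = vr x" and par: "\<forall>j \<le> 3 * n. s0 ''par'' j = j mod 2"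
    and rot: "ring3 (3 * n) (s0 ''rot'')" and z: "zeroed match_vars0 s0"
    and W: "10 * n + 10 * m + 10 \<le> W" and bd: "bounded W s0"
  shows "runs W (match_loop ;; grow_loop) s0 ((1 + 87 * n * (1 + cost match_body)) + (1 + (12 * n + 3) * (1 + cost grow_body)))
    (\<lambda>s. good_output (s ''out''))"
proof (rule runs_Seq[OF match_correct[OF _ _ _ _ _ _ _ _ _ par rot W bd]])
  fix s assume s: "agree {''i5'', ''md5'', ''p'', ''pos'', ''pe'', ''po'', ''st'', ''y5'', ''z5'', ''jj'', ''fl'', ''w''} s s0 \<and>
      balanced (3 * n) (s0 ''vr'') (s ''w'') \<and> balanced (3 * n) (s0 ''rot'') (s ''w'') \<and>
      (\<forall>x < 3 * n. \<not> frac (s ''w'') x)" and bds: "bounded W s"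
  then have ag: "agree {''i5'', ''md5'', ''p'', ''pos'', ''pe'', ''po'', ''st'', ''y5'', ''z5'', ''jj'', ''fl'', ''w''} s s0" by blast
  have E: "s ''N'' = s0 ''N''" "s ''part'' = s0 ''part''" "s ''su'' = s0 ''su''" "s ''pr'' = s0 ''pr''" "s ''ei'' = s0 ''ei''"
    "s ''deg'' = s0 ''deg''" "s ''real'' = s0 ''real''" "s ''vr'' = s0 ''vr''" "s ''out'' = s0 ''out''" "s ''rot'' = s0 ''rot''"
    by (simp_all add: agreeD[OF ag])
  let ?K = "{x. s0 ''deg'' x = 2}"
  interpret growth n m u v c ?K "s0 ''su''" "s0 ''pr''" "s0 ''ei''" cy "\<lambda>x. s ''w'' x = 3" "\<lambda>x. x \<in> R"
    by (rule matched_growth[OF cf rot]) (use s w0 in auto)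
  have zs: "zeroed grow_vars0 s" by (rule zeroed_agree[OF z ag]) (auto simp: vars0_defs)
  have "setup_ok s" unfolding setup_ok_def E
    using bs cf w0 by (simp add: basic_def cycles_found_def)
  then have "runs W grow_loop s (1 + (12 * n + 3) * (1 + cost grow_body))
    (\<lambda>s. (\<forall>i<m. s ''out'' i < 4) \<and> (\<forall>k<3. forest {vedge i | i. i < m \<and> s ''out'' i = k}) \<and>
      forest {vedge i | i. i < m \<and> s ''out'' i = 3} \<and>
      (\<forall>p. card {i. i < m \<and> s ''out'' i = 3 \<and> p \<in> vedge i} \<le> 3))"
    by (rule grow_correct[OF _ _ _ _ _ _ _ W bds]) (use out E zs in \<open>auto simp: zeroed_def vars0_defs\<close>)
  then show "runs W grow_loop s (1 + (12 * n + 3) * (1 + cost grow_body)) (\<lambda>s. good_output (s ''out''))"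
  proof (rule runs_mono)
    fix t :: store assume t: "(\<forall>i<m. t ''out'' i < 4) \<and> (\<forall>k<3. forest {vedge i | i. i < m \<and> t ''out'' i = k}) \<and>
      forest {vedge i | i. i < m \<and> t ''out'' i = 3} \<and>
      (\<forall>p. card {i. i < m \<and> t ''out'' i = 3 \<and> p \<in> vedge i} \<le> 3)"
    have "forest {vedge i | i. i < m \<and> t ''out'' i = k}" if "k < 4" for k :: nat
    proof (cases "k = 3")
      case True then show ?thesis using t by simp
    next
      case False
      then have "k < 3" using that by simp
      then show ?thesis using t by simp
    qed
    then show "good_output (t ''out'')" using t unfolding good_output_def by blast
  qed simp
qed (use bs w0 z in \<open>auto simp: basic_def zeroed_def vars0_defs\<close>)

lemma group_on_correct:
  assumes bs: "basic s0" and cf: "cycles_found al cy R s0" and out: "\<forall>i<m. s0 ''out'' i = c i"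
    and z: "zeroed group_vars0 s0"
    and W: "10 * n + 10 * m + 10 \<le> W" and bd: "bounded W s0"
  shows "runs W (group_loop ;; match_loop ;; grow_loop) s0 ((1 + 3 * n * (1 + cost group_body)) +
    ((1 + 87 * n * (1 + cost match_body)) + (1 + (12 * n + 3) * (1 + cost grow_body))))
    (\<lambda>s. good_output (s ''out''))"
proof (rule runs_Seq[OF group_correct[OF bs _ _ _ _ _ _ W bd]])
  have cert: "cyc_cert al {x. s0 ''deg'' x = 2} (s0 ''su'') (s0 ''pr'') (s0 ''ei'') cy R (s0 ''rot'')"
    using cf unfolding cycles_found_def by blast
  show "\<forall>x. s0 ''real'' x = (if x \<in> R then 1 else 0)" using cf unfolding cycles_found_def by blast
  show "R \<subseteq> {..<3 * n}" "3 dvd card R" using cert unfolding cyc_cert_def by blast+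
  fix s assume s: "agree {''x3'', ''g'', ''d1'', ''d2'', ''rot'', ''w'', ''vr'', ''par''} s s0 \<and>
      (\<forall>x\<in>R. s ''rot'' x = s0 ''rot'' x) \<and>
      (\<forall>x\<in>{..<3 * n} - R. s ''rot'' x \<in> {..<3 * n} - R \<and> s ''rot'' x \<noteq> x \<and> s ''rot'' (s ''rot'' x) \<noteq> x \<and>
        s ''rot'' (s ''rot'' (s ''rot'' x)) = x) \<and>
      (\<forall>x < 3 * n. s ''w'' x = 1 \<and> s ''vr'' x = vr x) \<and> (\<forall>j \<le> 3 * n. s ''par'' j = j mod 2)" and bds: "bounded W s"
  then have ag: "agree {''x3'', ''g'', ''d1'', ''d2'', ''rot'', ''w'', ''vr'', ''par''} s s0" by blast
  have RB: "\<And>x. x \<in> R \<Longrightarrow> s0 ''rot'' x \<in> R \<and> s0 ''rot'' x \<noteq> x \<and> s0 ''rot'' (s0 ''rot'' x) \<noteq> x \<and> s0 ''rot'' (s0 ''rot'' (s0 ''rot'' x)) = x"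
    using cert unfolding cyc_cert_def by blast
  have Rn: "R \<subseteq> {..<3 * n}" using cert unfolding cyc_cert_def by blast
  have "ring3 (3 * n) (s ''rot'')" unfolding ring3_def
  proof (intro allI impI)
    fix x assume x: "x < 3 * n"
    show "s ''rot'' x < 3 * n \<and> s ''rot'' x \<noteq> x \<and> s ''rot'' (s ''rot'' x) \<noteq> x \<and> s ''rot'' (s ''rot'' (s ''rot'' x)) = x"
    proof (cases "x \<in> R")
      case True
      have "s0 ''rot'' x \<in> R" "s0 ''rot'' (s0 ''rot'' x) \<in> R" using RB True by blast+
      then have "s ''rot'' x = s0 ''rot'' x" "s ''rot'' (s0 ''rot'' x) = s0 ''rot'' (s0 ''rot'' x)"
        "s ''rot'' (s0 ''rot'' (s0 ''rot'' x)) = s0 ''rot'' (s0 ''rot'' (s0 ''rot'' x))"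
        using s True by blast+
      then show ?thesis using RB[OF True] Rn by auto
    next
      case False
      then have "x \<in> {..<3 * n} - R" using x by simp
      then show ?thesis using s by blast
    qed
  qed
  moreover have "cycles_found al cy R s" by (rule cycles_found_cong[OF cf]) (use s in \<open>simp_all add: agreeD[OF ag]\<close>)
  moreover have "basic s" using bs by (simp add: basic_def agreeD[OF ag])
  moreover have "\<forall>i<m. s ''out'' i = c i" using out by (simp add: agreeD[OF ag])
  moreover have "zeroed match_vars0 s" by (rule zeroed_agree[OF z ag]) (auto simp: vars0_defs)
  ultimately show "runs W (match_loop ;; grow_loop) s
    ((1 + 87 * n * (1 + cost match_body)) + (1 + (12 * n + 3) * (1 + cost grow_body))) (\<lambda>s. good_output (s ''out''))"
    using s by (intro match_grow_correct[OF _ _ _ _ _ _ _ W bds]) blast+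
qed (use z in \<open>auto simp: zeroed_def vars0_defs\<close>)

lemma walk_on_correct:
  assumes ab: "basic_ab s0" and al: "al \<subseteq> {..<m}" and cn: "counts al (s0 ''deg'') (s0 ''S'')"
    and rem: "\<forall>i. s0 ''rem'' i = (if i < m \<and> i \<notin> al then 1 else 0)"
    and cyc: "\<forall>C. is_cycle sgraph C \<longrightarrow> C \<subseteq> sedge ` al"
    and no1: "\<forall>x < 3 * n. s0 ''deg'' x \<noteq> 1" and out: "\<forall>i<m. s0 ''out'' i = c i"
    and z: "zeroed walk_vars0 s0"
    and W: "10 * n + 10 * m + 10 \<le> W" and bd: "bounded W s0"
  shows "runs W (walk_loop ;; group_loop ;; match_loop ;; grow_loop) s0 ((1 + (3 * m + 1) * (1 + cost walk_body)) +
    ((1 + 3 * n * (1 + cost group_body)) +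
    ((1 + 87 * n * (1 + cost match_body)) + (1 + (12 * n + 3) * (1 + cost grow_body)))))
    (\<lambda>s. good_output (s ''out''))"
proof (rule runs_Seq[OF walk_correct[OF ab _ _ _ al cn rem no1 W bd]])
  let ?X = "{''i2'', ''md2'', ''cur'', ''e2'', ''k'', ''z2'', ''su'', ''pr'', ''ei'', ''rem'', ''f1'', ''f2'', ''rot'', ''real''}"
  fix s assume s: "agree ?X s s0 \<and>
      (\<exists>cy R. cyc_cert al {x. s ''deg'' x = 2} (s ''su'') (s ''pr'') (s ''ei'') cy R (s ''rot'') \<and>
        (\<forall>x. s ''real'' x = (if x \<in> R then 1 else 0)) \<and> al \<subseteq> s ''ei'' ` {x. s ''deg'' x = 2})" and bds: "bounded W s"
  then obtain cy R where "cyc_cert al {x. s ''deg'' x = 2} (s ''su'') (s ''pr'') (s ''ei'') cy R (s ''rot'')"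
    "\<forall>x. s ''real'' x = (if x \<in> R then 1 else 0)" "al \<subseteq> s ''ei'' ` {x. s ''deg'' x = 2}" by blast
  then have cf: "cycles_found al cy R s" unfolding cycles_found_def using al cyc by blast
  have ag: "agree ?X s s0" using s by blast
  show "runs W (group_loop ;; match_loop ;; grow_loop) s ((1 + 3 * n * (1 + cost group_body)) +
    ((1 + 87 * n * (1 + cost match_body)) + (1 + (12 * n + 3) * (1 + cost grow_body))))
    (\<lambda>s. good_output (s ''out''))"
  proof (rule group_on_correct[OF _ cf _ _ W bds])
    show "basic s" using ab by (simp add: basic_ab_def basic_def agreeD[OF ag])
    show "\<forall>i<m. s ''out'' i = c i" using out by (simp add: agreeD[OF ag])
    show "zeroed group_vars0 s" by (rule zeroed_agree[OF z ag]) (auto simp: vars0_defs)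
  qed
qed (use z in \<open>auto simp: zeroed_def vars0_defs\<close>)

lemma peel_on_correct:
  assumes ab: "basic_ab s0" and cn: "counts {..<m} (s0 ''deg'') (s0 ''S'')" and out: "\<forall>i<m. s0 ''out'' i = c i"
    and z: "zeroed peel_vars0 s0"
    and W: "10 * n + 10 * m + 10 \<le> W" and bd: "bounded W s0"
  shows "runs W (peel_loop ;; walk_loop ;; group_loop ;; match_loop ;; grow_loop) s0
    ((1 + (3 * n + m) * (1 + cost peel_body)) + ((1 + (3 * m + 1) * (1 + cost walk_body)) +
    ((1 + 3 * n * (1 + cost group_body)) +
    ((1 + 87 * n * (1 + cost match_body)) + (1 + (12 * n + 3) * (1 + cost grow_body))))))
    (\<lambda>s. good_output (s ''out''))"
proof (rule runs_Seq[OF peel_correct[OF ab _ _ _ cn W bd]])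
  let ?X = "{''x1'', ''y1'', ''e1'', ''z1'', ''deg'', ''S'', ''rem''}"
  fix s assume s: "agree ?X s s0 \<and>
      (\<exists>al \<subseteq> {..<m}. counts al (s ''deg'') (s ''S'') \<and>
        (\<forall>i. s ''rem'' i = (if i < m \<and> i \<notin> al then 1 else 0)) \<and>
        (\<forall>C. is_cycle sgraph C \<longrightarrow> C \<subseteq> sedge ` al) \<and> (\<forall>x < 3 * n. s ''deg'' x \<noteq> 1))" and bds: "bounded W s"
  then have ag: "agree ?X s s0" by blast
  obtain al where al: "al \<subseteq> {..<m}" "counts al (s ''deg'') (s ''S'')" "\<forall>i. s ''rem'' i = (if i < m \<and> i \<notin> al then 1 else 0)"
    "\<forall>C. is_cycle sgraph C \<longrightarrow> C \<subseteq> sedge ` al" "\<forall>x < 3 * n. s ''deg'' x \<noteq> 1" using s by blast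
  show "runs W (walk_loop ;; group_loop ;; match_loop ;; grow_loop) s ((1 + (3 * m + 1) * (1 + cost walk_body)) +
    ((1 + 3 * n * (1 + cost group_body)) +
    ((1 + 87 * n * (1 + cost match_body)) + (1 + (12 * n + 3) * (1 + cost grow_body)))))
    (\<lambda>s. good_output (s ''out''))"
  proof (rule walk_on_correct[OF _ al _ _ W bds])
    show "basic_ab s" using ab by (simp add: basic_ab_def basic_def agreeD[OF ag])
    show "\<forall>i<m. s ''out'' i = c i" using out by (simp add: agreeD[OF ag])
    show "zeroed walk_vars0 s" by (rule zeroed_agree[OF z ag]) (auto simp: vars0_defs)
  qed
qed (use z in \<open>auto simp: zeroed_def vars0_defs\<close>)

lemma program_correct:
  assumes inp: "s0 ''n'' 0 = n" "s0 ''m'' 0 = m" "\<forall>i<m. s0 ''u'' i = u i \<and> s0 ''v'' i = v i \<and> s0 ''part'' i = c i"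
    and z: "zeroed init_vars0 s0"
    and W: "10 * n + 10 * m + 10 \<le> W" and bd: "bounded W s0"
  shows "runs W (set_N ;; init_loop ;; peel_loop ;; walk_loop ;; group_loop ;; match_loop ;; grow_loop) s0
    (100 * total_cost * (n + m + 1)) (\<lambda>s. good_output (s ''out''))"
proof -
  let ?T = "(1 + (3 * n + m) * (1 + cost peel_body)) + ((1 + (3 * m + 1) * (1 + cost walk_body)) +
    ((1 + 3 * n * (1 + cost group_body)) +
    ((1 + 87 * n * (1 + cost match_body)) + (1 + (12 * n + 3) * (1 + cost grow_body)))))"
  have "runs W (set_N ;; init_loop ;; peel_loop ;; walk_loop ;; group_loop ;; match_loop ;; grow_loop) s0
    (cost set_N + ((1 + m * (1 + cost init_body)) + ?T)) (\<lambda>s. good_output (s ''out''))"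
  proof (rule runs_Seq[OF runs_wp[where Q = "\<lambda>s. s = s0(''N'' := (s0 ''N'')(0 := n + (n + n)))"]])
    show "wp W set_N (\<lambda>s. s = s0(''N'' := (s0 ''N'')(0 := n + (n + n)))) s0" using W inp(1) by simp
    fix s1 assume s1: "s1 = s0(''N'' := (s0 ''N'')(0 := n + (n + n)))" and bd1: "bounded W s1"
    have ag1: "agree {''N''} s1 s0" using s1 by (simp add: agree_def)
    have bs1: "basic s1" using inp s1 by (simp add: basic_def)
    have z1: "zeroed init_vars0 s1" by (rule zeroed_agree[OF z ag1]) (auto simp: vars0_defs)
    show "runs W (init_loop ;; peel_loop ;; walk_loop ;; group_loop ;; match_loop ;; grow_loop) s1
      ((1 + m * (1 + cost init_body)) + ?T) (\<lambda>s. good_output (s ''out''))"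
    proof (rule runs_Seq[OF init_correct[OF bs1 _ _ _ W bd1]])
      let ?X = "{''i0'', ''o'', ''a'', ''b'', ''out'', ''deg'', ''S''}"
      fix s assume s: "agree ?X s s1 \<and> basic_ab s \<and> counts {..<m} (s ''deg'') (s ''S'') \<and> (\<forall>i<m. s ''out'' i = c i)"
        and bds: "bounded W s"
      then have ag: "agree ?X s s1" by blast
      show "runs W (peel_loop ;; walk_loop ;; group_loop ;; match_loop ;; grow_loop) s ?T (\<lambda>s. good_output (s ''out''))"
      proof (rule peel_on_correct[OF _ _ _ _ W bds])
        show "zeroed peel_vars0 s" by (rule zeroed_agree[OF z1 ag]) (auto simp: vars0_defs)
      qed (use s in blast)+
    qed (use z1 in \<open>auto simp: zeroed_def vars0_defs\<close>)
  qed (rule bd)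
  then show ?thesis
  proof (rule runs_mono)
    let ?M = "n + m + 1"
    \<comment> \<open>90 covers the largest round count, \<open>87 * n\<close>; the remaining 10
      absorb the leading 1.\<close>
    have le: "1 + x * (1 + k) \<le> 100 * (k + 1) * ?M" if "x \<le> 90 * ?M" for x k
    proof -
      have "x * (1 + k) \<le> 90 * ?M * (1 + k)" using that by (rule mult_right_mono) simp
      moreover have "1 \<le> ?M * (1 + k)" by simp
      ultimately show ?thesis by (simp add: algebra_simps)
    qed
    have "cost set_N + ((1 + m * (1 + cost init_body)) + ?T) \<le> 100 * ?M +
      (100 * (cost init_body + 1) * ?M + (100 * (cost peel_body + 1) * ?M + (100 * (cost walk_body + 1) * ?M +
      (100 * (cost group_body + 1) * ?M + (100 * (cost match_body + 1) * ?M + 100 * (cost grow_body + 1) * ?M)))))"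
      by (intro add_mono le) simp_all
    also have "\<dots> \<le> 100 * total_cost * ?M" unfolding total_cost_def by (simp add: algebra_simps)
    finally show "cost set_N + ((1 + m * (1 + cost init_body)) + ?T) \<le> 100 * total_cost * ?M" .
  qed
qed

end

section \<open>From the given graph to slots and back\<close>

lemma pseudoforest_cycles_connected:
  assumes pf: "pseudoforest V E" and V: "\<Union>E \<subseteq> V"
    and C: "is_cycle E C1" "is_cycle E C2" and xy: "x \<in> \<Union>C1" "y \<in> \<Union>C2" "(x, y) \<in> (adj_rel E)\<^sup>*"
  shows "C1 = C2"
proof -
  let ?R = "{(p, q). p \<in> V \<and> q \<in> V \<and> (p, q) \<in> {(x, y). {x, y} \<in> E}\<^sup>*}"
  let ?K = "?R `` {x}"
  have CE: "C1 \<subseteq> E" "C2 \<subseteq> E" using C by (auto simp: is_cycle_def)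
  have xV: "x \<in> V" using xy(1) CE V by blast
  then have "?K \<in> components V E" unfolding components_def by (rule quotientI)
  then have uniq: "\<exists>\<^sub>\<le>\<^sub>1 C. is_cycle {e \<in> E. e \<subseteq> ?K} C" using pf unfolding pseudoforest_def by blast
  have K: "z \<in> ?K" if "(x, z) \<in> (adj_rel E)\<^sup>*" "z \<in> V" for z using that xV by (simp add: adj_rel_def)
  \<comment> \<open>A cycle is connected, so it lies entirely in any component that it
    meets.\<close>
  have in_K: "C \<subseteq> {e \<in> E. e \<subseteq> ?K}" if "is_cycle E C" "z \<in> \<Union>C" "(x, z) \<in> (adj_rel E)\<^sup>*" for C z
  proof
    fix e assume e: "e \<in> C"
    have CE: "C \<subseteq> E" using that by (auto simp: is_cycle_def)
    have "w \<in> ?K" if "w \<in> e" for w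
    proof (rule K)
      have "(z, w) \<in> (adj_rel C)\<^sup>*" using cycle_connected[OF \<open>is_cycle E C\<close> \<open>z \<in> \<Union>C\<close>] e that by blast
      then have "(z, w) \<in> (adj_rel E)\<^sup>*" using adj_rel_mono[OF CE] by blast
      then show "(x, w) \<in> (adj_rel E)\<^sup>*" using \<open>(x, z) \<in> (adj_rel E)\<^sup>*\<close> by (meson rtrancl_trans)
      show "w \<in> V" using V CE e that by blast
    qed
    then show "e \<in> {e \<in> E. e \<subseteq> ?K}" using e CE by blast
  qed
  have "is_cycle {e \<in> E. e \<subseteq> ?K} C1" using is_cycle_restrict[OF C(1) in_K[OF C(1) xy(1) rtrancl_refl]] .
  moreover have "is_cycle {e \<in> E. e \<subseteq> ?K} C2" using is_cycle_restrict[OF C(2) in_K[OF C(2) xy(2,3)]] .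
  ultimately show ?thesis using uniq by (simp add: Uniq_def)
qed

text \<open>The inverse renaming maps a cycle of the image back into \<open>G\<close>.\<close>

lemma forest_image:
  assumes "forest G" "inj_on f (\<Union>G)"
  shows "forest ((`) f ` G)"
  unfolding forest_def
proof (rule notI, elim exE)
  fix C assume C: "is_cycle ((`) f ` G) C"
  let ?g = "the_inv_into (\<Union>G) f"
  have U: "\<Union>((`) f ` G) = f ` \<Union>G" by blast
  have "inj_on ?g (\<Union>((`) f ` G))" unfolding U using inj_on_the_inv_into[OF assms(2)] .
  from is_cycle_image[OF C this] have "is_cycle ((`) ?g ` (`) f ` G) ((`) ?g ` C)" .
  moreover have "?g ` f ` e = e" if "e \<in> G" for e
  proof -
    have "?g (f x) = x" if "x \<in> e" for x
      using the_inv_into_f_f[OF assms(2)] that \<open>e \<in> G\<close> by blast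
    then show ?thesis by (simp add: image_image)
  qed
  then have "(`) ?g ` (`) f ` G = G" by (simp add: image_image)
  ultimately show False using assms(1) unfolding forest_def by auto
qed

locale partition_input =
  fixes vs :: "'a list" and es :: "'a set list" and V :: "'a set" and E P\<^sub>A P\<^sub>B P\<^sub>C :: "'a set set" and s :: store
  assumes graph: "simple_graph V E" and part: "edge_partition E [P\<^sub>A, P\<^sub>B, P\<^sub>C]"
    and pfs: "pseudoforest V P\<^sub>A" "pseudoforest V P\<^sub>B" "pseudoforest V P\<^sub>C"
    and vs: "distinct vs" "set vs = V" and es: "distinct es" "set es = E"
    and inp: "input_store vs es [P\<^sub>A, P\<^sub>B, P\<^sub>C] s"
begin

abbreviation "n \<equiv> length vs"
abbreviation "m \<equiv> length es"
abbreviation "u \<equiv> s ''u''"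
abbreviation "v \<equiv> s ''v''"
abbreviation "c \<equiv> s ''part''"

lemma es_nth: "i < m \<Longrightarrow> es ! i = {vs ! u i, vs ! v i} \<and> u i < n \<and> v i < n \<and> c i < 3 \<and> es ! i \<in> [P\<^sub>A, P\<^sub>B, P\<^sub>C] ! c i"
proof -
  assume i: "i < m"
  have I: "\<forall>i<m. u i < n \<and> v i < n \<and> es ! i = {vs ! u i, vs ! v i}" "labels es [P\<^sub>A, P\<^sub>B, P\<^sub>C] c"
    using inp unfolding input_store_def by blast+
  have "c i < length [P\<^sub>A, P\<^sub>B, P\<^sub>C] \<and> es ! i \<in> [P\<^sub>A, P\<^sub>B, P\<^sub>C] ! c i" using I(2) i unfolding labels_def by blast
  then show ?thesis using I(1) i by (simp only: list.size) simp
qed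

lemma ends_neq: "i < m \<Longrightarrow> u i \<noteq> v i"
proof
  assume i: "i < m" "u i = v i"
  have "es ! i \<in> E" using i es by auto
  then have "card (es ! i) = 2" using graph by (simp add: simple_graph_def)
  then show False using es_nth[OF i(1)] i(2) by simp
qed

sublocale colored_graph n m u v c
proof
  fix i j assume ij: "i < m" "j < m" "{u i, v i} = {u j, v j}"
  have "es ! i = (!) vs ` {u i, v i}" "es ! j = (!) vs ` {u j, v j}"
    using es_nth[OF ij(1)] es_nth[OF ij(2)] by simp_all
  then have "es ! i = es ! j" unfolding ij(3) by simp
  then show "i = j" using es ij by (simp add: nth_eq_iff_index_eq)
qed (use es_nth ends_neq in simp_all)

text \<open>A component of slots stays within one part, and on that part the map \<open>?h\<close>
  to vertices is injective. It carries both cycles and their connection into a pseudoforest, where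
  they coincide.\<close>

sublocale pseudo_graph n m u v c
proof
  fix C1 C2 x y
  assume C: "is_cycle sgraph C1" "is_cycle sgraph C2" and xy: "x \<in> \<Union>C1" "y \<in> \<Union>C2" "(x, y) \<in> (adj_rel sgraph)\<^sup>*"
  define k where "k = x div n"
  let ?G = "sedge ` {i. i < m \<and> c i = k}"
  let ?P = "[P\<^sub>A, P\<^sub>B, P\<^sub>C] ! k"
  let ?h = "\<lambda>x. vs ! (x mod n)"
  have div_same: "p div n = c i" if "p \<in> sedge i" "i < m" for p i
    using that a_div b_div by (auto simp: sedge_def)
  have step: "q div n = k" if "{p, q} \<in> sgraph" "p div n = k" for p q
  proof -
    obtain i where "i < m" "{p, q} = sedge i" using \<open>{p, q} \<in> sgraph\<close> by (auto simp: sgraph_def)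
    moreover from this have "p \<in> sedge i" "q \<in> sedge i" by (metis insertCI)+
    ultimately show ?thesis using div_same[of p i] div_same[of q i] that(2) by metis
  qed
  have conn_k: "z div n = k" if "(x, z) \<in> (adj_rel sgraph)\<^sup>*" for z
    by (rule adj_rel_invariant[OF that]) (use step k_def in auto)
  have inG: "C \<subseteq> ?G" if C: "is_cycle sgraph C" "z \<in> \<Union>C" "(x, z) \<in> (adj_rel sgraph)\<^sup>*" for C z
  proof
    fix e assume e: "e \<in> C"
    have CS: "C \<subseteq> sgraph" using C by (auto simp: is_cycle_def)
    then obtain i where i: "i < m" "e = sedge i" using e by (auto simp: sgraph_def)
    have "a i \<in> \<Union>C" using i e by (auto simp: sedge_def)
    then have "(z, a i) \<in> (adj_rel C)\<^sup>*" using cycle_connected[OF C(1,2)] by blast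
    then have "(x, a i) \<in> (adj_rel sgraph)\<^sup>*" using adj_rel_mono[OF CS] C(3) by (meson rtrancl_trans subsetD)
    then have "c i = k" using conn_k[of "a i"] a_div[OF i(1)] by simp
    then show "e \<in> ?G" using i by simp
  qed
  have C1G: "C1 \<subseteq> ?G" using inG[OF C(1) xy(1) rtrancl_refl] .
  have C2G: "C2 \<subseteq> ?G" using inG[OF C(2) xy(2,3)] .
  have GU: "z < 3 * n \<and> z div n = k" if "z \<in> \<Union>?G" for z
    using that div_same a_less b_less by (auto simp: sedge_def)
  have inj: "inj_on ?h (\<Union>?G)"
  proof (rule inj_onI)
    fix p q assume pq: "p \<in> \<Union>?G" "q \<in> \<Union>?G" "vs ! (p mod n) = vs ! (q mod n)"
    have "0 < n" using GU[OF pq(1)] by (cases "n = 0") auto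
    then have "p mod n = q mod n" using pq(3) vs(1) by (simp add: nth_eq_iff_index_eq)
    moreover have "p div n = q div n" using GU pq by simp
    ultimately show "p = q" by (metis div_mult_mod_eq)
  qed
  obtain i0 where "i0 < m" "c i0 = k" using C1G xy(1) by auto
  then have k3: "k < 3" using c_less by auto
  have him: "?h ` sedge i = es ! i" if "i < m" for i
    using that es_nth[OF that] by (simp add: sedge_def a_mod b_mod)
  have hG: "(`) ?h ` ?G \<subseteq> ?P"
  proof
    fix f assume "f \<in> (`) ?h ` ?G"
    then obtain i where i: "i < m" "c i = k" "f = ?h ` sedge i" by blast
    then have "f = es ! i" using him by simp
    then show "f \<in> ?P" using es_nth[OF i(1)] i(2) by metis
  qed
  have pk: "pseudoforest V ?P"
  proof -
    have "k = 0 \<or> k = 1 \<or> k = 2" using k3 by linarith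
    then show ?thesis using pfs by auto
  qed
  have "?P \<subseteq> E" using part k3 unfolding edge_partition_def by (metis (no_types, lifting) Union_upper nth_mem length_Cons list.size(3) numeral_3_eq_3)
  then have PV: "\<Union>?P \<subseteq> V" using graph unfolding simple_graph_def by blast
  have cyc: "is_cycle ?P ((`) ?h ` C)" if "is_cycle sgraph C" "C \<subseteq> ?G" for C
    using is_cycle_mono[OF is_cycle_image[OF is_cycle_restrict[OF that] inj] hG] .
  have "(?h x, ?h y) \<in> (adj_rel ?P)\<^sup>*"
  proof -
    have st: "(?h x, ?h q) \<in> (adj_rel ?P)\<^sup>*" if "{p, q} \<in> sgraph" "(?h x, ?h p) \<in> (adj_rel ?P)\<^sup>* \<and> p div n = k" for p q
    proof -
      obtain i where i: "i < m" "{p, q} = sedge i" using \<open>{p, q} \<in> sgraph\<close> by (auto simp: sgraph_def)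
      have "p \<in> sedge i" using i(2) by (metis insertCI)
      then have "c i = k" using div_same[of p i] that(2) i(1) by simp
      then have "sedge i \<in> ?G" using i by auto
      then have "?h ` sedge i \<in> ?P" using hG by blast
      then have "{?h p, ?h q} \<in> ?P" unfolding i(2)[symmetric] by simp
      then show ?thesis using that(2) by (auto simp: adj_rel_def intro: rtrancl_into_rtrancl)
    qed
    have "(?h x, ?h y) \<in> (adj_rel ?P)\<^sup>* \<and> y div n = k"
      by (rule adj_rel_invariant[OF xy(3)]) (use st step k_def in auto)
    then show ?thesis by blast
  qed
  note conn = this
  have "?h x \<in> \<Union>((`) ?h ` C1)" "?h y \<in> \<Union>((`) ?h ` C2)" using xy(1,2) by auto
  from pseudoforest_cycles_connected[OF pk PV cyc[OF C(1) C1G] cyc[OF C(2) C2G] this conn]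
  have "(`) ?h ` C1 = (`) ?h ` C2" .
  moreover have "inj_on ((`) ?h) ?G" using inj_on_image[OF inj] .
  ultimately show "C1 = C2" using C1G C2G by (simp add: inj_on_image_eq_iff)
qed

lemma output_forests:
  assumes good: "good_output out"
  defines "F \<equiv> \<lambda>k. {es ! i | i. i < m \<and> out i = k}"
  shows "labels es [F 0, F 1, F 2, F 3] out" "edge_partition E [F 0, F 1, F 2, F 3]"
    "k < 4 \<Longrightarrow> forest (F k)" "p \<in> V \<Longrightarrow> degree (F 3) p \<le> 3"
proof -
  have out: "out i < 4" if "i < m" for i using good that by (simp add: good_output_def)
  have nth4: "[F 0, F 1, F 2, F 3] ! k = F k" if "k < 4" for k
  proof -
    have "k = 0 \<or> k = 1 \<or> k = 2 \<or> k = 3" using that by linarith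
    then show ?thesis by auto
  qed
  show "labels es [F 0, F 1, F 2, F 3] out"
    unfolding labels_def
  proof (intro allI impI)
    fix i assume i: "i < m"
    have "es ! i \<in> F (out i)" using i by (auto simp: F_def)
    then show "out i < length [F 0, F 1, F 2, F 3] \<and> es ! i \<in> [F 0, F 1, F 2, F 3] ! out i"
      using out[OF i] nth4 by simp
  qed
  show "edge_partition E [F 0, F 1, F 2, F 3]"
    unfolding edge_partition_def
  proof (intro conjI allI impI)
    show "\<Union>(set [F 0, F 1, F 2, F 3]) = E"
    proof
      show "\<Union>(set [F 0, F 1, F 2, F 3]) \<subseteq> E" using es by (auto simp: F_def)
      show "E \<subseteq> \<Union>(set [F 0, F 1, F 2, F 3])"
      proof
        fix e assume "e \<in> E"
        then obtain i where i: "i < m" "e = es ! i" using es by (metis in_set_conv_nth)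
        then have "out i = 0 \<or> out i = 1 \<or> out i = 2 \<or> out i = 3" using out[OF i(1)] by linarith
        then show "e \<in> \<Union>(set [F 0, F 1, F 2, F 3])" using i by (auto simp: F_def)
      qed
    qed
    fix i j assume ij: "i < length [F 0, F 1, F 2, F 3]" "j < length [F 0, F 1, F 2, F 3]" "i \<noteq> j"
    have "F i \<inter> F j = {}" using ij(3) es(1) by (auto simp: F_def nth_eq_iff_index_eq)
    then show "[F 0, F 1, F 2, F 3] ! i \<inter> [F 0, F 1, F 2, F 3] ! j = {}" using ij nth4 by simp
  qed
  have im: "F k = (`) ((!) vs) ` {vedge i | i. i < m \<and> out i = k}" for k
  proof -
    have "(!) vs ` vedge i = es ! i" if "i < m" for i using es_nth[OF that] by (simp add: vedge_def)
    then show ?thesis unfolding F_def by (auto simp: image_iff)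
  qed
  show "forest (F k)" if "k < 4"
  proof -
    have "forest {vedge i | i. i < m \<and> out i = k}" using good that by (simp add: good_output_def)
    moreover have "\<Union>{vedge i | i. i < m \<and> out i = k} \<subseteq> {..<n}" using u_less v_less by (auto simp: vedge_def)
    then have "inj_on ((!) vs) (\<Union>{vedge i | i. i < m \<and> out i = k})"
      using inj_on_nth[OF vs(1)] by (rule_tac inj_on_subset) auto
    ultimately show ?thesis unfolding im by (rule forest_image)
  qed
  show "degree (F 3) p \<le> 3" if "p \<in> V"
  proof -
    obtain q where q: "q < n" "p = vs ! q" using \<open>p \<in> V\<close> vs by (metis in_set_conv_nth)
    let ?I = "{i. i < m \<and> out i = 3 \<and> q \<in> vedge i}"
    have "{e \<in> F 3. p \<in> e} \<subseteq> (!) es ` ?I"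
    proof
      fix e assume "e \<in> {e \<in> F 3. p \<in> e}"
      then obtain i where i: "i < m" "out i = 3" "e = es ! i" "p \<in> e" by (auto simp: F_def)
      then have "vs ! q = vs ! u i \<or> vs ! q = vs ! v i" using es_nth[OF i(1)] q by auto
      then have "q = u i \<or> q = v i" using es_nth[OF i(1)] q(1) vs(1) by (simp add: nth_eq_iff_index_eq)
      then show "e \<in> (!) es ` ?I" using i by (auto simp: vedge_def)
    qed
    moreover have "finite ?I" by simp
    ultimately have "card {e \<in> F 3. p \<in> e} \<le> card ?I" by (rule surj_card_le[rotated])
    also have "\<dots> \<le> 3" using good by (simp add: good_output_def)
    finally show ?thesis by (simp add: degree_def)
  qed
qed

lemma input_bounded:
  assumes "10 * n + 10 * m + 10 \<le> W" shows "bounded W s"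
  unfolding bounded_def
proof (intro allI)
  fix x i
  have z: "\<not> (x \<in> {''n'', ''m''} \<and> i = 0 \<or> x \<in> {''u'', ''v'', ''part''} \<and> i < m) \<Longrightarrow> s x i = 0"
    and nm: "s ''n'' 0 = n" "s ''m'' 0 = m" using inp unfolding input_store_def by blast+
  show "s x i \<le> W"
  proof (cases "x \<in> {''n'', ''m''} \<and> i = 0 \<or> x \<in> {''u'', ''v'', ''part''} \<and> i < m")
    case True
    then show ?thesis using nm es_nth[of i] assms by auto
  next
    case False then show ?thesis using z by simp
  qed
qed

lemma input_zeroed: "zeroed init_vars0 s"
  using inp unfolding input_store_def zeroed_def vars0_defs by (auto simp del: One_nat_def)

end

theorem theorem16:
  "\<exists>(p :: com) (k :: nat).
     \<forall>(V :: 'a set) E P\<^sub>A P\<^sub>B P\<^sub>C.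
       simple_graph V E \<and> edge_partition E [P\<^sub>A, P\<^sub>B, P\<^sub>C] \<and>
       pseudoforest V P\<^sub>A \<and> pseudoforest V P\<^sub>B \<and> pseudoforest V P\<^sub>C \<longrightarrow>
       (\<forall>vs es s.
          distinct vs \<and> set vs = V \<and> distinct es \<and> set es = E \<and>
          input_store vs es [P\<^sub>A, P\<^sub>B, P\<^sub>C] s \<longrightarrow>
          (\<exists>t s' F\<^sub>1 F\<^sub>2 F\<^sub>3 F\<^sub>4.
             exec (k * (card V + card E + 1)) p s t s' \<and>
             t \<le> k * (card V + card E + 1) \<and>
             output_store es [F\<^sub>1, F\<^sub>2, F\<^sub>3, F\<^sub>4] s' \<and>
             edge_partition E [F\<^sub>1, F\<^sub>2, F\<^sub>3, F\<^sub>4] \<and>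
             (\<forall>F \<in> {F\<^sub>1, F\<^sub>2, F\<^sub>3, F\<^sub>4}. forest F) \<and>
             (\<exists>F \<in> {F\<^sub>1, F\<^sub>2, F\<^sub>3, F\<^sub>4}. \<forall>v \<in> V. degree F v \<le> 3)))"
proof -
  let ?p = "set_N ;; init_loop ;; peel_loop ;; walk_loop ;; group_loop ;; match_loop ;; grow_loop"
  let ?k = "100 * total_cost"
  show ?thesis
  proof (rule exI[of _ ?p], rule exI[of _ ?k], intro allI impI, elim conjE)
    fix V :: "'a set" and E P\<^sub>A P\<^sub>B P\<^sub>C vs es s
    assume A: "simple_graph V E" "edge_partition E [P\<^sub>A, P\<^sub>B, P\<^sub>C]" "pseudoforest V P\<^sub>A" "pseudoforest V P\<^sub>B" "pseudoforest V P\<^sub>C"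
      "distinct vs" "set vs = V" "distinct es" "set es = E" "input_store vs es [P\<^sub>A, P\<^sub>B, P\<^sub>C] s"
    interpret partition_input vs es V E P\<^sub>A P\<^sub>B P\<^sub>C s using A by unfold_locales
    have card: "card V = length vs" "card E = length es" using A distinct_card by metis+
    show "\<exists>t s' F\<^sub>1 F\<^sub>2 F\<^sub>3 F\<^sub>4.
             exec (?k * (card V + card E + 1)) ?p s t s' \<and>
             t \<le> ?k * (card V + card E + 1) \<and>
             output_store es [F\<^sub>1, F\<^sub>2, F\<^sub>3, F\<^sub>4] s' \<and>
             edge_partition E [F\<^sub>1, F\<^sub>2, F\<^sub>3, F\<^sub>4] \<and>
             (\<forall>F \<in> {F\<^sub>1, F\<^sub>2, F\<^sub>3, F\<^sub>4}. forest F) \<and>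
             (\<exists>F \<in> {F\<^sub>1, F\<^sub>2, F\<^sub>3, F\<^sub>4}. \<forall>v \<in> V. degree F v \<le> 3)"
    proof -
      \<comment> \<open>One value serves as word bound and as time bound; its factor exceeds the 10
        that the phases require of the word bound.\<close>
      let ?W = "?k * (card V + card E + 1)"
      have "10 \<le> ?k" by (simp add: total_cost_def)
      then have "10 * (card V + card E + 1) \<le> ?W" by (rule mult_right_mono) simp
      then have W: "10 * length vs + 10 * length es + 10 \<le> ?W" unfolding card by (simp add: distrib_left)
      have nm: "s ''n'' 0 = length vs" "s ''m'' 0 = length es" using A(10) unfolding input_store_def by blast+
      have "runs ?W ?p s ?W (\<lambda>s. good_output (s ''out''))"
        using program_correct[OF nm _ input_zeroed W input_bounded[OF W]] unfolding card by simp
      then obtain t s' where t: "exec ?W ?p s t s'" "t \<le> ?W" "good_output (s' ''out'')"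
        unfolding runs_def by blast
      let ?F = "\<lambda>k. {es ! i | i. i < length es \<and> s' ''out'' i = k}"
      note O = output_forests[OF t(3)]
      have "\<forall>F \<in> {?F 0, ?F 1, ?F 2, ?F 3}. forest F" using O(3) by simp
      moreover have "\<exists>F \<in> {?F 0, ?F 1, ?F 2, ?F 3}. \<forall>v \<in> V. degree F v \<le> 3"
        by (rule bexI[of _ "?F 3"]) (use O(4) in auto)
      ultimately show ?thesis unfolding output_store_def using t(1,2) O(1,2) by blast
    qed
  qed
qed

end
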